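(* Let $\vec{a}=(0,0,1)$ and let $M$ be an embedded compact singular minimal surface in $\mathbb{R}^3_+=\{z>0\}$ whose boundary is a circle contained in a horizontal plane. Then $M$ is a surface of revolution whose rotation axis is vertical.
   Context: Let $\vec{a}=(0,0,1)$ and $\mathbb{R}^3_+=\{(x,y,z)\in\mathbb{R}^3:z>0\}$. For a real number $\alpha\neq 0$, an $\alpha$-singular minimal surface is a smooth immersion $\phi:M\to\mathbb{R}^3_+$ of an oriented surface $M$ (possibly with smooth boundary) such that $2H=\alpha\,\langle N,\vec{a}\rangle/\langle\phi,\vec{a}\rangle$ on $M$, where $N$ is the Gauss map and $H$ the mean curvature (half the sum of the principal curvatures, with sign such that $\Delta\phi=2HN$ for the Laplace-Beltrami operator of the induced metric). A singular minimal surface is an $\alpha$-singular minimal surface for some real $\alpha\neq0$. A surface has boundary $\Gamma$ if the restriction of the immersion to $\partial M$ is a diffeomorphism onto $\Gamma$. Horizontal (resp. vertical) means orthogonal (resp. parallel) to $\vec{a}$. *)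

theory Defs
  imports "HOL-Analysis.Analysis"
begin

section \<open>Smooth maps\<close>

primrec Ck_on :: "nat \<Rightarrow> ('a::real_normed_vector \<Rightarrow> 'b::real_normed_vector) \<Rightarrow> 'a set \<Rightarrow> bool" where
  "Ck_on 0 f U \<longleftrightarrow> continuous_on U f"
| "Ck_on (Suc k) f U \<longleftrightarrow>
     f differentiable_on U \<and> (\<forall>v. Ck_on k (\<lambda>x. frechet_derivative f (at x) v) U)"

text \<open>Intended for open \<open>U\<close> only, since full derivatives \<open>at x\<close> are used.\<close>

definition smooth_on :: "('a::real_normed_vector \<Rightarrow> 'b::real_normed_vector) \<Rightarrow> 'a set \<Rightarrow> bool" where
  "smooth_on f U \<longleftrightarrow> (\<forall>k. Ck_on k f U)"

section \<open>Embedded surfaces with boundary\<close>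

definition half_plane :: "(real^2) set" where
  "half_plane = {u. u $ 2 \<ge> 0}"

text \<open>
  An embedded surface is identified with its image in space. A chart parametrizes a relatively
  open piece of \<open>S\<close> by the part of the open set \<open>V\<close> in the closed half-plane; smoothness up to
  the edge of the half-plane means that \<open>X\<close> is smooth on all of \<open>V\<close>. Values of \<open>X\<close> outside the
  half-plane are irrelevant.
\<close>

definition surface_chart :: "(real^3) set \<Rightarrow> (real^2) set \<Rightarrow> (real^2 \<Rightarrow> real^3) \<Rightarrow> bool" where
  "surface_chart S V X \<longleftrightarrow>
     open V \<and> smooth_on X V \<and>
     (\<forall>u \<in> V \<inter> half_plane. inj (frechet_derivative X (at u))) \<and>
     openin (top_of_set S) (X ` (V \<inter> half_plane)) \<and>
     (\<exists>Y. homeomorphism (V \<inter> half_plane) (X ` (V \<inter> half_plane)) X Y)"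

definition embedded_surface :: "(real^3) set \<Rightarrow> bool" where
  "embedded_surface S \<longleftrightarrow>
     (\<forall>p\<in>S. \<exists>V X. surface_chart S V X \<and> p \<in> X ` (V \<inter> half_plane))"

definition surface_boundary :: "(real^3) set \<Rightarrow> (real^3) set" where
  "surface_boundary S = {X u | V X u. surface_chart S V X \<and> u \<in> V \<and> u $ 2 = 0}"

definition tangent_plane :: "(real^3) set \<Rightarrow> real^3 \<Rightarrow> (real^3) set" where
  "tangent_plane S p =
     {frechet_derivative X (at u) w | V X u w.
        surface_chart S V X \<and> u \<in> V \<inter> half_plane \<and> X u = p}"

section \<open>Gauss map and mean curvature\<close>

text \<open>
  An orientation of an embedded surface is a continuous unit normal field; such a field is
  automatically smooth.
\<close>

definition gauss_map :: "(real^3) set \<Rightarrow> (real^3 \<Rightarrow> real^3) \<Rightarrow> bool" where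
  "gauss_map S N \<longleftrightarrow>
     continuous_on S N \<and>
     (\<forall>p\<in>S. norm (N p) = 1 \<and> (\<forall>v \<in> tangent_plane S p. N p \<bullet> v = 0))"

text \<open>
  The differential of \<open>N\<close> along \<open>S\<close> is the derivative within \<open>S\<close>. As a linear map on space it is
  not unique, but its restriction to the tangent plane (also at boundary points) is.
  The shape operator is minus the differential of \<open>N\<close>, so the outward-oriented unit sphere has
  principal curvatures \<open>-1\<close>. This is the sign for which \<open>\<Delta>\<phi> = 2 H N\<close>.
\<close>

definition principal_direction ::
    "(real^3) set \<Rightarrow> (real^3 \<Rightarrow> real^3) \<Rightarrow> real^3 \<Rightarrow> real \<Rightarrow> real^3 \<Rightarrow> bool" where
  "principal_direction S N p k e \<longleftrightarrow>
     e \<in> tangent_plane S p \<and> norm e = 1 \<and>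
     (\<exists>dN. (N has_derivative dN) (at p within S) \<and> - dN e = k *\<^sub>R e)"

definition mean_curvature :: "(real^3) set \<Rightarrow> (real^3 \<Rightarrow> real^3) \<Rightarrow> real^3 \<Rightarrow> real" where
  "mean_curvature S N p =
     (THE H. \<exists>k1 k2 e1 e2.
        principal_direction S N p k1 e1 \<and> principal_direction S N p k2 e2 \<and>
        e1 \<bullet> e2 = 0 \<and> H = (k1 + k2) / 2)"

section \<open>Singular minimal surfaces\<close>

definition vertical :: "real^3" where
  "vertical = vector [0, 0, 1]"

definition upper_half_space :: "(real^3) set" where
  "upper_half_space = {p. p $ 3 > 0}"

definition alpha_singular_minimal_surface ::
    "real \<Rightarrow> (real^3) set \<Rightarrow> (real^3 \<Rightarrow> real^3) \<Rightarrow> bool" where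
  "alpha_singular_minimal_surface \<alpha> S N \<longleftrightarrow>
     embedded_surface S \<and> S \<subseteq> upper_half_space \<and> gauss_map S N \<and>
     (\<forall>p\<in>S. 2 * mean_curvature S N p = \<alpha> * ((N p \<bullet> vertical) / (p \<bullet> vertical)))"

definition singular_minimal_surface :: "(real^3) set \<Rightarrow> bool" where
  "singular_minimal_surface S \<longleftrightarrow>
     (\<exists>\<alpha> N. \<alpha> \<noteq> 0 \<and> alpha_singular_minimal_surface \<alpha> S N)"

section \<open>Circles, horizontal planes, surfaces of revolution\<close>

definition is_circle :: "(real^3) set \<Rightarrow> bool" where
  "is_circle C \<longleftrightarrow>
     (\<exists>c n r. n \<noteq> 0 \<and> r > 0 \<and> C = {p. (p - c) \<bullet> n = 0 \<and> dist p c = r})"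

definition horizontal_plane :: "(real^3) set \<Rightarrow> bool" where
  "horizontal_plane P \<longleftrightarrow> (\<exists>h. P = {p. p \<bullet> vertical = h})"

text \<open>
  The axis is the line through \<open>q\<close> with direction \<open>d\<close>; a rotation about it is
  \<open>x \<mapsto> q + A (x - q)\<close> with \<open>A\<close> in \<open>SO(3)\<close> fixing \<open>d\<close>.
\<close>

definition surface_of_revolution :: "(real^3) set \<Rightarrow> real^3 \<Rightarrow> real^3 \<Rightarrow> bool" where
  "surface_of_revolution S q d \<longleftrightarrow>
     embedded_surface S \<and> d \<noteq> 0 \<and>
     (\<forall>A :: real^3^3. rotation_matrix A \<and> A *v d = d \<longrightarrow> (\<lambda>x. q + A *v (x - q)) ` S = S)"

end

theory Submission
  imports Defs
begin

text \<open>
  On a singular minimal surface the operator \<open>L = \<Delta> + (\<alpha> / z) \<langle>\<nabla> z, \<nabla> \<cdot>\<rangle>\<close> annihilates the horizontal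
  coordinates, and \<open>L z = \<alpha> / z\<close>. Hence the surface lies in the solid cylinder over the boundary disc and
  on one side of the boundary plane, which it leaves at a positive angle. Alexandrov reflection in
  vertical planes moving towards the axis then meets no first contact. Since the equation does not
  depend on the orientation, the side from which the surfaces touch is irrelevant, so the surface
  need not bound a domain and no separation theorem is used: the moving plane is replaced by the
  maximum, over all pairs of points on a common line of direction \<open>e\<close>, of the position of their
  midpoint. Consequently a horizontal direction can only be tangent to the surface at a point of the
  vertical plane through the axis orthogonal to it. This says that the rotation field about the axis
  is tangent to the surface, so the surface is invariant under its flow.
\<close>

section \<open>Calculus\<close>

text \<open>The usual reflection argument writes two touching sheets as graphs over a common plane
  and studies the linear elliptic equation of their difference. Here a local defining function
  \<open>\<phi>\<close> of one sheet is composed with the reflection and restricted to the other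
  sheet. Off its zero set only the bound \<open>K * \<bar>\<phi> x\<bar>\<close> on
  \<open>sms_op\<close> is known, but that suffices: every maximum principle below comes down to the
  second derivative test at a single point of \<open>M\<close>, where subtracting a Hopf barrier
  makes the operator strictly negative. When two distinct points touch, coincidence of the sheets is
  only local. Instead of continuing it along a component, a linear function is maximized over the
  whole coincidence set; a small tilt by the height gives this function an operator of strict sign,
  so the maximum cannot be interior. The behaviour at the boundary circle serves only to keep
  contact points off it.\<close>

lemma smooth_on_continuous: "smooth_on f U \<Longrightarrow> continuous_on U f"
  unfolding smooth_on_def by (metis Ck_on.simps(1))

lemma smooth_on_has_derivative:
  assumes "smooth_on f U" "open U" "x \<in> U"
  shows "(f has_derivative frechet_derivative f (at x)) (at x)"
proof -
  have "Ck_on (Suc 0) f U"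
    using assms(1) unfolding smooth_on_def by blast
  then have "f differentiable_on U" by simp
  then have "f differentiable (at x)"
    using assms differentiable_on_eq_differentiable_at by blast
  then show ?thesis by (simp add: frechet_derivative_works[symmetric])
qed

lemma smooth_on_frechet_derivative:
  "smooth_on f U \<Longrightarrow> smooth_on (\<lambda>x. frechet_derivative f (at x) v) U"
  unfolding smooth_on_def by (metis Ck_on.simps(2))

lemma smooth_on_subset:
  assumes "smooth_on f U" "W \<subseteq> U" shows "smooth_on f W"
proof -
  have "Ck_on k g W" if "Ck_on k g U" for k and g :: "'a \<Rightarrow> 'b"
    using that
  proof (induction k arbitrary: g)
    case 0 then show ?case using assms(2) continuous_on_subset by auto
  next
    case (Suc k)
    then show ?case
      using assms(2) differentiable_on_subset by fastforce
  qed
  then show ?thesis using assms(1) unfolding smooth_on_def by blast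
qed

text \<open>The mean value inequality applies to \<open>f - f' x0\<close>, whose derivative is small
  near \<open>x0\<close>; an error of \<open>\<eta> / DIM('a)\<close> for each basis vector adds up
  to \<open>\<eta>\<close>. Both endpoints vary, which is what the control of arbitrary short chords
  of a surface requires.\<close>

lemma strict_differentiability:
  fixes f :: "'a::euclidean_space \<Rightarrow> 'b::real_normed_vector"
  assumes U: "open U" "x0 \<in> U"
    and der: "\<And>x. x \<in> U \<Longrightarrow> (f has_derivative f' x) (at x)"
    and cont: "\<And>b. b \<in> Basis \<Longrightarrow> continuous (at x0) (\<lambda>x. f' x b)"
    and \<eta>: "\<eta> > 0"
  shows "\<exists>\<delta>>0. ball x0 \<delta> \<subseteq> U \<and>
    (\<forall>u\<in>ball x0 \<delta>. \<forall>v\<in>ball x0 \<delta>. norm (f u - f v - f' x0 (u - v)) \<le> \<eta> * norm (u - v))"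
proof -
  define \<epsilon> where "\<epsilon> = \<eta> / real DIM('a)"
  have "\<epsilon> > 0" using \<eta> by (simp add: \<epsilon>_def)
  have "\<forall>\<^sub>F x in at x0. \<forall>b\<in>Basis. dist (f' x b) (f' x0 b) < \<epsilon>"
    using cont \<open>\<epsilon> > 0\<close> by (intro eventually_ball_finite) (auto simp: continuous_at tendsto_iff)
  then obtain d where d: "d > 0" "\<And>x. \<lbrakk>x \<noteq> x0; dist x x0 < d\<rbrakk> \<Longrightarrow> \<forall>b\<in>Basis. dist (f' x b) (f' x0 b) < \<epsilon>"
    unfolding eventually_at by auto
  have d2: "dist (f' x b) (f' x0 b) < \<epsilon>" if "dist x x0 < d" "b \<in> Basis" for x b
    using d that \<open>\<epsilon> > 0\<close> by (cases "x = x0") auto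
  obtain d' where d': "d' > 0" "ball x0 d' \<subseteq> U" using U open_contains_ball by blast
  let ?\<delta> = "min d d'"
  have sub: "ball x0 ?\<delta> \<subseteq> U" using d' by auto
  have lin: "linear (f' x)" if "x \<in> U" for x
    using der[OF that] has_derivative_linear by blast
  define g where "g = (\<lambda>x. f x - f' x0 x)"
  have gder: "(g has_derivative (\<lambda>h. f' x h - f' x0 h)) (at x within ball x0 ?\<delta>)" if "x \<in> ball x0 ?\<delta>" for x
    unfolding g_def
    by (intro has_derivative_at_withinI[OF has_derivative_diff] der bounded_linear_imp_has_derivative)
       (use sub that der[OF U(2)] has_derivative_bounded_linear in auto)
  have on: "onorm (\<lambda>h. f' x h - f' x0 h) \<le> \<eta>" if x: "x \<in> ball x0 ?\<delta>" for x
  proof (rule onorm_le)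
    fix h
    have "f' x h - f' x0 h = (\<Sum>b\<in>Basis. (h \<bullet> b) *\<^sub>R (f' x b - f' x0 b))"
    proof -
      interpret l1: linear "f' x" using lin sub x by blast
      interpret l0: linear "f' x0" using lin U by blast
      have "f' x (\<Sum>b\<in>Basis. (h \<bullet> b) *\<^sub>R b) - f' x0 (\<Sum>b\<in>Basis. (h \<bullet> b) *\<^sub>R b) = (\<Sum>b\<in>Basis. (h \<bullet> b) *\<^sub>R (f' x b - f' x0 b))"
        by (simp add: l1.sum l0.sum l1.scaleR l0.scaleR sum_subtractf algebra_simps)
      then show ?thesis by (simp add: euclidean_representation)
    qed
    also have "norm \<dots> \<le> (\<Sum>b\<in>(Basis::'a set). norm h * \<epsilon>)"
    proof (rule sum_norm_le)
      fix b :: 'a assume b: "b \<in> Basis"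
      have "norm (f' x b - f' x0 b) \<le> \<epsilon>"
        using d2[of x b] b x by (simp add: dist_norm dist_commute norm_minus_commute)
      then show "norm ((h \<bullet> b) *\<^sub>R (f' x b - f' x0 b)) \<le> norm h * \<epsilon>"
        using Basis_le_norm[OF b, of h] by (simp add: mult_mono)
    qed
    also have "\<dots> = \<eta> * norm h" by (simp add: \<epsilon>_def)
    finally show "norm (f' x h - f' x0 h) \<le> \<eta> * norm h" .
  qed
  have "norm (f u - f v - f' x0 (u - v)) \<le> \<eta> * norm (u - v)"
    if "u \<in> ball x0 ?\<delta>" "v \<in> ball x0 ?\<delta>" for u v
  proof -
    have "norm (g u - g v) \<le> \<eta> * norm (u - v)"
      by (rule differentiable_bound[OF convex_ball gder on]) (use that in auto)
    moreover have "g u - g v = f u - f v - f' x0 (u - v)"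
      using linear_diff[OF lin[OF U(2)]] by (simp add: g_def algebra_simps)
    ultimately show ?thesis by simp
  qed
  then show ?thesis using sub d(1) d'(1) by (intro exI[of _ ?\<delta>]) auto
qed

text \<open>Peano's form of Schwarz's theorem: the second difference quotient tends to either mixed
  derivative.\<close>

lemma second_difference_tendsto:
  fixes f :: "'a::real_normed_vector \<Rightarrow> real"
  assumes U: "open U" "x0 \<in> U"
    and der: "\<And>x. x \<in> U \<Longrightarrow> (f has_derivative f' x) (at x)"
    and der2: "((\<lambda>x. f' x a) has_derivative B) (at x0)"
  shows "((\<lambda>h. (f (x0 + h *\<^sub>R a + h *\<^sub>R b) - f (x0 + h *\<^sub>R a) - f (x0 + h *\<^sub>R b) + f x0) / h\<^sup>2)
           \<longlongrightarrow> B b) (at_right 0)"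
proof (rule tendstoI)
  fix e :: real assume "e > 0"
  define K where "K = 2 * norm a + norm b + 1"
  have K: "K > 0" by (simp add: K_def add_nonneg_pos)
  interpret B: bounded_linear B using der2 has_derivative_bounded_linear by blast
  obtain d where d: "d > 0" "\<And>y. norm (y - x0) < d \<Longrightarrow> norm (f' y a - f' x0 a - B (y - x0)) \<le> e / (4 * K) * norm (y - x0)"
  proof -
    have "e / (4 * K) > 0" using \<open>e > 0\<close> K by simp
    then show ?thesis using der2 that unfolding has_derivative_at_alt by blast
  qed
  obtain d' where d': "d' > 0" "ball x0 d' \<subseteq> U" using U open_contains_ball by blast
  define D where "D = min d d' / K"
  have D: "D > 0" using d(1) d'(1) K by (simp add: D_def)
  have main: "dist ((f (x0 + h *\<^sub>R a + h *\<^sub>R b) - f (x0 + h *\<^sub>R a) - f (x0 + h *\<^sub>R b) + f x0) / h\<^sup>2) (B b) < e"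
    if h: "0 < h" "h < D" for h
  proof -
    have hK: "h * K < min d d'" using h K by (simp add: D_def field_simps)
    have nb: "norm (t *\<^sub>R a + c *\<^sub>R b) \<le> h * K" if "\<bar>t\<bar> \<le> h" "\<bar>c\<bar> \<le> h" for t c
    proof -
      have "norm (t *\<^sub>R a + c *\<^sub>R b) \<le> \<bar>t\<bar> * norm a + \<bar>c\<bar> * norm b"
        by (metis norm_scaleR norm_triangle_ineq)
      also have "\<dots> \<le> h * norm a + h * norm b" using that by (intro add_mono mult_right_mono) auto
      also have "\<dots> \<le> h * K" using h by (simp add: K_def algebra_simps)
      finally show ?thesis .
    qed
    have inU: "x0 + t *\<^sub>R a + c *\<^sub>R b \<in> U" if "\<bar>t\<bar> \<le> h" "\<bar>c\<bar> \<le> h" for t c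
    proof -
      have "norm (t *\<^sub>R a + c *\<^sub>R b) < d'" using nb[OF that] hK by linarith
      then have "x0 + t *\<^sub>R a + c *\<^sub>R b \<in> ball x0 d'"
        by (metis add.assoc add_diff_cancel_left' dist_norm dist_commute mem_ball)
      then show ?thesis using d' by blast
    qed
    \<comment> \<open>The mean value theorem for the difference of two parallel edges leaves an
      increment of \<open>f' _ a\<close> over \<open>h *\<^sub>R b\<close>, and differentiability at
      \<open>x0\<close> evaluates it up to \<open>o(h)\<close>.\<close>
    define \<phi> where "\<phi> = (\<lambda>t. f (x0 + t *\<^sub>R a + h *\<^sub>R b) - f (x0 + t *\<^sub>R a))"
    have comp: "((\<lambda>t. f (x0 + t *\<^sub>R a + c *\<^sub>R b)) has_real_derivative f' (x0 + t *\<^sub>R a + c *\<^sub>R b) a) (at t)"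
      if "\<bar>t\<bar> \<le> h" "\<bar>c\<bar> \<le> h" for t c
    proof -
      have 1: "((\<lambda>t. x0 + t *\<^sub>R a + c *\<^sub>R b) has_derivative (\<lambda>s. s *\<^sub>R a)) (at t)"
        by (auto intro!: derivative_eq_intros)
      have 2: "((\<lambda>t. f (x0 + t *\<^sub>R a + c *\<^sub>R b)) has_derivative (\<lambda>s. f' (x0 + t *\<^sub>R a + c *\<^sub>R b) (s *\<^sub>R a))) (at t)"
        using has_derivative_compose[OF 1 der[OF inU[OF that]]] .
      have "linear (f' (x0 + t *\<^sub>R a + c *\<^sub>R b))"
        using der[OF inU[OF that]] has_derivative_linear by blast
      then have "(\<lambda>s. f' (x0 + t *\<^sub>R a + c *\<^sub>R b) (s *\<^sub>R a)) = (\<lambda>s. s * f' (x0 + t *\<^sub>R a + c *\<^sub>R b) a)"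
        by (simp add: linear_scale)
      then have "(\<lambda>s. f' (x0 + t *\<^sub>R a + c *\<^sub>R b) (s *\<^sub>R a)) = (*) (f' (x0 + t *\<^sub>R a + c *\<^sub>R b) a)"
        by (simp add: mult.commute fun_eq_iff)
      then show ?thesis using 2 by (simp add: has_field_derivative_def)
    qed
    have "\<exists>z>0. z < h \<and> \<phi> h - \<phi> 0 = (h - 0) * (f' (x0 + z *\<^sub>R a + h *\<^sub>R b) a - f' (x0 + z *\<^sub>R a) a)"
    proof (rule MVT2[OF h(1)])
      fix t assume t: "0 \<le> t" "t \<le> h"
      show "(\<phi> has_real_derivative f' (x0 + t *\<^sub>R a + h *\<^sub>R b) a - f' (x0 + t *\<^sub>R a) a) (at t)"
        unfolding \<phi>_def using comp[of t h] comp[of t 0] t by (intro DERIV_diff) auto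
    qed
    then obtain z where z: "0 < z" "z < h" "\<phi> h - \<phi> 0 = h * (f' (x0 + z *\<^sub>R a + h *\<^sub>R b) a - f' (x0 + z *\<^sub>R a) a)"
      by auto
    define y1 where "y1 = z *\<^sub>R a + h *\<^sub>R b"
    define y2 where "y2 = z *\<^sub>R a"
    have n1: "norm y1 \<le> h * K" using nb[of z h] z h by (simp add: y1_def)
    have n2: "norm y2 \<le> h * K" using nb[of z 0] z h by (simp add: y2_def)
    have e1: "norm (f' (x0 + y1) a - f' x0 a - B y1) \<le> e / (4 * K) * (h * K)"
    proof -
      have "norm (f' (x0 + y1) a - f' x0 a - B y1) \<le> e / (4 * K) * norm y1"
        using d(2)[of "x0 + y1"] n1 hK by simp
      also have "\<dots> \<le> e / (4 * K) * (h * K)" using n1 \<open>e > 0\<close> K by (intro mult_left_mono) auto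
      finally show ?thesis .
    qed
    have e2: "norm (f' (x0 + y2) a - f' x0 a - B y2) \<le> e / (4 * K) * (h * K)"
    proof -
      have "norm (f' (x0 + y2) a - f' x0 a - B y2) \<le> e / (4 * K) * norm y2"
        using d(2)[of "x0 + y2"] n2 hK by simp
      also have "\<dots> \<le> e / (4 * K) * (h * K)" using n2 \<open>e > 0\<close> K by (intro mult_left_mono) auto
      finally show ?thesis .
    qed
    have Bd: "B y1 - B y2 = h * B b" by (simp add: y1_def y2_def B.add B.scaleR)
    have "\<bar>f' (x0 + y1) a - f' (x0 + y2) a - h * B b\<bar> \<le> 2 * (e / (4 * K) * (h * K))"
      using e1 e2 Bd by (simp add: abs_le_iff)
    also have "\<dots> = e * h / 2" using K by simp
    finally have le: "\<bar>f' (x0 + y1) a - f' (x0 + y2) a - h * B b\<bar> \<le> e * h / 2" .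
    have "f (x0 + h *\<^sub>R a + h *\<^sub>R b) - f (x0 + h *\<^sub>R a) - f (x0 + h *\<^sub>R b) + f x0
       = h * (f' (x0 + y1) a - f' (x0 + y2) a)"
      using z(3) by (simp add: \<phi>_def y1_def y2_def add.assoc)
    then have eq: "(f (x0 + h *\<^sub>R a + h *\<^sub>R b) - f (x0 + h *\<^sub>R a) - f (x0 + h *\<^sub>R b) + f x0) / h\<^sup>2
       = (f' (x0 + y1) a - f' (x0 + y2) a) / h"
      using h by (simp add: power2_eq_square)
    have "\<bar>(f' (x0 + y1) a - f' (x0 + y2) a) / h - B b\<bar> = \<bar>f' (x0 + y1) a - f' (x0 + y2) a - h * B b\<bar> / h"
    proof -
      have "(f' (x0 + y1) a - f' (x0 + y2) a) / h - B b = (f' (x0 + y1) a - f' (x0 + y2) a - h * B b) / h"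
        using h by (simp add: diff_divide_distrib)
      then show ?thesis using h by simp
    qed
    also have "\<dots> \<le> (e * h / 2) / h" using le h by (intro divide_right_mono) auto
    also have "\<dots> < e" using \<open>e > 0\<close> h by simp
    finally show ?thesis unfolding eq dist_real_def .
  qed
  show "\<forall>\<^sub>F h in at_right 0. dist ((f (x0 + h *\<^sub>R a + h *\<^sub>R b) - f (x0 + h *\<^sub>R a) - f (x0 + h *\<^sub>R b) + f x0) / h\<^sup>2) (B b) < e"
    unfolding eventually_at_right_field using D main by (intro exI[of _ D]) auto
qed

lemma mixed_derivatives_eq_real:
  fixes f :: "'a::real_normed_vector \<Rightarrow> real"
  assumes U: "open U" "x0 \<in> U"
    and der: "\<And>x. x \<in> U \<Longrightarrow> (f has_derivative f' x) (at x)"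
    and a: "((\<lambda>x. f' x a) has_derivative A) (at x0)"
    and b: "((\<lambda>x. f' x b) has_derivative B) (at x0)"
  shows "A b = B a"
proof -
  have 1: "((\<lambda>h. (f (x0 + h *\<^sub>R a + h *\<^sub>R b) - f (x0 + h *\<^sub>R a) - f (x0 + h *\<^sub>R b) + f x0) / h\<^sup>2)
           \<longlongrightarrow> A b) (at_right 0)"
    by (rule second_difference_tendsto[OF U der a])
  have "((\<lambda>h. (f (x0 + h *\<^sub>R b + h *\<^sub>R a) - f (x0 + h *\<^sub>R b) - f (x0 + h *\<^sub>R a) + f x0) / h\<^sup>2)
           \<longlongrightarrow> B a) (at_right 0)"
    by (rule second_difference_tendsto[OF U der b])
  then have 2: "((\<lambda>h. (f (x0 + h *\<^sub>R a + h *\<^sub>R b) - f (x0 + h *\<^sub>R a) - f (x0 + h *\<^sub>R b) + f x0) / h\<^sup>2)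
           \<longlongrightarrow> B a) (at_right 0)"
    by (simp add: algebra_simps)
  show ?thesis using tendsto_unique[OF _ 1 2] by simp
qed

lemma mixed_derivatives_eq:
  fixes f :: "'a::real_normed_vector \<Rightarrow> 'b::euclidean_space"
  assumes U: "open U" "x0 \<in> U"
    and der: "\<And>x. x \<in> U \<Longrightarrow> (f has_derivative f' x) (at x)"
    and a: "((\<lambda>x. f' x a) has_derivative A) (at x0)"
    and b: "((\<lambda>x. f' x b) has_derivative B) (at x0)"
  shows "A b = B a"
proof (rule euclidean_eqI)
  fix i :: 'b
  show "A b \<bullet> i = B a \<bullet> i"
    by (rule mixed_derivatives_eq_real[OF U, where f="\<lambda>x. f x \<bullet> i" and f'="\<lambda>x h. f' x h \<bullet> i"])
       (auto intro!: derivative_intros der a b)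
qed

text \<open>If \<open>f2\<close> were positive, \<open>f'\<close> would be positive just to the
  right of \<open>0\<close> and \<open>f\<close> would increase there. Differentiability of
  \<open>f'\<close> at the single point \<open>0\<close> is what a gradient differentiable at one
  point provides.\<close>

lemma second_derivative_le_0_if_local_max:
  fixes f f' :: "real \<Rightarrow> real"
  assumes d: "d > 0"
    and der: "\<And>t. \<bar>t\<bar> < d \<Longrightarrow> (f has_real_derivative f' t) (at t)"
    and der2: "(f' has_real_derivative f2) (at 0)"
    and max: "\<And>t. \<bar>t\<bar> < d \<Longrightarrow> f t \<le> f 0"
  shows "f' 0 = 0" "f2 \<le> 0"
proof -
  show z: "f' 0 = 0"
    by (rule DERIV_local_max[OF der[of 0] d]) (use d max in auto)
  show "f2 \<le> 0"
  proof (rule ccontr)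
    assume "\<not> f2 \<le> 0"
    then obtain e where e: "e > 0" "\<And>h. \<lbrakk>h > 0; h < e\<rbrakk> \<Longrightarrow> f' 0 < f' (0 + h)"
      using DERIV_pos_inc_right[OF der2] by auto
    define s where "s = min d e / 2"
    have s: "0 < s" "s < d" "s < e" using d e by (auto simp: s_def)
    have "f 0 < f s"
    proof (rule DERIV_pos_imp_increasing_open[OF s(1)])
      fix x assume x: "0 < x" "x < s"
      then show "\<exists>y. (f has_real_derivative y) (at x) \<and> 0 < y"
        using der[of x] e(2)[of x] z s by (intro exI[of _ "f' x"]) auto
    next
      show "continuous_on {0..s} f"
        using s by (intro DERIV_continuous_on[where D=f'] DERIV_subset[OF der]) auto
    qed
    then show False using max[of s] s by auto
  qed
qed

section \<open>Orthonormal frames and traces in three-space\<close>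

lemma real3_onb_expand:
  fixes e1 e2 n x :: "real^3"
  assumes "norm e1 = 1" "norm e2 = 1" "norm n = 1" "e1 \<bullet> e2 = 0" "e1 \<bullet> n = 0" "e2 \<bullet> n = 0"
  shows "x = (x \<bullet> e1) *\<^sub>R e1 + (x \<bullet> e2) *\<^sub>R e2 + (x \<bullet> n) *\<^sub>R n"
proof -
  let ?B = "{e1, e2, n}"
  have ne: "e1 \<noteq> e2" "e1 \<noteq> n" "e2 \<noteq> n" using assms by (metis norm_eq_1 zero_neq_one)+
  have orth: "pairwise orthogonal ?B"
    using assms by (auto simp: pairwise_def orthogonal_def inner_commute)
  have "0 \<notin> ?B" using assms by auto
  then have ind: "independent ?B" using pairwise_orthogonal_independent[OF orth] by blast
  have "span ?B = UNIV"
    using card_ge_dim_independent[of ?B UNIV] ind ne by auto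
  then have "(\<Sum>i\<in>?B. (x \<bullet> i) *\<^sub>R i) = x"
    using orth assms by (intro orthonormal_basis_expand) auto
  then show ?thesis using ne by (simp add: add.assoc)
qed

definition ltrace :: "(real^3 \<Rightarrow> real^3) \<Rightarrow> real" where
  "ltrace A = (\<Sum>i\<in>Basis. A i \<bullet> i)"

text \<open>Every basis vector is expanded in the frame. Later the frame consists of two principal
  directions and the normal, so the part of the trace along the surface becomes
  \<open>ltrace A - A n \<bullet> n\<close>.\<close>

lemma ltrace_onb:
  fixes e1 e2 n :: "real^3"
  assumes A: "linear A"
    and onb: "norm e1 = 1" "norm e2 = 1" "norm n = 1" "e1 \<bullet> e2 = 0" "e1 \<bullet> n = 0" "e2 \<bullet> n = 0"
  shows "A e1 \<bullet> e1 + A e2 \<bullet> e2 + A n \<bullet> n = ltrace A"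
proof -
  interpret A: linear A by (rule A)
  have one: "A x \<bullet> x = (\<Sum>b\<in>Basis. (x \<bullet> b) * (A b \<bullet> x))" for x
  proof -
    have "A x = A (\<Sum>b\<in>Basis. (x \<bullet> b) *\<^sub>R b)" by (simp add: euclidean_representation)
    also have "\<dots> = (\<Sum>b\<in>Basis. (x \<bullet> b) *\<^sub>R A b)" by (simp add: A.sum A.scaleR)
    finally have eq: "A x = (\<Sum>b\<in>Basis. (x \<bullet> b) *\<^sub>R A b)" .
    show ?thesis by (subst eq) (simp add: inner_sum_left)
  qed
  have "A e1 \<bullet> e1 + A e2 \<bullet> e2 + A n \<bullet> n
    = (\<Sum>b\<in>Basis. A b \<bullet> ((b \<bullet> e1) *\<^sub>R e1 + (b \<bullet> e2) *\<^sub>R e2 + (b \<bullet> n) *\<^sub>R n))"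
    unfolding one[of e1] one[of e2] one[of n] by (simp add: inner_add_right sum.distrib inner_commute)
  also have "\<dots> = ltrace A"
    unfolding ltrace_def using real3_onb_expand[OF onb] by simp
  finally show ?thesis .
qed

section \<open>Tangent planes and interior charts\<close>

lemma inner_vertical [simp]: "p \<bullet> vertical = p $ 3" "vertical \<bullet> p = p $ 3"
  by (simp_all add: vertical_def inner_vec_def sum_3 vector_def)

lemma orthonormal_complement_basis:
  fixes n :: "real^3"
  assumes "norm n = 1"
  obtains f1 f2 where "norm f1 = 1" "norm f2 = 1" "f1 \<bullet> f2 = 0" "f1 \<bullet> n = 0" "f2 \<bullet> n = 0"
proof -
  have "n \<noteq> 0" using assms by auto
  then obtain a where a: "cross3 n a \<noteq> 0" using cross_basis_nonzero by metis
  define f1 where "f1 = cross3 n a /\<^sub>R norm (cross3 n a)"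
  define f2 where "f2 = cross3 n f1"
  have 1: "norm f1 = 1" using a by (simp add: f1_def)
  have 2: "f1 \<bullet> n = 0" by (simp add: f1_def dot_cross_self)
  have 3: "f2 \<bullet> n = 0" "f1 \<bullet> f2 = 0" by (simp_all add: f2_def dot_cross_self)
  have "(norm f2)\<^sup>2 = 1" using norm_cross_dot[of n f1] 1 2 assms by (simp add: f2_def inner_commute)
  then have "norm f2 = 1" by (metis norm_ge_zero power2_eq_1_iff neg_0_le_iff_le not_one_le_zero)
  then show ?thesis using that 1 2 3 by blast
qed

text \<open>Spectral theorem for the shape operator. Symmetry is asked on the plane orthogonal to
  \<open>n\<close> only, because a derivative of the Gauss map within the surface is arbitrary in
  the normal direction.\<close>

lemma self_adjoint_plane_eigenvectors:
  fixes D :: "real^3 \<Rightarrow> real^3" and n :: "real^3"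
  assumes D: "linear D" and n: "norm n = 1"
    and tan: "\<And>v. v \<bullet> n = 0 \<Longrightarrow> D v \<bullet> n = 0"
    and sym: "\<And>v w. v \<bullet> n = 0 \<Longrightarrow> w \<bullet> n = 0 \<Longrightarrow> D v \<bullet> w = D w \<bullet> v"
  obtains e1 e2 k1 k2 where "norm e1 = 1" "norm e2 = 1" "e1 \<bullet> e2 = 0" "e1 \<bullet> n = 0" "e2 \<bullet> n = 0"
    "D e1 = k1 *\<^sub>R e1" "D e2 = k2 *\<^sub>R e2"
proof -
  obtain f1 f2 where f: "norm f1 = 1" "norm f2 = 1" "f1 \<bullet> f2 = 0" "f1 \<bullet> n = 0" "f2 \<bullet> n = 0"
    using orthonormal_complement_basis[OF n] by metis
  interpret D: linear D by (rule D)
  define a where "a = D f1 \<bullet> f1"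
  define b where "b = D f1 \<bullet> f2"
  define d where "d = D f2 \<bullet> f2"
  have D1: "D f1 = a *\<^sub>R f1 + b *\<^sub>R f2"
    using real3_onb_expand[OF f(1,2) n f(3,4,5), of "D f1"] tan[OF f(4)] by (simp add: a_def b_def)
  have D2: "D f2 = b *\<^sub>R f1 + d *\<^sub>R f2"
    using real3_onb_expand[OF f(1,2) n f(3,4,5), of "D f2"] tan[OF f(5)] sym[OF f(5,4)]
    by (simp add: b_def d_def)
  show ?thesis
  proof (cases "b = 0")
    case True
    then show ?thesis using that[OF f, of a d] D1 D2 by simp
  next
    case False
    \<comment> \<open>\<open>l\<close> is the larger root of the characteristic polynomial and
      \<open>m\<close> the other one, by the trace. \<open>v\<close> is read off from the first row
      of the matrix, and \<open>w\<close> is \<open>v\<close> turned by a right angle in the plane,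
      hence an eigenvector for \<open>m\<close>.\<close>
    define l where "l = ((a + d) + sqrt ((a - d)\<^sup>2 + 4 * b\<^sup>2)) / 2"
    define m where "m = a + d - l"
    have "2 * l - (a + d) = sqrt ((a - d)\<^sup>2 + 4 * b\<^sup>2)" by (simp add: l_def field_simps)
    then have "(2 * l - (a + d))\<^sup>2 = (a - d)\<^sup>2 + 4 * b\<^sup>2" by simp
    then have q: "(l - a) * (l - d) = b * b"
      by (simp add: power2_eq_square algebra_simps)
    define v where "v = b *\<^sub>R f1 + (l - a) *\<^sub>R f2"
    define w where "w = (- (l - a)) *\<^sub>R f1 + b *\<^sub>R f2"
    have q2: "b * b + (l - a) * d = l * (l - a)" using q by (simp add: algebra_simps)
    have q3: "b * b - (l - a) * a = m * (- (l - a))" using q by (simp add: m_def algebra_simps)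
    have Dv: "D v = l *\<^sub>R v"
    proof -
      have "D v = (l * b) *\<^sub>R f1 + (b * b + (l - a) * d) *\<^sub>R f2"
        unfolding v_def D.add D.scaleR D1 D2 by (simp add: algebra_simps)
      also have "\<dots> = l *\<^sub>R v" unfolding q2 by (simp add: v_def algebra_simps)
      finally show ?thesis .
    qed
    have Dw: "D w = m *\<^sub>R w"
    proof -
      have "D w = (b * b - (l - a) * a) *\<^sub>R f1 + (m * b) *\<^sub>R f2"
        unfolding w_def m_def D.add D.scaleR D1 D2 by (simp add: algebra_simps)
      also have "\<dots> = m *\<^sub>R w" unfolding q3 by (simp add: w_def algebra_simps)
      finally show ?thesis .
    qed
    have f': "f1 \<bullet> f1 = 1" "f2 \<bullet> f2 = 1" "f2 \<bullet> f1 = 0"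
      using f by (simp_all add: norm_eq_1 inner_commute)
    have vw: "v \<bullet> w = 0" "v \<bullet> n = 0" "w \<bullet> n = 0"
      using f f' by (simp_all add: v_def w_def inner_simps algebra_simps)
    have "v \<bullet> v = b * b + (l - a) * (l - a)" "w \<bullet> w = b * b + (l - a) * (l - a)"
      using f f' by (simp_all add: v_def w_def inner_simps algebra_simps)
    moreover have "b * b + (l - a) * (l - a) > 0"
      using False by (metis add_pos_nonneg not_real_square_gt_zero zero_le_square)
    ultimately have nz: "v \<noteq> 0" "w \<noteq> 0" by auto
    show ?thesis
      by (rule that[of "v /\<^sub>R norm v" "w /\<^sub>R norm w" l m])
         (use nz vw Dv Dw in \<open>simp_all add: D.scaleR inner_commute\<close>)
  qed
qed

section \<open>Charts, tangent planes and chords of an oriented surface\<close>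

locale oriented_surface =
  fixes M :: "(real^3) set" and N :: "real^3 \<Rightarrow> real^3"
  assumes embedded: "embedded_surface M" and gauss: "gauss_map M N"
begin

lemma N_norm: "p \<in> M \<Longrightarrow> norm (N p) = 1"
  using gauss unfolding gauss_map_def by blast

lemma N_continuous: "continuous_on M N"
  using gauss unfolding gauss_map_def by blast

text \<open>One inclusion is the definition of \<open>gauss_map\<close>, and both sides have
  dimension two: the left by injectivity of the differential, the right by the unit normal. Hence
  the tangent plane does not depend on the chart.\<close>

lemma chart_tangent_range:
  assumes ch: "surface_chart M V X" and u: "u \<in> V \<inter> half_plane"
  shows "range (frechet_derivative X (at u)) = {w. N (X u) \<bullet> w = 0}"
proof (rule subspace_dim_equal)
  let ?D = "frechet_derivative X (at u)"
  have V: "open V" "smooth_on X V" "inj ?D" using ch u unfolding surface_chart_def by auto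
  have "linear ?D"
    using smooth_on_has_derivative[OF V(2,1)] u has_derivative_linear by blast
  then show "subspace (range ?D)" by (simp add: linear_subspace_image)
  have "X u \<in> M" using ch u unfolding surface_chart_def
    by (metis IntI image_eqI openin_imp_subset subset_iff)
  have "?D w \<in> tangent_plane M (X u)" for w
    unfolding tangent_plane_def using ch u by blast
  then show "range ?D \<subseteq> {w. N (X u) \<bullet> w = 0}"
    using gauss \<open>X u \<in> M\<close> unfolding gauss_map_def by auto
  show "subspace {w. N (X u) \<bullet> w = 0}" by (rule subspace_hyperplane)
  have "N (X u) \<noteq> 0" using N_norm[OF \<open>X u \<in> M\<close>] by auto
  then have "dim {w. N (X u) \<bullet> w = 0} = 2" by (simp add: dim_hyperplane)
  moreover have "dim (range ?D) = 2"
    using dim_image_eq[OF \<open>linear ?D\<close>, of UNIV] V(3) by simp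
  ultimately show "dim {w. N (X u) \<bullet> w = 0} \<le> dim (range ?D)" by simp
qed

lemma tangent_plane_eq:
  assumes "p \<in> M"
  shows "tangent_plane M p = {w. N p \<bullet> w = 0}"
proof -
  obtain V X where ch: "surface_chart M V X" "p \<in> X ` (V \<inter> half_plane)"
    using embedded assms unfolding embedded_surface_def by blast
  then obtain u where u: "u \<in> V \<inter> half_plane" "X u = p" by blast
  show ?thesis
  proof
    show "tangent_plane M p \<subseteq> {w. N p \<bullet> w = 0}"
      using gauss assms unfolding gauss_map_def by auto
    show "{w. N p \<bullet> w = 0} \<subseteq> tangent_plane M p"
      using chart_tangent_range[OF ch(1) u(1)] u ch(1) unfolding tangent_plane_def by blast
  qed
qed

text \<open>Since \<open>surface_boundary\<close> ranges over all charts, a point outside it has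
  positive second coordinate in any chart around it, and the chart can be cut down to the open upper
  half-plane. Invariance of the boundary under change of charts never becomes an issue.\<close>

lemma interior_chart:
  assumes p: "p \<in> M" "p \<notin> surface_boundary M"
  obtains V :: "(real^2) set" and X u Y where "open V" "smooth_on X V" "u \<in> V" "X u = p"
    "\<forall>v\<in>V. inj (frechet_derivative X (at v))"
    "openin (top_of_set M) (X ` V)" "homeomorphism V (X ` V) X Y"
    "\<forall>v\<in>V. range (frechet_derivative X (at v)) = {w. N (X v) \<bullet> w = 0}"
proof -
  obtain V0 X where ch: "surface_chart M V0 X" "p \<in> X ` (V0 \<inter> half_plane)"
    using embedded p unfolding embedded_surface_def by blast
  then obtain u where u: "u \<in> V0 \<inter> half_plane" "X u = p" by blast
  have "u $ 2 \<noteq> 0" using p ch(1) u unfolding surface_boundary_def by blast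
  then have u2: "u $ 2 > 0" using u by (auto simp: half_plane_def)
  define V where "V = V0 \<inter> {u. u $ 2 > 0}"
  have oV0: "open V0" using ch unfolding surface_chart_def by blast
  have oH: "open {u::real^2. u $ 2 > 0}" by (rule open_halfspace_component_gt_cart)
  have sub: "V \<subseteq> V0 \<inter> half_plane" by (auto simp: V_def half_plane_def)
  obtain Y where Y: "homeomorphism (V0 \<inter> half_plane) (X ` (V0 \<inter> half_plane)) X Y"
    using ch unfolding surface_chart_def by blast
  have "openin (top_of_set (V0 \<inter> half_plane)) V"
    unfolding openin_open using oH by (intro exI[of _ "V0 \<inter> {u. u $ 2 > 0}"]) (auto simp: V_def half_plane_def oV0)
  then have "openin (top_of_set (X ` (V0 \<inter> half_plane))) (X ` V)"
    by (rule homeomorphism_imp_open_map[OF Y])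
  then have op: "openin (top_of_set M) (X ` V)"
    using ch openin_trans unfolding surface_chart_def by blast
  show ?thesis
  proof (rule that[of V X u Y])
    show "open V" using oV0 oH by (simp add: V_def open_Int)
    show "smooth_on X V"
      using ch smooth_on_subset[of X V0 V] sub unfolding surface_chart_def by auto
    show "u \<in> V" using u u2 by (simp add: V_def)
    show "X u = p" by fact
    show "\<forall>v\<in>V. inj (frechet_derivative X (at v))"
      using ch sub unfolding surface_chart_def by blast
    show "openin (top_of_set M) (X ` V)" by fact
    show "homeomorphism V (X ` V) X Y"
      by (rule homeomorphism_of_subsets[OF Y sub, of "X ` V"]) (use sub in auto)
    show "\<forall>v\<in>V. range (frechet_derivative X (at v)) = {w. N (X v) \<bullet> w = 0}"
      using chart_tangent_range[OF ch(1)] sub by blast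
  qed
qed

text \<open>The patch is relatively open in \<open>M\<close>, so no other sheet of the surface comes
  near \<open>X u\<close>. This is where embeddedness enters.\<close>

lemma openin_image_nbhd:
  assumes "openin (top_of_set M) (X ` V)" "homeomorphism V (X ` V) X Y" "u \<in> V" "open W" "u \<in> W"
  shows "\<exists>\<delta>>0. \<forall>x\<in>M. dist x (X u) < \<delta> \<longrightarrow> (\<exists>v\<in>V \<inter> W. X v = x)"
proof -
  have "openin (top_of_set V) (V \<inter> W)" using assms(4) by (simp add: openin_open_Int)
  then have "openin (top_of_set (X ` V)) (X ` (V \<inter> W))"
    by (rule homeomorphism_imp_open_map[OF assms(2)])
  then have "openin (top_of_set M) (X ` (V \<inter> W))" using assms(1) openin_trans by blast
  then obtain e where "e > 0" "\<And>x. \<lbrakk>x \<in> M; dist x (X u) < e\<rbrakk> \<Longrightarrow> x \<in> X ` (V \<inter> W)"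
    unfolding openin_euclidean_subtopology_iff using assms by (metis IntI image_eqI)
  then show ?thesis by (metis imageE)
qed

text \<open>Strict differentiability of the chart turns a chord into a tangent vector up to a small
  relative error. Half-plane charts are used, so boundary points are included.\<close>

lemma chord_almost_tangent:
  assumes p: "p \<in> M" and \<eta>: "\<eta> > 0"
  shows "\<exists>\<delta>>0. \<forall>x\<in>M. \<forall>y\<in>M. dist x p < \<delta> \<longrightarrow> dist y p < \<delta> \<longrightarrow>
      \<bar>(x - y) \<bullet> N p\<bar> \<le> \<eta> * norm (x - y)"
proof -
  obtain V X where ch: "surface_chart M V X" "p \<in> X ` (V \<inter> half_plane)"
    using embedded p unfolding embedded_surface_def by blast
  then obtain u where u: "u \<in> V \<inter> half_plane" "X u = p" by blast
  obtain Y where Y: "homeomorphism (V \<inter> half_plane) (X ` (V \<inter> half_plane)) X Y"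
    and op: "openin (top_of_set M) (X ` (V \<inter> half_plane))" and V: "open V" "smooth_on X V"
    and inj: "inj (frechet_derivative X (at u))"
    using ch u unfolding surface_chart_def by blast
  let ?D = "frechet_derivative X (at u)"
  have lin: "linear ?D"
    using smooth_on_has_derivative[OF V(2,1)] u has_derivative_linear by blast
  obtain B where B: "B > 0" "\<And>w. B * norm w \<le> norm (?D w)"
    using linear_inj_bounded_below_pos[OF lin inj] by blast
  \<comment> \<open>\<open>B / 2\<close> keeps the chord at least \<open>B / 2\<close> times as long
    as the parameter difference; \<open>\<eta> * B / 2\<close> then turns the error in the
    parameters into one relative to the chord.\<close>
  define \<epsilon> where "\<epsilon> = min (B / 2) (\<eta> * B / 2)"
  have \<epsilon>: "\<epsilon> > 0" "\<epsilon> \<le> B / 2" "\<epsilon> \<le> \<eta> * B / 2" using B \<eta> by (auto simp: \<epsilon>_def)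
  obtain d where d: "d > 0"
    "\<And>a b. \<lbrakk>a \<in> ball u d; b \<in> ball u d\<rbrakk> \<Longrightarrow> norm (X a - X b - ?D (a - b)) \<le> \<epsilon> * norm (a - b)"
  proof -
    have "\<exists>\<delta>>0. ball u \<delta> \<subseteq> V \<and> (\<forall>a\<in>ball u \<delta>. \<forall>b\<in>ball u \<delta>. norm (X a - X b - ?D (a - b)) \<le> \<epsilon> * norm (a - b))"
    proof (rule strict_differentiability)
      show "open V" "u \<in> V" "0 < \<epsilon>" using V u \<epsilon> by auto
      show "(X has_derivative frechet_derivative X (at x)) (at x)" if "x \<in> V" for x
        using smooth_on_has_derivative[OF V(2,1) that] .
      show "isCont (\<lambda>x. frechet_derivative X (at x) b) u" for b
        using smooth_on_continuous[OF smooth_on_frechet_derivative[OF V(2)]] V u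
        by (simp add: continuous_on_eq_continuous_at)
    qed
    then show ?thesis using that by blast
  qed
  have tan: "?D w \<bullet> N p = 0" for w
  proof -
    have "?D w \<in> {w. N (X u) \<bullet> w = 0}" using chart_tangent_range[OF ch(1) u(1)] by (metis rangeI)
    then show ?thesis using u by (simp add: inner_commute)
  qed
  obtain \<delta> where \<delta>: "\<delta> > 0" "\<And>x. \<lbrakk>x \<in> M; dist x p < \<delta>\<rbrakk> \<Longrightarrow> \<exists>v\<in>(V \<inter> half_plane) \<inter> ball u d. X v = x"
    using openin_image_nbhd[OF op Y u(1), of "ball u d"] d u by auto
  have "\<bar>(x - y) \<bullet> N p\<bar> \<le> \<eta> * norm (x - y)"
    if xy: "x \<in> M" "y \<in> M" "dist x p < \<delta>" "dist y p < \<delta>" for x y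
  proof -
    obtain a b where ab: "a \<in> ball u d" "b \<in> ball u d" "X a = x" "X b = y"
      using \<delta>(2) xy by blast
    let ?r = "x - y - ?D (a - b)"
    have r: "norm ?r \<le> \<epsilon> * norm (a - b)" using d(2)[OF ab(1,2)] ab by simp
    have "B * norm (a - b) \<le> norm (?D (a - b))" by (rule B)
    also have "\<dots> \<le> norm (x - y) + norm ?r"
      by (metis norm_triangle_sub norm_minus_commute add.commute)
    also have "\<dots> \<le> norm (x - y) + B / 2 * norm (a - b)"
      using r \<epsilon>(2) by (smt (verit) mult_right_mono norm_ge_zero)
    finally have 1: "B / 2 * norm (a - b) \<le> norm (x - y)" by simp
    have "(x - y) \<bullet> N p = ?r \<bullet> N p" using tan by (simp add: inner_diff_left)
    then have "\<bar>(x - y) \<bullet> N p\<bar> \<le> norm ?r"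
      using Cauchy_Schwarz_ineq2[of ?r "N p"] N_norm[OF p] by simp
    also have "\<dots> \<le> \<eta> * B / 2 * norm (a - b)"
      using r \<epsilon>(3) by (smt (verit) mult_right_mono norm_ge_zero)
    also have "\<dots> \<le> \<eta> * norm (x - y)"
      using mult_left_mono[OF 1, of \<eta>] \<eta> by (simp add: mult.assoc)
    finally show ?thesis .
  qed
  then show ?thesis using \<delta>(1) by blast
qed

end

section \<open>The surface Laplacian at a local maximum\<close>

lemma cross3_image_nonzero:
  fixes f :: "real^2 \<Rightarrow> real^3"
  assumes "linear f" "inj f"
  shows "cross3 (f (axis 1 1)) (f (axis 2 1)) \<noteq> 0"
proof
  interpret f: linear f by (rule assms)
  have ker: "w = 0" if "f w = 0" for w using injD[OF assms(2), of w 0] that f.zero by simp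
  have ax: "axis 1 (1::real) \<noteq> (0::real^2)" "axis 2 (1::real) \<noteq> (0::real^2)"
    "axis 2 (1::real) - k *\<^sub>R axis 1 1 \<noteq> (0::real^2)" for k
    by (simp_all add: vec_eq_iff axis_def forall_2)
  assume "cross3 (f (axis 1 1)) (f (axis 2 1)) = 0"
  then consider "f (axis 1 1) = 0" | "f (axis 2 1) = 0" | k where "f (axis 2 1) = k *\<^sub>R f (axis 1 1)"
    unfolding cross_eq_0 collinear_lemma by blast
  then show False
  proof cases
    case 1 then show ?thesis using ker ax(1) by blast
  next
    case 2 then show ?thesis using ker ax(2) by blast
  next
    case 3
    then have "f (axis 2 1 - k *\<^sub>R axis 1 1) = 0" by (simp add: f.diff f.scaleR)
    then show ?thesis using ker ax(3) by blast
  qed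
qed

context oriented_surface
begin

text \<open>The Gauss map is only assumed continuous. In a chart it is, up to the sign
  \<open>s\<close>, the normalized cross product of the coordinate fields. A continuous function
  with values \<open>1\<close> and \<open>-1\<close> is locally constant, so differentiability
  passes from the cross product to \<open>N\<close>.\<close>

lemma N_on_chart_differentiable:
  fixes X :: "real^2 \<Rightarrow> real^3"
  assumes V: "open V" "smooth_on X V" and u: "u \<in> V" and img: "X ` V \<subseteq> M"
    and inj: "\<And>v. v \<in> V \<Longrightarrow> inj (frechet_derivative X (at v))"
    and rng: "\<And>v. v \<in> V \<Longrightarrow> range (frechet_derivative X (at v)) = {w. N (X v) \<bullet> w = 0}"
  shows "(\<lambda>v. N (X v)) differentiable (at u)"
proof -
  define c where "c = (\<lambda>v::real^2. cross3 (frechet_derivative X (at v) (axis 1 1)) (frechet_derivative X (at v) (axis 2 1)))"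
  have lin: "linear (frechet_derivative X (at v))" if "v \<in> V" for v
    using smooth_on_has_derivative[OF V(2,1) that] has_derivative_linear by blast
  have nz: "c v \<noteq> 0" if "v \<in> V" for v
    unfolding c_def using cross3_image_nonzero[OF lin[OF that] inj[OF that]] .
  have Nn: "N (X v) \<bullet> N (X v) = 1" if "v \<in> V" for v
    using N_norm[of "X v"] img that norm_eq_1 by blast
  have par: "c v = (N (X v) \<bullet> c v) *\<^sub>R N (X v)" if v: "v \<in> V" for v
  proof -
    interpret l: linear "frechet_derivative X (at v)" by (rule lin[OF v])
    let ?z = "c v - (N (X v) \<bullet> c v) *\<^sub>R N (X v)"
    have "N (X v) \<bullet> ?z = 0" using Nn[OF v] by (simp add: inner_diff_right)
    then obtain w where w: "?z = frechet_derivative X (at v) w" using rng[OF v] by blast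
    have "w = (w $ 1) *\<^sub>R axis 1 1 + (w $ 2) *\<^sub>R axis 2 1"
      by (simp add: vec_eq_iff axis_def forall_2)
    then have "?z = (w $ 1) *\<^sub>R frechet_derivative X (at v) (axis 1 1) + (w $ 2) *\<^sub>R frechet_derivative X (at v) (axis 2 1)"
      using w by (metis l.add l.scaleR)
    then have "c v \<bullet> ?z = 0" by (simp add: c_def inner_add_right dot_cross_self)
    moreover have "N (X v) \<bullet> ?z = 0" by fact
    ultimately have "?z \<bullet> ?z = 0" by (simp add: inner_diff_left)
    then show ?thesis by simp
  qed
  define s where "s = (\<lambda>v. (N (X v) \<bullet> c v) / norm (c v))"
  have absn: "\<bar>N (X v) \<bullet> c v\<bar> = norm (c v)" if "v \<in> V" for v
    using arg_cong[OF par[OF that], of norm] N_norm[of "X v"] img that by auto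
  have s1: "s v = 1 \<or> s v = -1" if "v \<in> V" for v
    using absn[OF that] nz[OF that] by (auto simp: s_def abs_if divide_simps split: if_splits)
  have Ns: "N (X v) = s v *\<^sub>R (c v /\<^sub>R norm (c v))" if "v \<in> V" for v
  proof -
    have "N (X v) \<bullet> c v = s v * norm (c v)" using nz[OF that] by (simp add: s_def)
    then have "c v = (s v * norm (c v)) *\<^sub>R N (X v)" using par[OF that] by simp
    then have "s v *\<^sub>R (c v /\<^sub>R norm (c v)) = (s v * (s v * norm (c v)) / norm (c v)) *\<^sub>R N (X v)"
      by (metis (no_types, opaque_lifting) divide_inverse mult.commute scaleR_scaleR)
    also have "\<dots> = N (X v)" using s1[OF that] nz[OF that] by auto
    finally show ?thesis by simp
  qed
  have dd: "(\<lambda>v. frechet_derivative X (at v) a) differentiable (at w)" if "w \<in> V" for a w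
    using smooth_on_has_derivative[OF smooth_on_frechet_derivative[OF V(2)] V(1) that]
    unfolding differentiable_def by blast
  have cd: "c differentiable (at w)" if w: "w \<in> V" for w
    unfolding c_def
  proof -
    have bb: "bounded_bilinear cross3" using bilinear_cross bilinear_conv_bounded_bilinear by blast
    obtain A B where "((\<lambda>v. frechet_derivative X (at v) (axis 1 1)) has_derivative A) (at w)"
      "((\<lambda>v. frechet_derivative X (at v) (axis 2 1)) has_derivative B) (at w)"
      using dd[OF w] unfolding differentiable_def by metis
    from bounded_bilinear.FDERIV[OF bb this]
    show "(\<lambda>v. cross3 (frechet_derivative X (at v) (axis 1 1)) (frechet_derivative X (at v) (axis 2 1))) differentiable (at w)"
      unfolding differentiable_def by blast
  qed
  have contX: "continuous_on V X" using smooth_on_continuous[OF V(2)] .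
  have contc: "continuous_on V c"
    using cd differentiable_imp_continuous_within by (meson continuous_at_imp_continuous_on)
  have contN: "continuous_on V (\<lambda>v. N (X v))"
    using continuous_on_compose2[OF N_continuous contX img] .
  have "continuous_on V s" unfolding s_def
    using nz by (intro continuous_intros contN contc) auto
  then have "\<forall>\<^sub>F v in at u. dist (s v) (s u) < 1"
    using V(1) u by (auto simp: continuous_on_eq_continuous_at continuous_at tendsto_iff)
  then have ev: "\<forall>\<^sub>F v in at u. s v = s u \<and> v \<in> V"
    using eventually_at_in_open'[OF V(1) u]
  proof eventually_elim
    case (elim v)
    then show ?case using s1[of v] s1[OF u] by (auto simp: dist_real_def)
  qed
  then have ev2: "\<forall>\<^sub>F v in at u. s u *\<^sub>R (c v /\<^sub>R norm (c v)) = N (X v)"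
    by eventually_elim (metis Ns)
  have "(\<lambda>v. s u *\<^sub>R (c v /\<^sub>R norm (c v))) differentiable (at u)"
  proof -
    have nc: "(norm \<circ> c) differentiable (at u)"
      using nz[OF u] by (intro differentiable_chain_at cd u differentiable_norm_at)
    have "(\<lambda>v. inverse (norm (c v))) differentiable (at u)"
      using nz[OF u] nc by (intro differentiable_inverse) (auto simp: o_def)
    from differentiable_scaleR[OF differentiable_const differentiable_scaleR[OF this cd[OF u]]]
    show ?thesis .
  qed
  then obtain D where D: "((\<lambda>v. s u *\<^sub>R (c v /\<^sub>R norm (c v))) has_derivative D) (at u)"
    unfolding differentiable_def by blast
  have "((\<lambda>v. N (X v)) has_derivative D) (at u)"
    by (rule has_derivative_transform_eventually[OF D ev2]) (use Ns[OF u] in auto)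
  then show ?thesis unfolding differentiable_def by blast
qed

end

locale sms = oriented_surface +
  fixes \<alpha> :: real
  assumes upper: "M \<subseteq> upper_half_space"
    and curvature: "p \<in> M \<Longrightarrow> 2 * mean_curvature M N p = \<alpha> * ((N p \<bullet> vertical) / (p \<bullet> vertical))"
begin

text \<open>At an interior local maximum of \<open>F\<close> on the surface, the Laplacian of the restriction,
  \<open>tr A - A N \<bullet> N + 2 H (N \<bullet> G)\<close>, is nonpositive; by the curvature equation the last summand
  equals \<open>\<alpha> G\<^sub>3 / z\<close>.\<close>

lemma local_max_on_surface:
  assumes p: "p \<in> M" "p \<notin> surface_boundary M" and d: "d > 0"
    and F: "\<And>x. x \<in> ball p d \<Longrightarrow> (F has_derivative (\<lambda>h. G x \<bullet> h)) (at x)"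
    and G: "(G has_derivative A) (at p)"
    and max: "\<And>x. x \<in> M \<inter> ball p d \<Longrightarrow> F x \<le> F p"
  shows "G p = (N p \<bullet> G p) *\<^sub>R N p"
    and "ltrace A - A (N p) \<bullet> N p + \<alpha> * (G p $ 3) / (p $ 3) \<le> 0"
proof -
  obtain V :: "(real^2) set" and X Y u where V: "open V" "smooth_on X V" and u: "u \<in> V" and Xu: "X u = p"
    and inj0: "\<forall>v\<in>V. inj (frechet_derivative X (at v))"
    and op: "openin (top_of_set M) (X ` V)" and hom: "homeomorphism V (X ` V) X Y"
    and rng0: "\<forall>v\<in>V. range (frechet_derivative X (at v)) = {w. N (X v) \<bullet> w = 0}"
    by (rule interior_chart[OF p])
  note inj = bspec[OF inj0] and rng = bspec[OF rng0]
  have img: "X ` V \<subseteq> M" using op openin_imp_subset by blast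
  define D where "D = (\<lambda>a v. frechet_derivative X (at v) a)"
  define n where "n = N p"
  have n1: "norm n = 1" "n \<bullet> n = 1" using N_norm[OF p(1)] by (auto simp: n_def norm_eq_1)
  have Xd: "(X has_derivative (\<lambda>a. D a v)) (at v)" if "v \<in> V" for v
    using smooth_on_has_derivative[OF V(2,1) that] by (simp add: D_def)
  have lin: "linear (\<lambda>a. D a v)" if "v \<in> V" for v
    using Xd[OF that] has_derivative_linear by blast
  define Q where "Q = (\<lambda>a. frechet_derivative (D a) (at u))"
  have Dd: "(D a has_derivative Q a) (at u)" for a
    using smooth_on_has_derivative[OF smooth_on_frechet_derivative[OF V(2)] V(1) u]
    by (simp add: D_def Q_def)
  \<comment> \<open>Symmetry of the second derivative of the chart makes the shape operator
    self-adjoint below.\<close>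
  have Qsym: "Q a b = Q b a" for a b
    by (rule mixed_derivatives_eq[OF V(1) u, where f=X and f'="\<lambda>v a. D a v"]) (simp_all add: Dd Xd)
  have Drng: "\<exists>a. D a u = w" if "w \<bullet> n = 0" for w
    using rng[OF u] that Xu unfolding D_def n_def by (metis (mono_tags, lifting) inner_commute mem_Collect_eq rangeE)
  have Dperp: "D a v \<bullet> N (X v) = 0" if "v \<in> V" for a v
    using rng[OF that] unfolding D_def by (metis (mono_tags, lifting) inner_commute mem_Collect_eq rangeI)
  obtain E where E: "((\<lambda>v. N (X v)) has_derivative E) (at u)"
    using N_on_chart_differentiable[OF V u img inj rng] unfolding differentiable_def by blast
  have En: "E w \<bullet> n = 0" for w
  proof -
    have 1: "((\<lambda>v. N (X v) \<bullet> N (X v)) has_derivative (\<lambda>h. N (X u) \<bullet> E h + E h \<bullet> N (X u))) (at u)"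
      by (rule has_derivative_inner[OF E E])
    have "((\<lambda>v. 1::real) has_derivative (\<lambda>h. N (X u) \<bullet> E h + E h \<bullet> N (X u))) (at u)"
      by (rule has_derivative_transform_within_open[OF 1 V(1) u])
         (use img N_norm in \<open>auto simp: norm_eq_1 image_subset_iff\<close>)
    from has_derivative_unique[OF this has_derivative_const]
    show ?thesis using Xu by (simp add: fun_eq_iff n_def inner_commute)
  qed
  \<comment> \<open>Differentiating the orthogonality of \<open>N\<close> and the coordinate fields
    expresses the second fundamental form through second derivatives of the chart.\<close>
  have EQ: "E a \<bullet> D b u = - (n \<bullet> Q b a)" for a b
  proof -
    have 1: "((\<lambda>v. N (X v) \<bullet> D b v) has_derivative (\<lambda>h. N (X u) \<bullet> Q b h + E h \<bullet> D b u)) (at u)"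
      by (rule has_derivative_inner[OF E Dd])
    have "((\<lambda>v. 0::real) has_derivative (\<lambda>h. N (X u) \<bullet> Q b h + E h \<bullet> D b u)) (at u)"
      by (rule has_derivative_transform_within_open[OF 1 V(1) u]) (use Dperp in \<open>auto simp: inner_commute\<close>)
    from has_derivative_unique[OF this has_derivative_const]
    have "N (X u) \<bullet> Q b a + E a \<bullet> D b u = 0" by (simp add: fun_eq_iff)
    then show ?thesis by (simp add: Xu n_def)
  qed
  obtain L where L: "linear L" "L \<circ> (\<lambda>a. D a u) = id"
    using linear_injective_left_inverse[OF lin[OF u]] inj[OF u] by (auto simp: D_def)
  have LD: "L (D a u) = a" for a using L(2) by (simp add: fun_eq_iff)
  \<comment> \<open>\<open>L\<close> inverts the differential of the chart on the tangent plane and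
    is arbitrary elsewhere, so \<open>dN\<close> is one of many derivatives of \<open>N\<close>
    within \<open>M\<close>. \<open>dNu\<close> shows that all of them agree on tangent
    vectors.\<close>
  define dN where "dN = (\<lambda>h. E (L h))"
  have ndm: "at p within X ` V = at p within M"
  proof -
    obtain T where T: "open T" "X ` V = M \<inter> T" using op openin_open by metis
    have "p \<in> T" using T u Xu by blast
    then show ?thesis using T by (intro at_within_nhd[of p T]) auto
  qed
  have dN: "(N has_derivative dN) (at p within M)"
  proof -
    have contY: "continuous (at (X u) within X ` V) Y"
      using hom u unfolding homeomorphism_def continuous_on_eq_continuous_within by blast
    have YX: "\<And>x. x \<in> V \<Longrightarrow> Y (X x) = x" using hom unfolding homeomorphism_def by blast
    have Yd: "(Y has_derivative L) (at (X u) within X ` V)"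
      by (rule has_derivative_inverse_within[OF has_derivative_at_withinI[OF Xd[OF u]] contY u L YX])
    have "(N \<circ> X has_derivative E) (at (Y (X u)))" using E YX[OF u] by (simp add: o_def)
    from has_derivative_compose[OF Yd this]
    have 1: "((\<lambda>x. N (X (Y x))) has_derivative (\<lambda>x. E (L x))) (at (X u) within X ` V)" by simp
    have "(N has_derivative (\<lambda>x. E (L x))) (at (X u) within X ` V)"
      by (rule has_derivative_transform[OF _ _ 1]) (use u YX in auto)
    then show ?thesis by (simp add: Xu ndm dN_def)
  qed
  have dNu: "dN' (D a u) = E a" if "(N has_derivative dN') (at p within M)" for dN' a
  proof -
    have "(N has_derivative dN') (at (X u) within X ` V)" using that by (simp add: Xu ndm)
    from has_derivative_in_compose[OF has_derivative_at_withinI[OF Xd[OF u]] this]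
    have "((\<lambda>v. N (X v)) has_derivative (\<lambda>a. dN' (D a u))) (at u within V)" by simp
    then have "((\<lambda>v. N (X v)) has_derivative (\<lambda>a. dN' (D a u))) (at u)"
      using at_within_open[OF u V(1)] by simp
    from has_derivative_unique[OF this E] show ?thesis by (simp add: fun_eq_iff)
  qed
  have lindN: "linear dN" using dN has_derivative_linear by blast
  obtain e1 e2 k1 k2 where e: "norm e1 = 1" "norm e2 = 1" "e1 \<bullet> e2 = 0" "e1 \<bullet> n = 0" "e2 \<bullet> n = 0"
    and k: "- dN e1 = k1 *\<^sub>R e1" "- dN e2 = k2 *\<^sub>R e2"
  proof -
    have "linear (\<lambda>v. - dN v)" using lindN linear_compose_neg by blast
    moreover have "- dN v \<bullet> n = 0" if "v \<bullet> n = 0" for v using En by (simp add: dN_def)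
    moreover have "- dN v \<bullet> w = - dN w \<bullet> v" if vw: "v \<bullet> n = 0" "w \<bullet> n = 0" for v w
    proof -
      obtain a b where "D a u = v" "D b u = w" using Drng vw by metis
      then show ?thesis using EQ[of a b] EQ[of b a] Qsym[of a b] LD by (auto simp: dN_def)
    qed
    ultimately show ?thesis using self_adjoint_plane_eigenvectors[of "\<lambda>v. - dN v" n] n1 that by metis
  qed
  have tp: "v \<in> tangent_plane M p \<longleftrightarrow> v \<bullet> n = 0" for v
    by (simp add: tangent_plane_eq[OF p(1)] n_def inner_commute)
  \<comment> \<open>All admissible pairs of curvatures have the same sum, so the description in
    \<open>mean_curvature\<close> is unique even where the principal directions are not.\<close>
  have tr: "k1' + k2' = - (ltrace dN - dN n \<bullet> n)"
    if pd: "principal_direction M N p k1' e1'" "principal_direction M N p k2' e2'" "e1' \<bullet> e2' = 0"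
    for k1' k2' e1' e2'
  proof -
    have e': "norm e1' = 1" "norm e2' = 1" "e1' \<bullet> n = 0" "e2' \<bullet> n = 0"
      using pd tp unfolding principal_direction_def by auto
    have one: "k' = - (dN e' \<bullet> e')" if "principal_direction M N p k' e'" for k' e'
    proof -
      obtain dN' where "(N has_derivative dN') (at p within M)" "- dN' e' = k' *\<^sub>R e'" "norm e' = 1" "e' \<bullet> n = 0"
        using \<open>principal_direction M N p k' e'\<close> tp unfolding principal_direction_def by auto
      moreover obtain a where "D a u = e'" using Drng calculation by metis
      ultimately have "- dN e' = k' *\<^sub>R e'" using dNu dN by metis
      then have "- dN e' \<bullet> e' = k' * (e' \<bullet> e')" by (metis inner_scaleR_left inner_minus_left)
      then show ?thesis using \<open>norm e' = 1\<close> by (simp add: norm_eq_1)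
    qed
    show ?thesis
      using ltrace_onb[OF lindN e'(1,2) n1(1) pd(3) e'(3,4)] one[OF pd(1)] one[OF pd(2)] by simp
  qed
  have pd: "principal_direction M N p k1 e1" "principal_direction M N p k2 e2"
    unfolding principal_direction_def using e k dN tp by auto
  have "mean_curvature M N p = (k1 + k2) / 2"
    unfolding mean_curvature_def
  proof (rule the_equality)
    show "\<exists>k1' k2' e1 e2. principal_direction M N p k1' e1 \<and> principal_direction M N p k2' e2 \<and> e1 \<bullet> e2 = 0 \<and> (k1 + k2) / 2 = (k1' + k2') / 2"
      using pd e by blast
  next
    fix H assume "\<exists>k1 k2 e1 e2. principal_direction M N p k1 e1 \<and> principal_direction M N p k2 e2 \<and> e1 \<bullet> e2 = 0 \<and> H = (k1 + k2) / 2"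
    then show "H = (k1 + k2) / 2" using tr tr[OF pd e(3)] by metis
  qed
  then have H: "k1 + k2 = \<alpha> * (n $ 3) / (p $ 3)" using curvature[OF p(1)] by (simp add: n_def)
  \<comment> \<open>Second derivative test along the image of a straight line of the parameter
    domain. \<open>Q a a\<close> is the acceleration of that curve; since the gradient is normal,
    only the normal part of it counts.\<close>
  have second: "G p \<bullet> D a u = 0 \<and> A (D a u) \<bullet> D a u + G p \<bullet> Q a a \<le> 0" for a
  proof -
    have contX: "continuous_on V X" using smooth_on_continuous[OF V(2)] .
    have "open (V \<inter> X -` ball p d)" using continuous_open_preimage[OF contX V(1) open_ball] .
    moreover have "u \<in> V \<inter> X -` ball p d" using u Xu d by auto
    moreover have "((\<lambda>t. u + t *\<^sub>R a) \<longlongrightarrow> u + 0 *\<^sub>R a) (at 0)" by (intro tendsto_intros)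
    ultimately have "\<forall>\<^sub>F t in at 0. u + t *\<^sub>R a \<in> V \<inter> X -` ball p d"
      using topological_tendstoD by fastforce
    then obtain \<epsilon> where \<epsilon>: "\<epsilon> > 0" "\<And>t. t \<noteq> 0 \<Longrightarrow> \<bar>t\<bar> < \<epsilon> \<Longrightarrow> u + t *\<^sub>R a \<in> V \<inter> X -` ball p d"
      unfolding eventually_at by auto
    have \<epsilon>': "u + t *\<^sub>R a \<in> V" "X (u + t *\<^sub>R a) \<in> ball p d" if "\<bar>t\<bar> < \<epsilon>" for t
      using \<epsilon>(2)[of t] that u Xu d by (cases "t = 0"; auto)+
    define f where "f = (\<lambda>t. F (X (u + t *\<^sub>R a)))"
    define f' where "f' = (\<lambda>t. G (X (u + t *\<^sub>R a)) \<bullet> D a (u + t *\<^sub>R a))"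
    have line: "((\<lambda>t. u + t *\<^sub>R a) has_derivative (\<lambda>s. s *\<^sub>R a)) (at t)" for t
      by (auto intro!: derivative_eq_intros)
    have Xline: "((\<lambda>t. X (u + t *\<^sub>R a)) has_derivative (\<lambda>s. s *\<^sub>R D a (u + t *\<^sub>R a))) (at t)" if "\<bar>t\<bar> < \<epsilon>" for t
    proof -
      have "((\<lambda>t. X (u + t *\<^sub>R a)) has_derivative (\<lambda>s. D (s *\<^sub>R a) (u + t *\<^sub>R a))) (at t)"
        using has_derivative_compose[OF line Xd[OF \<epsilon>'(1)[OF that]]] .
      then show ?thesis using linear_scale[OF lin[OF \<epsilon>'(1)[OF that]]] by simp
    qed
    have fd: "(f has_real_derivative f' t) (at t)" if "\<bar>t\<bar> < \<epsilon>" for t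
    proof -
      have "(f has_derivative (\<lambda>s. G (X (u + t *\<^sub>R a)) \<bullet> (s *\<^sub>R D a (u + t *\<^sub>R a)))) (at t)"
        unfolding f_def using has_derivative_compose[OF Xline[OF that] F[OF \<epsilon>'(2)[OF that]]] .
      also have "(\<lambda>s. G (X (u + t *\<^sub>R a)) \<bullet> (s *\<^sub>R D a (u + t *\<^sub>R a))) = (*) (f' t)"
        by (simp add: fun_eq_iff f'_def)
      finally show ?thesis by (simp add: has_field_derivative_def)
    qed
    have f'd: "(f' has_real_derivative (A (D a u) \<bullet> D a u + G p \<bullet> Q a a)) (at 0)"
    proof -
      have X0: "((\<lambda>t. X (u + t *\<^sub>R a)) has_derivative (\<lambda>s. s *\<^sub>R D a u)) (at 0)"
        using Xline[of 0] \<epsilon> by simp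
      have "(G has_derivative A) (at (X (u + 0 *\<^sub>R a)))" using G Xu by simp
      from has_derivative_compose[OF X0 this]
      have 1: "((\<lambda>t. G (X (u + t *\<^sub>R a))) has_derivative (\<lambda>s. A (s *\<^sub>R D a u))) (at 0)" .
      have "(D a has_derivative Q a) (at (u + 0 *\<^sub>R a))" using Dd by simp
      from has_derivative_compose[OF line this]
      have 2: "((\<lambda>t. D a (u + t *\<^sub>R a)) has_derivative (\<lambda>s. Q a (s *\<^sub>R a))) (at 0)" .
      have lA: "linear A" "linear (Q a)" using G Dd has_derivative_linear by blast+
      have "(f' has_derivative (\<lambda>s. G p \<bullet> Q a (s *\<^sub>R a) + A (s *\<^sub>R D a u) \<bullet> D a u)) (at 0)"
        unfolding f'_def using has_derivative_inner[OF 1 2] by (simp add: Xu)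
      also have "(\<lambda>s. G p \<bullet> Q a (s *\<^sub>R a) + A (s *\<^sub>R D a u) \<bullet> D a u) = (*) (A (D a u) \<bullet> D a u + G p \<bullet> Q a a)"
        using linear_scale[OF lA(1)] linear_scale[OF lA(2)] by (simp add: fun_eq_iff algebra_simps)
      finally show ?thesis by (simp add: has_field_derivative_def)
    qed
    have fmax: "f t \<le> f 0" if "\<bar>t\<bar> < \<epsilon>" for t
      using max[of "X (u + t *\<^sub>R a)"] \<epsilon>'[OF that] img Xu by (auto simp: f_def)
    show ?thesis
      using second_derivative_le_0_if_local_max[OF \<epsilon>(1) fd f'd fmax]
      by (auto simp: f'_def Xu)
  qed
  show Gn: "G p = (N p \<bullet> G p) *\<^sub>R N p"
  proof -
    let ?z = "G p - (n \<bullet> G p) *\<^sub>R n"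
    have zn: "?z \<bullet> n = 0" using n1 by (simp add: inner_diff_left inner_commute[of "G p" n])
    then obtain a where "D a u = ?z" using Drng by blast
    then have Gz: "G p \<bullet> ?z = 0" using second by metis
    have q: "(G p - k *\<^sub>R n) \<bullet> w = G p \<bullet> w - k * (w \<bullet> n)" for k w
      by (simp add: inner_diff_left inner_commute[of w n])
    have "?z \<bullet> ?z = 0" by (subst q) (simp only: zn Gz mult_zero_right diff_zero)
    then show ?thesis by (simp add: n_def)
  qed
  have key: "A ei \<bullet> ei + (n \<bullet> G p) * ki \<le> 0" if ei: "norm ei = 1" "ei \<bullet> n = 0" "- dN ei = ki *\<^sub>R ei" for ei ki
  proof -
    obtain a where a: "D a u = ei" using Drng ei by blast
    have "G p \<bullet> Q a a = (n \<bullet> G p) * (n \<bullet> Q a a)" by (subst Gn) (simp add: n_def)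
    also have "n \<bullet> Q a a = - (E a \<bullet> ei)" using EQ[of a a] a by simp
    also have "E a = dN ei" using a LD by (auto simp: dN_def)
    also have "- (dN ei \<bullet> ei) = ki"
      using arg_cong[OF ei(3), of "\<lambda>w. w \<bullet> ei"] ei(1) by (simp add: norm_eq_1)
    finally show ?thesis using second[of a] a by simp
  qed
  have "A e1 \<bullet> e1 + A e2 \<bullet> e2 + (n \<bullet> G p) * (k1 + k2) \<le> 0"
    using key[OF e(1,4) k(1)] key[OF e(2,5) k(2)] by (simp add: algebra_simps)
  moreover have "A e1 \<bullet> e1 + A e2 \<bullet> e2 = ltrace A - A n \<bullet> n"
    using ltrace_onb[OF has_derivative_linear[OF G] e(1,2) n1(1) e(3,4,5)] by simp
  moreover have "(n \<bullet> G p) * (k1 + k2) = \<alpha> * (G p $ 3) / (p $ 3)"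
    unfolding H by (subst (2) Gn) (simp add: n_def)
  ultimately show "ltrace A - A (N p) \<bullet> N p + \<alpha> * (G p $ 3) / (p $ 3) \<le> 0"
    by (simp add: n_def)
qed

end

section \<open>Local defining functions\<close>

text \<open>The level sets of a function with gradient \<open>b\<close> and Hessian \<open>A\<close> satisfy the singular
  minimal surface equation precisely where this operator vanishes.\<close>

definition sms_op :: "real \<Rightarrow> (real^3 \<Rightarrow> real^3) \<Rightarrow> real^3 \<Rightarrow> real \<Rightarrow> real" where
  "sms_op \<alpha> A b z = (b \<bullet> b) * ltrace A - A b \<bullet> b + \<alpha> * (b \<bullet> b) * (b $ 3) / z"

lemma linear_real2_expand:
  fixes f :: "real^2 \<Rightarrow> 'b::real_vector"
  assumes "linear f"
  shows "f a = (a $ 1) *\<^sub>R f (axis 1 1) + (a $ 2) *\<^sub>R f (axis 2 1)"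
proof -
  have a: "a = (a $ 1) *\<^sub>R axis 1 1 + (a $ 2) *\<^sub>R axis 2 1"
    by (simp add: vec_eq_iff axis_def forall_2)
  have "f a = f ((a $ 1) *\<^sub>R axis 1 1 + (a $ 2) *\<^sub>R axis 2 1)" using a by (rule arg_cong)
  also have "\<dots> = (a $ 1) *\<^sub>R f (axis 1 1) + (a $ 2) *\<^sub>R f (axis 2 1)"
    unfolding linear_add[OF assms] linear_scale[OF assms] ..
  finally show ?thesis .
qed

lemma ltrace_minus: "ltrace (\<lambda>h. - A h) = - ltrace A"
  by (simp add: ltrace_def sum_negf)

lemma sms_op_minus: "linear A \<Longrightarrow> sms_op \<alpha> (\<lambda>h. - A h) (- b) z = - sms_op \<alpha> A b z"
  by (simp add: sms_op_def ltrace_minus linear_neg)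

context sms
begin

lemma height_pos: "p \<in> M \<Longrightarrow> p $ 3 > 0"
  using upper by (auto simp: upper_half_space_def)

text \<open>The gradient at the maximum is a multiple of the normal, so \<open>sms_op\<close> is its
  squared length times the expression of \<open>local_max_on_surface\<close>. This homogeneous form
  needs no division by a gradient that may vanish.\<close>

lemma sms_op_nonpos_at_local_max:
  assumes p: "p \<in> M" "p \<notin> surface_boundary M" and d: "d > 0"
    and F: "\<And>x. x \<in> ball p d \<Longrightarrow> (F has_derivative (\<lambda>h. G x \<bullet> h)) (at x)"
    and G: "(G has_derivative A) (at p)"
    and max: "\<And>x. x \<in> M \<inter> ball p d \<Longrightarrow> F x \<le> F p"
  shows "sms_op \<alpha> A (G p) (p $ 3) \<le> 0"
proof -
  define k where "k = N p \<bullet> G p"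
  have Gk: "G p = k *\<^sub>R N p"
    using local_max_on_surface(1)[OF p d F G max] by (simp add: k_def)
  have le: "ltrace A - A (N p) \<bullet> N p + \<alpha> * (G p $ 3) / (p $ 3) \<le> 0"
    using local_max_on_surface(2)[OF p d F G max] .
  have "linear A" using G has_derivative_linear by blast
  have "N p \<bullet> N p = 1" using N_norm[OF p(1)] norm_eq_1 by blast
  then have bb: "G p \<bullet> G p = k\<^sup>2" by (simp add: Gk power2_eq_square)
  have Ab: "A (G p) \<bullet> G p = k\<^sup>2 * (A (N p) \<bullet> N p)"
    by (simp add: Gk linear_scale[OF \<open>linear A\<close>] power2_eq_square)
  have "sms_op \<alpha> A (G p) (p $ 3) = k\<^sup>2 * (ltrace A - A (N p) \<bullet> N p + \<alpha> * (G p $ 3) / (p $ 3))"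
    by (simp add: sms_op_def bb Ab algebra_simps)
  also have "\<dots> \<le> 0" using le by (simp add: mult_nonneg_nonpos)
  finally show ?thesis .
qed

lemma sms_op_nonneg_at_local_min:
  assumes p: "p \<in> M" "p \<notin> surface_boundary M" and d: "d > 0"
    and F: "\<And>x. x \<in> ball p d \<Longrightarrow> (F has_derivative (\<lambda>h. G x \<bullet> h)) (at x)"
    and G: "(G has_derivative A) (at p)"
    and min: "\<And>x. x \<in> M \<inter> ball p d \<Longrightarrow> F p \<le> F x"
  shows "sms_op \<alpha> A (G p) (p $ 3) \<ge> 0" and "G p = (N p \<bullet> G p) *\<^sub>R N p"
proof -
  have F': "((\<lambda>x. - F x) has_derivative (\<lambda>h. (- G x) \<bullet> h)) (at x)" if "x \<in> ball p d" for x
    using has_derivative_minus[OF F[OF that]] by simp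
  have G': "((\<lambda>x. - G x) has_derivative (\<lambda>h. - A h)) (at p)"
    using has_derivative_minus[OF G] .
  have m: "- F x \<le> - F p" if "x \<in> M \<inter> ball p d" for x using min[OF that] by simp
  have "sms_op \<alpha> (\<lambda>h. - A h) (- G p) (p $ 3) \<le> 0"
    by (rule sms_op_nonpos_at_local_max[OF p d F' G' m])
  then show "sms_op \<alpha> A (G p) (p $ 3) \<ge> 0"
    using sms_op_minus[OF has_derivative_linear[OF G], of \<alpha> "G p" "p $ 3"] by simp
  show "G p = (N p \<bullet> G p) *\<^sub>R N p"
    using local_max_on_surface(1)[OF p d F' G' m] by simp
qed

text \<open>Near an interior point the surface is a graph in any transversal direction \<open>\<nu>\<close>. The
  defining function \<open>\<phi>\<close> is the \<open>\<nu>\<close>-coordinate of the inverse of \<open>(w, t) \<mapsto> X w + t \<nu>\<close>; its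
  gradient is computed from the normal \<open>X\<^sub>1 \<times> X\<^sub>2\<close>, which gives the second derivative without
  any further inverse function argument.\<close>

lemma local_defining_function:
  assumes p: "p \<in> M" and bd: "closed (surface_boundary M)" "p \<notin> surface_boundary M"
    and nu: "\<nu> \<bullet> N p \<noteq> 0" "norm \<nu> = 1"
  obtains \<phi> :: "real^3 \<Rightarrow> real" and G A \<delta> K where "\<delta> > 0" "K > 0"
    "\<forall>x\<in>ball p \<delta>. (\<phi> has_derivative (\<lambda>h. G x \<bullet> h)) (at x)"
    "\<forall>x\<in>ball p \<delta>. (G has_derivative A x) (at x)"
    "\<forall>x\<in>ball p \<delta>. x \<in> M \<longleftrightarrow> \<phi> x = 0"
    "\<forall>x\<in>ball p \<delta>. \<forall>t. x + t *\<^sub>R \<nu> \<in> ball p \<delta> \<longrightarrow> \<phi> (x + t *\<^sub>R \<nu>) = \<phi> x + t \<and> G (x + t *\<^sub>R \<nu>) = G x"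
    "\<forall>x\<in>ball p \<delta>. \<forall>h. norm (A x h) \<le> K * norm h"
    "\<forall>x\<in>ball p \<delta>. \<bar>sms_op \<alpha> (A x) (G x) (x $ 3)\<bar> \<le> K * \<bar>\<phi> x\<bar>"
    "\<forall>x\<in>ball p \<delta>. G x \<bullet> \<nu> = 1"
    "\<forall>x\<in>ball p \<delta> \<inter> M. G x = (N x \<bullet> G x) *\<^sub>R N x"
    "\<forall>x\<in>ball p \<delta>. norm (G x) \<le> K"
    "ball p \<delta> \<inter> surface_boundary M = {}"
proof -
  obtain V :: "(real^2) set" and X u Y where V: "open V" "smooth_on X V" and u: "u \<in> V" and Xu: "X u = p"
    and inj0: "\<forall>v\<in>V. inj (frechet_derivative X (at v))"
    and op: "openin (top_of_set M) (X ` V)" and hom: "homeomorphism V (X ` V) X Y"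
    and rng0: "\<forall>v\<in>V. range (frechet_derivative X (at v)) = {w. N (X v) \<bullet> w = 0}"
    by (rule interior_chart[OF p bd(2)])
  have img: "X ` V \<subseteq> M" using op openin_imp_subset by blast
  \<comment> \<open>\<open>e\<close> projects space to the parameter plane and \<open>ex\<close> is
    a section of it. The third coordinate carries \<open>t\<close>, so that the inverse function
    theorem is applied between spaces of equal dimension.\<close>
  define e where "e = (\<lambda>y::real^3. (\<chi> i. if i = 1 then y $ 1 else y $ 2) :: real^2)"
  define ex where "ex = (\<lambda>w::real^2. vector [w $ 1, w $ 2, 0] :: real^3)"
  have e_lin: "linear e" unfolding e_def by (rule linearI) (auto simp: vec_eq_iff)
  have e_bl: "bounded_linear e" using e_lin linear_conv_bounded_linear by blast
  have e0 [simp]: "e 0 = 0" by (simp add: linear_0 e_lin)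
  have e3 [simp]: "e (axis 3 1) = 0" "e (y + t *\<^sub>R axis 3 1) = e y" for y t
    by (auto simp: e_def vec_eq_iff axis_def)
  have eex [simp]: "e (ex w) = w" "(ex w) $ 3 = 0" for w
    by (simp_all add: e_def ex_def vec_eq_iff forall_2 vector_def)
  have exe: "ex (e y) = y" if "y $ 3 = 0" for y
    using that by (simp add: e_def ex_def vec_eq_iff forall_3 vector_def)
  have ex_lin: "linear ex" unfolding ex_def by (rule linearI) (auto simp: vec_eq_iff forall_3 vector_def)
  define D where "D = (\<lambda>a v. frechet_derivative X (at v) a)"
  have Xd: "(X has_derivative (\<lambda>a. D a v)) (at v)" if "v \<in> V" for v
    using smooth_on_has_derivative[OF V(2,1) that] by (simp add: D_def)
  have lin: "linear (\<lambda>a. D a v)" if "v \<in> V" for v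
    using Xd[OF that] has_derivative_linear by blast
  have contD: "continuous_on V (D a)" for a
    using smooth_on_continuous[OF smooth_on_frechet_derivative[OF V(2)]] by (simp add: D_def)
  define Q where "Q = (\<lambda>a v h. frechet_derivative (D a) (at v) h)"
  have smD: "smooth_on (D a) V" for a
    using smooth_on_frechet_derivative[OF V(2)] by (simp add: D_def)
  have Dd: "(D a has_derivative Q a v) (at v)" if "v \<in> V" for a v
    using smooth_on_has_derivative[OF smD V(1) that] by (simp add: Q_def)
  have contQ: "continuous_on V (\<lambda>v. Q a v h)" for a h
    using smooth_on_continuous[OF smooth_on_frechet_derivative[OF smD]] by (simp add: Q_def)
  define c where "c = (\<lambda>v. cross3 (D (axis 1 1) v) (D (axis 2 1) v))"
  have bb: "bounded_bilinear cross3" using bilinear_cross bilinear_conv_bounded_bilinear by blast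
  define c' where "c' = (\<lambda>v h. cross3 (D (axis 1 1) v) (Q (axis 2 1) v h) + cross3 (Q (axis 1 1) v h) (D (axis 2 1) v))"
  have cd: "(c has_derivative c' v) (at v)" if "v \<in> V" for v
    unfolding c_def c'_def using bounded_bilinear.FDERIV[OF bb Dd[OF that] Dd[OF that]] .
  have contc': "continuous_on V (\<lambda>v. c' v h)" for h
    unfolding c'_def by (intro continuous_intros continuous_on_cross contD contQ)
  have contc: "continuous_on V c"
    unfolding c_def by (intro continuous_on_cross contD)
  have Dperp: "D a v \<bullet> N (X v) = 0" if "v \<in> V" for a v
    using bspec[OF rng0 that] unfolding D_def by (metis (mono_tags, lifting) inner_commute mem_Collect_eq rangeI)
  have cperp: "c v \<bullet> D a v = 0" if "v \<in> V" for a v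
  proof -
    show ?thesis
      by (subst linear_real2_expand[OF lin[OF that]]) (simp add: c_def inner_add_right dot_cross_self)
  qed
  define U where "U = {y. u + e y \<in> V}"
  have oU: "open U"
  proof -
    have "U = (\<lambda>y. u + e y) -` V" by (auto simp: U_def)
    moreover have "continuous_on UNIV (\<lambda>y. u + e y)"
      by (intro continuous_intros linear_continuous_on e_bl)
    ultimately show ?thesis using V(1) open_vimage by metis
  qed
  have "0 \<in> U" using u by (simp add: U_def)
  define \<Phi> where "\<Phi> = (\<lambda>y. X (u + e y) + (y $ 3) *\<^sub>R \<nu>)"
  define \<Phi>' where "\<Phi>' = (\<lambda>y h. D (e h) (u + e y) + (h $ 3) *\<^sub>R \<nu>)"
  have \<Phi>d: "(\<Phi> has_derivative \<Phi>' y) (at y)" if "y \<in> U" for y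
  proof -
    have "((\<lambda>y. u + e y) has_derivative e) (at y)"
      using bounded_linear_imp_has_derivative[OF e_bl] by (auto intro!: derivative_eq_intros)
    moreover have "u + e y \<in> V" using that by (simp add: U_def)
    ultimately have "((\<lambda>y. X (u + e y)) has_derivative (\<lambda>h. D (e h) (u + e y))) (at y)"
      using has_derivative_compose[OF _ Xd] by blast
    moreover have "((\<lambda>y::real^3. (y $ 3) *\<^sub>R \<nu>) has_derivative (\<lambda>h. (h $ 3) *\<^sub>R \<nu>)) (at y)"
      by (intro bounded_linear_imp_has_derivative bounded_linear_scaleR_left[THEN bounded_linear_compose] bounded_linear_vec_nth)
    ultimately show ?thesis unfolding \<Phi>_def \<Phi>'_def by (rule has_derivative_add)
  qed
  have bl\<Phi>: "bounded_linear (\<Phi>' y)" if "y \<in> U" for y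
    using \<Phi>d[OF that] has_derivative_bounded_linear by blast
  define B where "B = (\<lambda>y. Blinfun (\<Phi>' y))"
  have Bap: "blinfun_apply (B y) = \<Phi>' y" if "y \<in> U" for y
    using bounded_linear_Blinfun_apply[OF bl\<Phi>[OF that]] by (simp add: B_def)
  have contB: "continuous_on U B"
  proof (rule continuous_on_blinfun_componentwise)
    fix i :: "real^3"
    have "continuous_on U (\<lambda>y. \<Phi>' y i)"
      unfolding \<Phi>'_def
      by (intro continuous_intros continuous_on_compose2[OF contD] linear_continuous_on e_bl) (auto simp: U_def)
    then show "continuous_on U (\<lambda>x. blinfun_apply (B x) i)"
      using Bap by (metis (no_types, lifting) continuous_on_cong)
  qed
  have \<Phi>0: "\<Phi> 0 = p" by (simp add: \<Phi>_def Xu)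
  have inj\<Phi>: "inj (\<Phi>' 0)"
  proof -
    have l: "linear (\<Phi>' 0)" using bl\<Phi>[OF \<open>0 \<in> U\<close>] bounded_linear.linear by blast
    have "h = 0" if h: "\<Phi>' 0 h = 0" for h
    proof -
      have "\<Phi>' 0 h \<bullet> N p = (h $ 3) * (\<nu> \<bullet> N p)"
        using Dperp[OF u] Xu by (simp add: \<Phi>'_def inner_add_left)
      then have h3: "h $ 3 = 0" using h nu by simp
      have "D 0 u = 0" using linear_0[OF lin[OF u]] by simp
      then have "D (e h) u = D 0 u" using h h3 by (simp add: \<Phi>'_def)
      then have "e h = 0" using bspec[OF inj0 u] unfolding D_def by (metis injD)
      then show "h = 0" using exe[OF h3] linear_0[OF ex_lin] by metis
    qed
    then show ?thesis using linear_injective_0[OF l] by blast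
  qed
  obtain g0 where g0: "linear g0" "g0 \<circ> \<Phi>' 0 = id"
    using linear_injective_left_inverse inj\<Phi> bl\<Phi>[OF \<open>0 \<in> U\<close>] bounded_linear.linear by metis
  have inv0: "Blinfun g0 o\<^sub>L B 0 = id_blinfun"
  proof (rule blinfun_eqI)
    fix h
    have "bounded_linear g0" using g0(1) linear_conv_bounded_linear by blast
    then show "blinfun_apply (Blinfun g0 o\<^sub>L B 0) h = blinfun_apply id_blinfun h"
      using g0(2) Bap[OF \<open>0 \<in> U\<close>] by (simp add: bounded_linear_Blinfun_apply fun_eq_iff)
  qed
  have derB: "(\<Phi> has_derivative blinfun_apply (B y)) (at y)" if "y \<in> U" for y
    using \<Phi>d[OF that] Bap[OF that] by simp
  obtain U' V' g g' where U': "open U'" "U' \<subseteq> U" "0 \<in> U'" and V': "open V'" "\<Phi> 0 \<in> V'"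
    and hom': "homeomorphism U' V' \<Phi> g"
    and gd: "\<And>y. y \<in> V' \<Longrightarrow> (g has_derivative (g' y)) (at y)"
    and g'inv: "\<And>y. y \<in> V' \<Longrightarrow> g' y = inv (blinfun_apply (B (g y)))"
    and g'bij: "\<And>y. y \<in> V' \<Longrightarrow> bij (blinfun_apply (B (g y)))"
  proof (rule inverse_function_theorem[OF oU derB contB \<open>0 \<in> U\<close> inv0])
    fix U' V' g g'
    assume a: "open U'" "U' \<subseteq> U" "0 \<in> U'" "open V'" "\<Phi> 0 \<in> V'" "homeomorphism U' V' \<Phi> g"
      "\<And>y. y \<in> V' \<Longrightarrow> (g has_derivative (g' y)) (at y)"
      "\<And>y. y \<in> V' \<Longrightarrow> g' y = inv (blinfun_apply (B (g y)))"
      "\<And>y. y \<in> V' \<Longrightarrow> bij (blinfun_apply (B (g y)))"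
    show thesis by (rule that[OF a(1-6)]) (use a(7-9) in blast)+
  qed
  have gU': "g x \<in> U'" and \<Phi>g: "\<Phi> (g x) = x" if "x \<in> V'" for x
    using hom' that unfolding homeomorphism_def by blast+
  have g\<Phi>: "g (\<Phi> y) = y" and \<Phi>V': "\<Phi> y \<in> V'" if "y \<in> U'" for y
    using hom' that unfolding homeomorphism_def by blast+
  have gp: "g p = 0" using g\<Phi>[OF U'(3)] \<Phi>0 by simp
  have pV': "p \<in> V'" using V'(2) \<Phi>0 by simp
  have \<Phi>'g': "\<Phi>' (g x) (g' x h) = h" if "x \<in> V'" for x h
    using g'inv[OF that] g'bij[OF that] Bap[of "g x"] gU'[OF that] U'(2)
    by (metis bij_inv_eq_iff subset_iff)
  have cgV: "u + e (g x) \<in> V" if "x \<in> V'" for x using gU'[OF that] U'(2) by (auto simp: U_def)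
  have cnu: "c v \<bullet> \<nu> \<noteq> 0" if x: "x \<in> V'" "v = u + e (g x)" for v x
  proof
    assume cn: "c v \<bullet> \<nu> = 0"
    have vV: "v \<in> V" using cgV x by simp
    have "c v \<bullet> h = 0" for h
    proof -
      have "h = D (e (g' x h)) v + (g' x h $ 3) *\<^sub>R \<nu>" using \<Phi>'g'[OF x(1), of h] x(2) by (simp add: \<Phi>'_def)
      then show ?thesis using cn cperp[OF vV] by (metis inner_add_right inner_scaleR_right mult_zero_right add.right_neutral)
    qed
    then have "c v = 0" by (metis inner_eq_zero_iff)
    moreover have "c v \<noteq> 0"
      unfolding c_def using cross3_image_nonzero[OF lin[OF vV]] bspec[OF inj0 vV] by (simp add: D_def)
    ultimately show False by simp
  qed
  \<comment> \<open>\<open>c\<close> is orthogonal to the coordinate fields. Divided by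
    \<open>c v \<bullet> \<nu>\<close> it annihilates them and takes the value \<open>1\<close> on
    \<open>\<nu>\<close>, so it is the gradient of \<open>\<phi>\<close>. It depends on the
    parameter alone, whence the invariance of \<open>G\<close> under shifts along
    \<open>\<nu>\<close>.\<close>
  define m where "m = (\<lambda>v. inverse (c v \<bullet> \<nu>) *\<^sub>R c v)"
  define m' where "m' = (\<lambda>v h. inverse (c v \<bullet> \<nu>) *\<^sub>R c' v h
      - (inverse (c v \<bullet> \<nu>) * (c' v h \<bullet> \<nu>) * inverse (c v \<bullet> \<nu>)) *\<^sub>R c v)"
  have md: "(m has_derivative m' v) (at v)" if "v \<in> V" "c v \<bullet> \<nu> \<noteq> 0" for v
  proof -
    have "((\<lambda>v. c v \<bullet> \<nu>) has_derivative (\<lambda>h. c' v h \<bullet> \<nu>)) (at v)"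
      using has_derivative_inner_left[OF cd[OF that(1)]] .
    from Deriv.has_derivative_inverse[OF that(2) this]
    have "((\<lambda>v. inverse (c v \<bullet> \<nu>)) has_derivative (\<lambda>h. - (inverse (c v \<bullet> \<nu>) * (c' v h \<bullet> \<nu>) * inverse (c v \<bullet> \<nu>)))) (at v)" .
    from has_derivative_scaleR[OF this cd[OF that(1)]]
    show ?thesis unfolding m_def m'_def by simp
  qed
  define \<phi> where "\<phi> = (\<lambda>x. g x $ 3)"
  define G where "G = (\<lambda>x. m (u + e (g x)))"
  define A where "A = (\<lambda>x h. m' (u + e (g x)) (e (g' x h)))"
  have G\<nu>: "G x \<bullet> \<nu> = 1" if "x \<in> V'" for x
    using cnu[OF that refl] by (simp add: G_def m_def)
  have \<phi>d: "(\<phi> has_derivative (\<lambda>h. G x \<bullet> h)) (at x)" if x: "x \<in> V'" for x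
  proof -
    have "(\<phi> has_derivative (\<lambda>h. g' x h $ 3)) (at x)"
      unfolding \<phi>_def using has_derivative_compose[OF gd[OF x] bounded_linear_imp_has_derivative[OF bounded_linear_vec_nth]] .
    moreover have "g' x h $ 3 = G x \<bullet> h" for h
    proof -
      let ?v = "u + e (g x)"
      have "h = D (e (g' x h)) ?v + (g' x h $ 3) *\<^sub>R \<nu>" using \<Phi>'g'[OF x, of h] by (simp add: \<Phi>'_def)
      then have "c ?v \<bullet> h = (g' x h $ 3) * (c ?v \<bullet> \<nu>)"
        using cperp[OF cgV[OF x]] by (metis inner_add_right inner_scaleR_right add.left_neutral)
      then show ?thesis using cnu[OF x refl] by (simp add: G_def m_def)
    qed
    ultimately show ?thesis by simp
  qed
  have Gd: "(G has_derivative A x) (at x)" if x: "x \<in> V'" for x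
  proof -
    have 1: "((\<lambda>x. u + e (g x)) has_derivative (\<lambda>h. e (g' x h))) (at x)"
      using has_derivative_compose[OF gd[OF x] bounded_linear_imp_has_derivative[OF e_bl]]
      by (auto intro!: derivative_eq_intros)
    show ?thesis unfolding G_def A_def
      using has_derivative_compose[OF 1 md[OF cgV[OF x] cnu[OF x refl]]] .
  qed
  have contg: "continuous_on V' g" using hom' unfolding homeomorphism_def by blast
  have contw: "continuous_on V' (\<lambda>x. u + e (g x))"
    by (intro continuous_intros continuous_on_compose2[OF linear_continuous_on[OF e_bl] contg]) auto
  have contm': "continuous_on V' (\<lambda>x. m' (u + e (g x)) h)" for h
  proof -
    have "continuous_on V' (\<lambda>x. c (u + e (g x)))"
      by (rule continuous_on_compose2[OF contc contw]) (use cgV in auto)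
    moreover have "continuous_on V' (\<lambda>x. c' (u + e (g x)) h)"
      by (rule continuous_on_compose2[OF contc' contw]) (use cgV in auto)
    ultimately show ?thesis unfolding m'_def
      by (intro continuous_intros) (use cnu in auto)
  qed
  \<comment> \<open>A lower bound for the differential of \<open>\<Phi>\<close> at the base point
    survives small perturbations and so bounds \<open>g'\<close> nearby, without continuity of
    \<open>g'\<close>.\<close>
  obtain c0 where c0: "c0 > 0" "\<And>h. c0 * norm h \<le> norm (\<Phi>' 0 h)"
    using linear_inj_bounded_below_pos[of "\<Phi>' 0"] inj\<Phi> bl\<Phi>[OF \<open>0 \<in> U\<close>] bounded_linear.linear by metis
  define K0 where "K0 = 1 + norm (m' u (axis 1 1)) + norm (m' u (axis 2 1))"
  obtain Ke where Ke: "Ke > 0" "\<And>y. norm (e y) \<le> norm y * Ke"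
    using bounded_linear.pos_bounded[OF e_bl] by blast
  have evV: "\<forall>\<^sub>F x in nhds p. x \<in> V'" using V'(1) pV' eventually_nhds by blast
  have contat: "f \<midarrow>p\<rightarrow> f p" if "continuous_on V' f" for f :: "real^3 \<Rightarrow> 'b::metric_space"
    using that V'(1) pV' continuous_on_eq_continuous_at continuous_at by blast
  have evnh: "\<forall>\<^sub>F x in nhds p. dist (f x) (f p) < r" if "continuous_on V' f" "r > 0" for f :: "real^3 \<Rightarrow> 'b::metric_space" and r
  proof -
    have "f \<midarrow>p\<rightarrow> f p" using contat that by blast
    then have "\<forall>\<^sub>F x in at p. dist (f x) (f p) < r" using that tendstoD by blast
    then show ?thesis unfolding eventually_at_filter using that(2)
      by (elim eventually_mono) (metis UNIV_I dist_self)
  qed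
  have up: "u + e (g p) = u" by (simp add: gp)
  have contBg: "continuous_on V' (\<lambda>x. B (g x))"
    by (rule continuous_on_compose2[OF contB contg]) (use gU' U'(2) in auto)
  have evB: "\<forall>\<^sub>F x in nhds p. dist (B (g x)) (B (g p)) < c0 / 2"
    by (rule evnh[OF contBg]) (use c0(1) in simp)
  have evm: "\<forall>\<^sub>F x in nhds p. dist (m' (u + e (g x)) h) (m' (u + e (g p)) h) < 1" for h
    by (rule evnh[OF contm']) simp
  have contG: "continuous_on V' G"
    using Gd has_derivative_continuous V'(1) by (meson continuous_at_imp_continuous_on)
  have evG: "\<forall>\<^sub>F x in nhds p. dist (G x) (G p) < 1" by (rule evnh[OF contG]) simp
  obtain \<rho> where \<rho>: "\<rho> > 0" "ball 0 (2 * \<rho>) \<subseteq> U'"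
  proof -
    obtain r where "r > 0" "ball 0 r \<subseteq> U'" using U'(1,3) open_contains_ball by blast
    then show ?thesis using that[of "r / 2"] by simp
  qed
  have evg: "\<forall>\<^sub>F x in nhds p. dist (g x) (g p) < \<rho>" using evnh[OF contg \<rho>(1)] .
  have p3: "p $ 3 > 0" using height_pos[OF p] .
  have ev3: "\<forall>\<^sub>F x in nhds p. dist (x $ 3) (p $ 3) < p $ 3 / 2"
    by (rule evnh[of "\<lambda>x. x $ 3" "p $ 3 / 2"]) (use p3 in \<open>auto intro!: continuous_intros\<close>)
  have "\<forall>\<^sub>F x in nhds p. x \<in> - surface_boundary M"
    using bd by (intro eventually_nhds_in_open) auto
  \<comment> \<open>Points of \<open>M\<close> near \<open>p\<close> must lie in the patch, with
    parameters so close to \<open>u\<close> that their lift by \<open>ex\<close> stays in the domain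
    \<open>U'\<close> of the local inverse. The denominator compensates for the norm of
    \<open>ex\<close>.\<close>
  obtain \<delta>c where \<delta>c: "\<delta>c > 0" "\<And>x. \<lbrakk>x \<in> M; dist x p < \<delta>c\<rbrakk> \<Longrightarrow> \<exists>v\<in>V \<inter> ball u (\<rho> / (1 + onorm ex)). X v = x"
  proof -
    have "0 < \<rho> / (1 + onorm ex)"
    proof -
      have "bounded_linear ex" using ex_lin linear_conv_bounded_linear by blast
      then have "0 \<le> onorm ex" by (rule onorm_pos_le)
      then show ?thesis using \<rho>(1) by simp
    qed
    then show ?thesis using openin_image_nbhd[OF op hom u, of "ball u (\<rho> / (1 + onorm ex))"] Xu that by auto
  qed
  have ev\<delta>c: "\<forall>\<^sub>F x in nhds p. dist x p < \<delta>c" using \<delta>c(1) eventually_nhds_metric by blast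
  have "\<forall>\<^sub>F x in nhds p. x \<in> V' \<and> dist (B (g x)) (B (g p)) < c0 / 2
      \<and> dist (m' (u + e (g x)) (axis 1 1)) (m' (u + e (g p)) (axis 1 1)) < 1
      \<and> dist (m' (u + e (g x)) (axis 2 1)) (m' (u + e (g p)) (axis 2 1)) < 1
      \<and> dist (G x) (G p) < 1 \<and> dist (g x) (g p) < \<rho> \<and> dist (x $ 3) (p $ 3) < p $ 3 / 2
      \<and> x \<in> - surface_boundary M \<and> dist x p < \<delta>c"
    by (intro eventually_conj evV evB evm evG evg ev3 ev\<delta>c) fact
  then obtain \<delta>0 where \<delta>0: "\<delta>0 > 0" and near0: "\<And>x. dist x p < \<delta>0 \<Longrightarrow> x \<in> V' \<and> dist (B (g x)) (B (g p)) < c0 / 2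
      \<and> dist (m' (u + e (g x)) (axis 1 1)) (m' (u + e (g p)) (axis 1 1)) < 1
      \<and> dist (m' (u + e (g x)) (axis 2 1)) (m' (u + e (g p)) (axis 2 1)) < 1
      \<and> dist (G x) (G p) < 1 \<and> dist (g x) (g p) < \<rho> \<and> dist (x $ 3) (p $ 3) < p $ 3 / 2
      \<and> x \<in> - surface_boundary M \<and> dist x p < \<delta>c"
    unfolding eventually_nhds_metric by blast
  \<comment> \<open>Two points of this ball are less than \<open>\<rho>\<close> apart, so a shift
    along \<open>\<nu>\<close> from one to the other keeps the preimage in
    \<open>ball 0 (2 * \<rho>)\<close>, inside \<open>U'\<close>.\<close>
  define \<delta>1 where "\<delta>1 = min \<delta>0 (\<rho> / 2)"
  have \<delta>1: "\<delta>1 > 0" using \<delta>0 \<rho> by (simp add: \<delta>1_def)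
  have near: "x \<in> V'" "dist (B (g x)) (B 0) < c0 / 2"
      "norm (m' (u + e (g x)) (axis 1 1)) \<le> K0"
      "norm (m' (u + e (g x)) (axis 2 1)) \<le> K0"
      "norm (G x) \<le> 1 + norm (G p)" "norm (g x) < \<rho>" "x $ 3 > p $ 3 / 2" "x \<notin> surface_boundary M" "dist x p < \<delta>c"
    if "x \<in> ball p \<delta>1" for x
  proof -
    note n = near0[of x]
    have "dist x p < \<delta>0" using that by (simp add: \<delta>1_def dist_commute)
    note n = near0[OF this]
    show "x \<in> V'" "dist (B (g x)) (B 0) < c0 / 2" "norm (g x) < \<rho>" "x \<notin> surface_boundary M" "dist x p < \<delta>c"
      using n by (simp_all add: gp)
    show "x $ 3 > p $ 3 / 2" using n by (simp add: dist_real_def abs_if split: if_splits)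
    show "norm (m' (u + e (g x)) (axis 1 1)) \<le> K0"
      using n norm_triangle_ineq2[of "m' (u + e (g x)) (axis 1 1)" "m' u (axis 1 1)"]
        norm_ge_zero[of "m' u (axis 2 1)"] unfolding up K0_def dist_norm by linarith
    show "norm (m' (u + e (g x)) (axis 2 1)) \<le> K0"
      using n norm_triangle_ineq2[of "m' (u + e (g x)) (axis 2 1)" "m' u (axis 2 1)"]
        norm_ge_zero[of "m' u (axis 1 1)"] unfolding up K0_def dist_norm by linarith
    show "norm (G x) \<le> 1 + norm (G p)"
      using n norm_triangle_ineq2[of "G x" "G p"] unfolding dist_norm by linarith
  qed
  have shift: "g (x + t *\<^sub>R \<nu>) = g x + t *\<^sub>R axis 3 1"
    if x: "x \<in> ball p \<delta>1" "\<bar>t\<bar> < \<rho>" for x t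
  proof -
    have "norm (t *\<^sub>R axis 3 1 :: real^3) < \<rho>" using x(2) by (simp add: norm_axis_1)
    then have "norm (g x + t *\<^sub>R axis 3 1) < 2 * \<rho>"
      using norm_triangle_ineq[of "g x" "t *\<^sub>R axis 3 1"] near(6)[OF x(1)] by linarith
    then have inU: "g x + t *\<^sub>R axis 3 1 \<in> U'" using \<rho>(2) by auto
    have "\<Phi> (g x + t *\<^sub>R axis 3 1) = \<Phi> (g x) + t *\<^sub>R \<nu>"
      by (simp add: \<Phi>_def algebra_simps)
    then show ?thesis using g\<Phi>[OF inU] \<Phi>g[OF near(1)[OF x(1)]] by simp
  qed
  have shift': "\<phi> (x + t *\<^sub>R \<nu>) = \<phi> x + t \<and> G (x + t *\<^sub>R \<nu>) = G x"
    if x: "x \<in> ball p \<delta>1" "x + t *\<^sub>R \<nu> \<in> ball p \<delta>1" for x t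
  proof -
    have "\<bar>t\<bar> = norm ((x + t *\<^sub>R \<nu>) - x)" using nu by simp
    also have "\<dots> < 2 * \<delta>1"
      using x norm_triangle_ineq[of "(x + t *\<^sub>R \<nu>) - p" "p - x"] by (simp add: dist_norm norm_minus_commute)
    also have "\<dots> \<le> \<rho>" by (simp add: \<delta>1_def)
    finally show ?thesis using shift[OF x(1), of t] by (simp add: \<phi>_def G_def)
  qed
  have Mzero: "x \<in> M \<longleftrightarrow> \<phi> x = 0" if x: "x \<in> ball p \<delta>1" for x
  proof
    assume "\<phi> x = 0"
    then have "x = X (u + e (g x))" using \<Phi>g[OF near(1)[OF x]] by (simp add: \<Phi>_def \<phi>_def)
    then show "x \<in> M" using img cgV[OF near(1)[OF x]] by (metis image_subset_iff)
  next
    assume "x \<in> M"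
    then obtain v where v: "v \<in> V" "v \<in> ball u (\<rho> / (1 + onorm ex))" "X v = x"
      using \<delta>c(2)[OF _ near(9)[OF x]] by blast
    have blex: "bounded_linear ex" using ex_lin linear_conv_bounded_linear by blast
    have on: "0 \<le> onorm ex" by (rule onorm_pos_le[OF blex])
    have "norm (ex (v - u)) \<le> onorm ex * norm (v - u)" using onorm[OF blex] .
    also have "\<dots> \<le> (1 + onorm ex) * norm (v - u)" by (simp add: algebra_simps)
    also have "\<dots> \<le> (1 + onorm ex) * (\<rho> / (1 + onorm ex))"
      using v(2) on by (intro mult_left_mono) (auto simp: dist_norm norm_minus_commute)
    also have "\<dots> = \<rho>" using on by simp
    finally have "ex (v - u) \<in> U'" using \<rho> by auto
    moreover have "\<Phi> (ex (v - u)) = x" using v by (simp add: \<Phi>_def)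
    ultimately have "g x = ex (v - u)" using g\<Phi> by metis
    then show "\<phi> x = 0" by (simp add: \<phi>_def)
  qed
  have Abound: "norm (A x h) \<le> (2 * K0 * (Ke * (2 / c0))) * norm h" if x: "x \<in> ball p \<delta>1" for x h
  proof -
    let ?k = "g' x h" and ?v = "u + e (g x)"
    have xV: "x \<in> V'" using near(1)[OF x] .
    have gxU: "g x \<in> U" using gU'[OF xV] U'(2) by blast
    have "norm (\<Phi>' (g x) ?k - \<Phi>' 0 ?k) = norm (blinfun_apply (B (g x) - B 0) ?k)"
      using Bap gxU \<open>0 \<in> U\<close> by (simp add: blinfun.diff_left)
    also have "\<dots> \<le> norm (B (g x) - B 0) * norm ?k" by (rule norm_blinfun)
    also have "\<dots> \<le> c0 / 2 * norm ?k"
      using near(2)[OF x] by (intro mult_right_mono) (auto simp: dist_norm)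
    finally have "norm (h - \<Phi>' 0 ?k) \<le> c0 / 2 * norm ?k" using \<Phi>'g'[OF xV] by simp
    moreover have "norm (\<Phi>' 0 ?k) \<le> norm h + norm (h - \<Phi>' 0 ?k)"
      by (metis norm_minus_commute norm_triangle_sub add.commute)
    ultimately have "c0 / 2 * norm ?k \<le> norm h" using c0(2)[of ?k] by (simp add: algebra_simps)
    then have k: "norm ?k \<le> (2 / c0) * norm h" using c0(1) by (simp add: field_simps)
    have lm: "linear (m' ?v)" using md[OF cgV[OF xV] cnu[OF xV refl]] has_derivative_linear by blast
    define a where "a = e ?k"
    have "m' ?v a = (a $ 1) *\<^sub>R m' ?v (axis 1 1) + (a $ 2) *\<^sub>R m' ?v (axis 2 1)"
      using linear_real2_expand[OF lm] .
    then have "norm (m' ?v a) \<le> \<bar>a $ 1\<bar> * norm (m' ?v (axis 1 1)) + \<bar>a $ 2\<bar> * norm (m' ?v (axis 2 1))"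
      by (metis norm_scaleR norm_triangle_ineq)
    also have "\<dots> \<le> norm a * K0 + norm a * K0"
      using near(3,4)[OF x] component_le_norm_cart[of a] by (intro add_mono mult_mono) auto
    also have "\<dots> = 2 * K0 * norm a" by simp
    also have "\<dots> \<le> 2 * K0 * (Ke * ((2 / c0) * norm h))"
    proof (rule mult_left_mono)
      have "norm a \<le> norm ?k * Ke" using Ke(2) by (simp add: a_def)
      also have "\<dots> \<le> ((2 / c0) * norm h) * Ke" using k Ke(1) by (intro mult_right_mono) auto
      finally show "norm a \<le> Ke * ((2 / c0) * norm h)" by (simp add: mult.commute)
    qed (simp add: K0_def add_nonneg_nonneg)
    finally show ?thesis by (simp add: A_def a_def mult.assoc)
  qed
  \<comment> \<open>\<open>\<phi>\<close> vanishes on \<open>M\<close>, so every point of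
    \<open>M\<close> in the ball is a local maximum and a local minimum of its restriction.\<close>
  have op0: "sms_op \<alpha> (A x) (G x) (x $ 3) = 0" "G x = (N x \<bullet> G x) *\<^sub>R N x" if x: "x \<in> ball p \<delta>1" "x \<in> M" for x
  proof -
    obtain d where d: "d > 0" "ball x d \<subseteq> ball p \<delta>1" using x(1) open_contains_ball open_ball by meson
    have 1: "(\<phi> has_derivative (\<lambda>h. G y \<bullet> h)) (at y)" if "y \<in> ball x d" for y
      by (rule \<phi>d[OF near(1)]) (use that d in blast)
    have z: "\<phi> x = 0" using Mzero[OF x(1)] x(2) by simp
    have zy: "\<phi> y = 0" if "y \<in> M \<inter> ball x d" for y
    proof -
      have "y \<in> ball p \<delta>1" "y \<in> M" using that d(2) by auto
      then show ?thesis using Mzero by simp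
    qed
    have le: "\<phi> y \<le> \<phi> x" and ge: "\<phi> x \<le> \<phi> y" if "y \<in> M \<inter> ball x d" for y
      unfolding z zy[OF that] by simp_all
    note Gx = Gd[OF near(1)[OF x(1)]]
    have "sms_op \<alpha> (A x) (G x) (x $ 3) \<le> 0"
      by (rule sms_op_nonpos_at_local_max[OF x(2) near(8)[OF x(1)] d(1) 1 Gx le])
    moreover note sms_op_nonneg_at_local_min[OF x(2) near(8)[OF x(1)] d(1) 1 Gx ge]
    ultimately show "sms_op \<alpha> (A x) (G x) (x $ 3) = 0" "G x = (N x \<bullet> G x) *\<^sub>R N x" by auto
  qed
  have "isCont \<phi> p" using \<phi>d[OF pV'] has_derivative_continuous by blast
  moreover have "\<phi> p = 0" using gp by (simp add: \<phi>_def)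
  ultimately have "\<forall>\<^sub>F x in at p. \<bar>\<phi> x\<bar> < \<delta>1 / 2"
    using \<delta>1 tendstoD[of \<phi> 0 "at p" "\<delta>1 / 2"] by (simp add: continuous_at)
  then obtain \<delta>2 where \<delta>2: "\<delta>2 > 0" "\<And>x. dist x p < \<delta>2 \<Longrightarrow> \<bar>\<phi> x\<bar> < \<delta>1 / 2"
    unfolding eventually_at using \<open>\<phi> p = 0\<close> \<delta>1 by (metis abs_zero half_gt_zero_iff UNIV_I)
  define \<delta> where "\<delta> = min \<delta>2 (\<delta>1 / 2)"
  have \<delta>: "\<delta> > 0" "ball p \<delta> \<subseteq> ball p \<delta>1" using \<delta>1 \<delta>2 by (auto simp: \<delta>_def)
  \<comment> \<open>Shifting \<open>x\<close> along \<open>\<nu>\<close> onto \<open>M\<close>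
    changes neither gradient nor Hessian, and the operator vanishes there. Only the factor
    \<open>1 / z\<close> differs, by an amount proportional to the shift
    \<open>\<bar>\<phi> x\<bar>\<close>; both heights exceed \<open>p $ 3 / 2\<close>, hence
    \<open>4 / (p $ 3)\<^sup>2\<close>.\<close>
  define L where "L = \<bar>\<alpha>\<bar> * (1 + norm (G p))^3 * (4 / (p $ 3)\<^sup>2)"
  have opK: "\<bar>sms_op \<alpha> (A x) (G x) (x $ 3)\<bar> \<le> L * \<bar>\<phi> x\<bar>" if x: "x \<in> ball p \<delta>" for x
  proof -
    define t where "t = - \<phi> x"
    define y where "y = x + t *\<^sub>R \<nu>"
    have t: "\<bar>t\<bar> < \<delta>1 / 2" using \<delta>2(2)[of x] x by (simp add: t_def \<delta>_def dist_commute)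
    have x1: "x \<in> ball p \<delta>1" using x \<delta> by blast
    have dxy: "dist x y < \<delta>1 / 2" using t nu by (simp add: y_def dist_norm)
    have y1: "y \<in> ball p \<delta>1"
      using dist_triangle[of p y x] dxy x by (simp add: \<delta>_def)
    have "\<phi> y = 0" "G y = G x" using shift'[OF x1, of t] y1 by (auto simp: y_def t_def)
    then have yM: "y \<in> M" using Mzero[OF y1] by simp
    have Ay: "A y = A x"
    proof -
      have "((\<lambda>w. w + t *\<^sub>R \<nu>) has_derivative (\<lambda>h. h)) (at x)" by (auto intro!: derivative_eq_intros)
      moreover have "(G has_derivative A y) (at (x + t *\<^sub>R \<nu>))" using Gd[OF near(1)[OF y1]] by (simp add: y_def)
      ultimately have 1: "((\<lambda>w. G (w + t *\<^sub>R \<nu>)) has_derivative A y) (at x)"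
        using has_derivative_compose by fastforce
      obtain d where d: "d > 0" "ball y d \<subseteq> ball p \<delta>1" using y1 open_contains_ball open_ball by meson
      obtain d' where d': "d' > 0" "ball x d' \<subseteq> ball p \<delta>1" using x1 open_contains_ball open_ball by meson
      have "(G has_derivative A y) (at x)"
      proof (rule has_derivative_transform_within_open[OF 1 open_ball])
        show "x \<in> ball x (min d d')" using d d' by simp
        fix w assume w: "w \<in> ball x (min d d')"
        have "w \<in> ball p \<delta>1" using w d' by auto
        moreover have "w + t *\<^sub>R \<nu> \<in> ball y d" using w by (simp add: y_def dist_norm)
        ultimately show "G (w + t *\<^sub>R \<nu>) = G w" using shift' d by blast
      qed
      then show ?thesis using Gd[OF near(1)[OF x1]] has_derivative_unique by blast
    qed
    have x3: "x $ 3 > p $ 3 / 2" "y $ 3 > p $ 3 / 2" using near(7) x1 y1 by auto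
    have "sms_op \<alpha> (A x) (G x) (y $ 3) = 0" using op0(1)[OF y1 yM] Ay \<open>G y = G x\<close> by simp
    then have "sms_op \<alpha> (A x) (G x) (x $ 3) = \<alpha> * (G x \<bullet> G x) * (G x $ 3) * (1 / x $ 3 - 1 / y $ 3)"
      by (simp add: sms_op_def algebra_simps)
    also have "1 / x $ 3 - 1 / y $ 3 = t * (\<nu> $ 3) * (1 / (x $ 3 * y $ 3))"
      using x3 p3 by (simp add: y_def field_simps)
    finally have eq: "\<bar>sms_op \<alpha> (A x) (G x) (x $ 3)\<bar>
        = \<bar>\<alpha>\<bar> * (G x \<bullet> G x) * \<bar>G x $ 3\<bar> * (\<bar>t\<bar> * \<bar>\<nu> $ 3\<bar> * (1 / (x $ 3 * y $ 3)))"
      using x3 p3 by (simp add: abs_mult)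
    have a1: "G x \<bullet> G x \<le> (1 + norm (G p))\<^sup>2"
      using near(5)[OF x1] by (simp add: dot_square_norm power_mono)
    have a2: "\<bar>G x $ 3\<bar> \<le> 1 + norm (G p)" using near(5)[OF x1] component_le_norm_cart[of "G x" 3] by linarith
    have a3: "\<bar>\<nu> $ 3\<bar> \<le> 1" using component_le_norm_cart[of \<nu> 3] nu by simp
    have a4: "1 / (x $ 3 * y $ 3) \<le> 4 / (p $ 3)\<^sup>2"
    proof -
      have "(p $ 3 / 2) * (p $ 3 / 2) \<le> x $ 3 * y $ 3" using x3 p3 by (intro mult_mono) auto
      then have "1 / (x $ 3 * y $ 3) \<le> 1 / ((p $ 3 / 2) * (p $ 3 / 2))"
        using p3 by (intro divide_left_mono) (auto intro!: mult_pos_pos simp: x3 less_trans[OF _ x3(1)] less_trans[OF _ x3(2)])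
      then show ?thesis by (simp add: power2_eq_square)
    qed
    have pos: "0 \<le> 1 / (x $ 3 * y $ 3)" using x3 p3 by simp
    have m1: "\<bar>\<alpha>\<bar> * (G x \<bullet> G x) * \<bar>G x $ 3\<bar> \<le> \<bar>\<alpha>\<bar> * (1 + norm (G p))\<^sup>2 * (1 + norm (G p))"
      using a1 a2 by (intro mult_mono) auto
    have m2: "\<bar>t\<bar> * \<bar>\<nu> $ 3\<bar> * (1 / (x $ 3 * y $ 3)) \<le> \<bar>t\<bar> * 1 * (4 / (p $ 3)\<^sup>2)"
      using a3 a4 pos by (intro mult_mono) auto
    have "\<bar>sms_op \<alpha> (A x) (G x) (x $ 3)\<bar>
      \<le> (\<bar>\<alpha>\<bar> * (1 + norm (G p))\<^sup>2 * (1 + norm (G p))) * (\<bar>t\<bar> * 1 * (4 / (p $ 3)\<^sup>2))"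
      unfolding eq by (rule mult_mono[OF m1 m2]) (use pos in \<open>auto intro!: mult_nonneg_nonneg\<close>)
    also have "(\<bar>\<alpha>\<bar> * g\<^sup>2 * g) * (\<bar>t\<bar> * 1 * q) = (\<bar>\<alpha>\<bar> * g ^ 3 * q) * \<bar>t\<bar>" for g q
      by (simp add: power2_eq_square power3_eq_cube)
    finally show ?thesis unfolding L_def t_def abs_minus .
  qed
  define KA where "KA = 2 * K0 * (Ke * (2 / c0))"
  define K where "K = 1 + L + KA + (1 + norm (G p))"
  have K0pos: "K0 > 0" by (simp add: K0_def add_pos_nonneg)
  have nn: "L \<ge> 0" "KA \<ge> 0" using K0pos Ke c0 by (auto simp: L_def KA_def)
  show ?thesis
  proof (rule that[of \<delta> K \<phi> G A])
    show "\<delta> > 0" by fact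
    show "K > 0" using nn by (simp add: K_def add_nonneg_pos add_pos_nonneg)
    show "\<forall>x\<in>ball p \<delta>. (\<phi> has_derivative (\<lambda>h. G x \<bullet> h)) (at x)"
      "\<forall>x\<in>ball p \<delta>. (G has_derivative A x) (at x)" using \<delta>(2) near(1) \<phi>d Gd by blast+
    show "\<forall>x\<in>ball p \<delta>. x \<in> M \<longleftrightarrow> \<phi> x = 0" using \<delta>(2) Mzero by blast
    show "\<forall>x\<in>ball p \<delta>. \<forall>t. x + t *\<^sub>R \<nu> \<in> ball p \<delta> \<longrightarrow> \<phi> (x + t *\<^sub>R \<nu>) = \<phi> x + t \<and> G (x + t *\<^sub>R \<nu>) = G x"
      using \<delta>(2) shift' by blast
    show "\<forall>x\<in>ball p \<delta>. \<forall>h. norm (A x h) \<le> K * norm h"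
    proof (intro ballI allI)
      fix x h assume "x \<in> ball p \<delta>"
      then have "norm (A x h) \<le> KA * norm h" using Abound \<delta>(2) by (auto simp: KA_def)
      also have "\<dots> \<le> K * norm h" using nn by (intro mult_right_mono) (auto simp: K_def add_nonneg_nonneg)
      finally show "norm (A x h) \<le> K * norm h" .
    qed
    show "\<forall>x\<in>ball p \<delta>. \<bar>sms_op \<alpha> (A x) (G x) (x $ 3)\<bar> \<le> K * \<bar>\<phi> x\<bar>"
    proof
      fix x assume "x \<in> ball p \<delta>"
      then have "\<bar>sms_op \<alpha> (A x) (G x) (x $ 3)\<bar> \<le> L * \<bar>\<phi> x\<bar>" using opK by blast
      also have "\<dots> \<le> K * \<bar>\<phi> x\<bar>" using nn by (intro mult_right_mono) (auto simp: K_def add_nonneg_nonneg)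
      finally show "\<bar>sms_op \<alpha> (A x) (G x) (x $ 3)\<bar> \<le> K * \<bar>\<phi> x\<bar>" .
    qed
    show "\<forall>x\<in>ball p \<delta>. G x \<bullet> \<nu> = 1" using \<delta>(2) near(1) G\<nu> by blast
    show "\<forall>x\<in>ball p \<delta> \<inter> M. G x = (N x \<bullet> G x) *\<^sub>R N x" using \<delta>(2) op0(2) by blast
    show "\<forall>x\<in>ball p \<delta>. norm (G x) \<le> K"
    proof
      fix x assume "x \<in> ball p \<delta>"
      then have "norm (G x) \<le> 1 + norm (G p)" using \<delta>(2) near(5) by blast
      then show "norm (G x) \<le> K" using nn by (simp add: K_def)
    qed
    show "ball p \<delta> \<inter> surface_boundary M = {}" using \<delta>(2) near(8) by blast
  qed
qed

end

section \<open>The Hopf barrier\<close>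

text \<open>Hopf's exponential comparison function: for positive \<open>\<beta>\<close> and
  \<open>r\<close> it is positive inside the sphere of radius \<open>r\<close> about
  \<open>m\<close>, zero on it and negative outside, with nonzero gradient along the sphere.\<close>

definition barrier :: "real \<Rightarrow> real \<Rightarrow> real^3 \<Rightarrow> real^3 \<Rightarrow> real" where
  "barrier \<beta> r m x = exp (- \<beta> * ((x - m) \<bullet> (x - m))) - exp (- \<beta> * r\<^sup>2)"

definition barrier_grad :: "real \<Rightarrow> real^3 \<Rightarrow> real^3 \<Rightarrow> real^3" where
  "barrier_grad \<beta> m x = (- 2 * \<beta> * exp (- \<beta> * ((x - m) \<bullet> (x - m)))) *\<^sub>R (x - m)"

definition barrier_hess :: "real \<Rightarrow> real^3 \<Rightarrow> real^3 \<Rightarrow> real^3 \<Rightarrow> real^3" where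
  "barrier_hess \<beta> m x h = exp (- \<beta> * ((x - m) \<bullet> (x - m))) *\<^sub>R
     ((4 * \<beta>\<^sup>2 * ((x - m) \<bullet> h)) *\<^sub>R (x - m) - (2 * \<beta>) *\<^sub>R h)"

lemma barrier_has_derivative:
  "(barrier \<beta> r m has_derivative (\<lambda>h. barrier_grad \<beta> m x \<bullet> h)) (at x)"
  unfolding barrier_def barrier_grad_def
  by (rule has_derivative_eq_rhs, (rule derivative_intros)+)
     (auto simp: fun_eq_iff inner_commute algebra_simps)

lemma barrier_grad_has_derivative:
  "(barrier_grad \<beta> m has_derivative barrier_hess \<beta> m x) (at x)"
  unfolding barrier_grad_def barrier_hess_def
  by (rule has_derivative_eq_rhs, (rule derivative_intros)+)
     (auto simp: fun_eq_iff inner_commute algebra_simps power2_eq_square)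

lemma linear_barrier_hess: "linear (barrier_hess \<beta> m x)"
  using barrier_grad_has_derivative has_derivative_linear by blast

lemma ltrace_barrier_hess:
  "ltrace (barrier_hess \<beta> m x) =
     exp (- \<beta> * ((x - m) \<bullet> (x - m))) * (4 * \<beta>\<^sup>2 * ((x - m) \<bullet> (x - m)) - 6 * \<beta>)"
proof -
  have "ltrace (barrier_hess \<beta> m x) = (\<Sum>i\<in>Basis. exp (- \<beta> * ((x - m) \<bullet> (x - m))) *
      (4 * \<beta>\<^sup>2 * (((x - m) \<bullet> i) * ((x - m) \<bullet> i)) - 2 * \<beta>))"
  proof -
    have "((k * (d \<bullet> i)) *\<^sub>R d - l *\<^sub>R i) \<bullet> i = k * ((d \<bullet> i) * (d \<bullet> i)) - l"
      if "i \<in> Basis" for k l and d i :: "real^3"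
      using that by (simp add: inner_diff_left)
    then show ?thesis unfolding ltrace_def barrier_hess_def inner_scaleR_left by (intro sum.cong) simp_all
  qed
  also have "\<dots> = exp (- \<beta> * ((x - m) \<bullet> (x - m))) *
      (4 * \<beta>\<^sup>2 * (\<Sum>i\<in>Basis. ((x - m) \<bullet> i) * ((x - m) \<bullet> i)) - 6 * \<beta>)"
    unfolding sum_distrib_left[symmetric] sum_subtractf by simp
  finally show ?thesis by (simp add: euclidean_inner[symmetric])
qed

text \<open>A Lipschitz estimate in the gradient: the term with the trace contributes
  \<open>6 * K\<^sup>2\<close>, the one with \<open>A b \<bullet> b\<close> contributes
  \<open>2 * K\<^sup>2\<close>, and the cubic one \<open>3 * K ^ 3\<close>.\<close>

lemma sms_op_perturb:
  fixes A :: "real^3 \<Rightarrow> real^3"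
  assumes A: "linear A" "\<And>h. norm (A h) \<le> K * norm h" and b: "norm b \<le> K" "norm b' \<le> K"
    and a: "\<bar>\<alpha>\<bar> / z \<le> K" and z: "z > 0" and K: "K > 0"
  shows "sms_op \<alpha> A b' z \<le> sms_op \<alpha> A b z + (8 * K\<^sup>2 + 3 * K ^ 3) * norm (b' - b)"
proof -
  define d where "d = norm (b' - b)"
  have d0: "d \<ge> 0" by (simp add: d_def)
  have 1: "\<bar>b' \<bullet> b' - b \<bullet> b\<bar> \<le> 2 * K * d"
  proof -
    have "b' \<bullet> b' - b \<bullet> b = (b' - b) \<bullet> (b' + b)" by (simp add: inner_diff_left inner_add_right inner_commute[of b b'])
    then have "\<bar>b' \<bullet> b' - b \<bullet> b\<bar> \<le> d * norm (b' + b)"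
      using Cauchy_Schwarz_ineq2[of "b' - b" "b' + b"] by (simp add: d_def)
    also have "\<dots> \<le> d * (2 * K)"
      using norm_triangle_ineq[of b' b] b d0 by (intro mult_left_mono) linarith+
    finally show ?thesis by (simp only: mult.commute[of d])
  qed
  have 2: "\<bar>ltrace A\<bar> \<le> 3 * K"
  proof -
    have "\<bar>ltrace A\<bar> \<le> (\<Sum>i\<in>(Basis::(real^3) set). \<bar>A i \<bullet> i\<bar>)" unfolding ltrace_def by (rule sum_abs)
    also have "\<dots> \<le> (\<Sum>i\<in>(Basis::(real^3) set). K)"
    proof (rule sum_mono)
      fix i :: "real^3" assume i: "i \<in> Basis"
      then show "\<bar>A i \<bullet> i\<bar> \<le> K" using Cauchy_Schwarz_ineq2[of "A i" i] A(2)[of i] by simp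
    qed
    finally show ?thesis by simp
  qed
  have 3: "\<bar>A b' \<bullet> b' - A b \<bullet> b\<bar> \<le> 2 * K\<^sup>2 * d"
  proof -
    have "A b' \<bullet> b' - A b \<bullet> b = A (b' - b) \<bullet> b' + A b \<bullet> (b' - b)"
      by (simp add: linear_diff[OF A(1)] inner_diff_left inner_diff_right)
    moreover have "\<bar>A (b' - b) \<bullet> b'\<bar> \<le> (K * d) * K"
    proof -
      have "\<bar>A (b' - b) \<bullet> b'\<bar> \<le> norm (A (b' - b)) * norm b'" by (rule Cauchy_Schwarz_ineq2)
      also have "\<dots> \<le> (K * d) * K" using A(2)[of "b' - b"] b K d0 by (intro mult_mono) (auto simp: d_def)
      finally show ?thesis .
    qed
    moreover have "\<bar>A b \<bullet> (b' - b)\<bar> \<le> (K * K) * d"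
    proof -
      have "norm (A b) \<le> K * K" using A(2)[of b] b K by (meson mult_left_mono order_trans less_imp_le)
      have "\<bar>A b \<bullet> (b' - b)\<bar> \<le> norm (A b) * d" unfolding d_def by (rule Cauchy_Schwarz_ineq2)
      also have "\<dots> \<le> (K * K) * d" using \<open>norm (A b) \<le> K * K\<close> d0 by (rule mult_right_mono)
      finally show ?thesis .
    qed
    ultimately show ?thesis by (simp add: power2_eq_square abs_le_iff algebra_simps)
  qed
  have 4: "\<bar>(b' \<bullet> b') * (b' $ 3) - (b \<bullet> b) * (b $ 3)\<bar> \<le> 3 * K\<^sup>2 * d"
  proof -
    have e: "(b' \<bullet> b') * (b' $ 3) - (b \<bullet> b) * (b $ 3) = (b' \<bullet> b' - b \<bullet> b) * (b' $ 3) + (b \<bullet> b) * ((b' - b) $ 3)"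
      by (simp add: algebra_simps)
    have "\<bar>(b' \<bullet> b' - b \<bullet> b) * (b' $ 3)\<bar> \<le> (2 * K * d) * K"
      unfolding abs_mult using 1 component_le_norm_cart[of b' 3] b(2) K d0 by (intro mult_mono) auto
    moreover have "\<bar>(b \<bullet> b) * ((b' - b) $ 3)\<bar> \<le> K\<^sup>2 * d"
      unfolding abs_mult using component_le_norm_cart[of "b' - b" 3] b(1) K d0
      by (intro mult_mono) (auto simp: d_def dot_square_norm power_mono)
    ultimately show ?thesis unfolding e by (simp add: power2_eq_square abs_le_iff algebra_simps)
  qed
  have t1: "(b' \<bullet> b' - b \<bullet> b) * ltrace A \<le> 6 * K\<^sup>2 * d"
  proof -
    have "\<bar>(b' \<bullet> b' - b \<bullet> b) * ltrace A\<bar> \<le> (2 * K * d) * (3 * K)"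
      unfolding abs_mult using 1 2 K d0 by (intro mult_mono) auto
    then show ?thesis by (simp add: power2_eq_square abs_le_iff algebra_simps)
  qed
  have t3: "(\<alpha> / z) * ((b' \<bullet> b') * (b' $ 3) - (b \<bullet> b) * (b $ 3)) \<le> 3 * K ^ 3 * d"
  proof -
    have "\<bar>(\<alpha> / z) * ((b' \<bullet> b') * (b' $ 3) - (b \<bullet> b) * (b $ 3))\<bar> \<le> K * (3 * K\<^sup>2 * d)"
      unfolding abs_mult using 4 a z K d0 by (intro mult_mono) auto
    then show ?thesis by (simp add: power2_eq_square power3_eq_cube abs_le_iff algebra_simps)
  qed
  have "sms_op \<alpha> A b' z - sms_op \<alpha> A b z = (b' \<bullet> b' - b \<bullet> b) * ltrace A - (A b' \<bullet> b' - A b \<bullet> b)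
     + (\<alpha> / z) * ((b' \<bullet> b') * (b' $ 3) - (b \<bullet> b) * (b $ 3))"
    using z by (simp add: sms_op_def field_simps)
  also have "\<dots> \<le> 6 * K\<^sup>2 * d + 2 * K\<^sup>2 * d + 3 * K ^ 3 * d"
    using t1 t3 3 by linarith
  finally show ?thesis by (simp add: d_def algebra_simps)
qed

text \<open>The order of quantifiers matters: \<open>\<beta>\<close> depends on the bounds only and
  serves for all \<open>\<epsilon>\<close>, so that \<open>\<epsilon>\<close> can afterwards be
  taken small depending on \<open>\<beta>\<close>. The last premise is what the bound
  \<open>K * \<bar>w x\<bar>\<close> becomes at a point where \<open>w\<close> lies between
  \<open>0\<close> and \<open>\<epsilon> * barrier \<beta> r m x\<close>.\<close>

definition strict_barrier :: "real \<Rightarrow> real \<Rightarrow> real \<Rightarrow> real \<Rightarrow> real \<Rightarrow> bool" where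
  "strict_barrier \<alpha> K \<kappa> r \<beta> \<longleftrightarrow> (\<forall>\<epsilon> A b z x m. \<epsilon> > 0 \<and> linear A \<and> (\<forall>h. norm (A h) \<le> K * norm h) \<and> norm b \<le> K \<and>
       \<bar>\<alpha>\<bar> / z \<le> K \<and> z > 0 \<and> r / 2 \<le> norm (x - m) \<and> norm (x - m) \<le> 2 * r \<and>
       norm (b - \<epsilon> *\<^sub>R barrier_grad \<beta> m x) \<le> K \<and> \<kappa> \<le> norm (b - \<epsilon> *\<^sub>R barrier_grad \<beta> m x) \<and>
       \<bar>(x - m) \<bullet> (b - \<epsilon> *\<^sub>R barrier_grad \<beta> m x)\<bar> \<le> norm (x - m) * norm (b - \<epsilon> *\<^sub>R barrier_grad \<beta> m x) / 2 \<and>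
       sms_op \<alpha> A b z \<le> K * (\<epsilon> * barrier \<beta> r m x)
     \<longrightarrow> sms_op \<alpha> (\<lambda>h. A h - \<epsilon> *\<^sub>R barrier_hess \<beta> m x h) (b - \<epsilon> *\<^sub>R barrier_grad \<beta> m x) z < 0)"

text \<open>For large \<open>\<beta>\<close> the term of order \<open>\<beta>\<^sup>2\<close> in the Hessian of the barrier dominates the
  contributions of its gradient and its values; it is elliptic because \<open>x - m\<close> is far from
  being parallel to the gradient.\<close>

lemma barrier_strict:
  fixes \<alpha> K \<kappa> r :: real
  assumes K: "K > 0" and \<kappa>: "\<kappa> > 0" and r: "r > 0"
  shows "\<exists>\<beta>>0. strict_barrier \<alpha> K \<kappa> r \<beta>"
proof -
  define C where "C = 8 * K\<^sup>2 + 3 * K ^ 3"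
  have C: "C > 0" using K by (simp add: C_def add_pos_pos)
  \<comment> \<open>With \<open>\<beta> * r\<^sup>2 \<ge> 16\<close> the term quadratic in
    \<open>\<beta>\<close> absorbs the linear one and leaves at least
    \<open>\<beta>\<^sup>2 * \<kappa>\<^sup>2 * r\<^sup>2 / 2\<close>. The last summand makes this
    exceed the error \<open>K + 4 * C * \<beta> * r\<close>, using
    \<open>K \<le> \<beta> * K\<close>.\<close>
  define \<beta> where "\<beta> = 1 + 16 / r\<^sup>2 + 2 * (K + 4 * C * r) / (\<kappa>\<^sup>2 * r\<^sup>2)"
  have q0: "16 / r\<^sup>2 > 0" "2 * (K + 4 * C * r) / (\<kappa>\<^sup>2 * r\<^sup>2) > 0" using K C r \<kappa> by (auto intro!: divide_pos_pos add_pos_pos)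
  then have \<beta>: "\<beta> \<ge> 1" "\<beta> \<ge> 16 / r\<^sup>2" "\<beta> > 2 * (K + 4 * C * r) / (\<kappa>\<^sup>2 * r\<^sup>2)"
    unfolding \<beta>_def by linarith+
  have \<beta>1: "\<beta> * r\<^sup>2 \<ge> 16" using \<beta>(2) r by (simp add: field_simps)
  have \<beta>2: "\<beta> * (\<kappa>\<^sup>2 * r\<^sup>2) / 2 > K + 4 * C * r"
  proof -
    have "\<kappa>\<^sup>2 * r\<^sup>2 > 0" using \<kappa> r by simp
    then show ?thesis using \<beta>(3) by (simp add: pos_divide_less_eq)
  qed
  show ?thesis
    unfolding strict_barrier_def
  proof (intro exI[of _ \<beta>] conjI allI impI; (elim conjE)?)
    show "\<beta> > 0" using \<beta>(1) by simp
    fix \<epsilon> :: real and A :: "real^3 \<Rightarrow> real^3" and b :: "real^3" and z :: real and x m :: "real^3"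
    assume \<epsilon>: "\<epsilon> > 0" and A0: "linear A" "\<forall>h. norm (A h) \<le> K * norm h" and b: "norm b \<le> K"
      and z: "\<bar>\<alpha>\<bar> / z \<le> K" "z > 0" and d: "r / 2 \<le> norm (x - m)" "norm (x - m) \<le> 2 * r"
      and b': "norm (b - \<epsilon> *\<^sub>R barrier_grad \<beta> m x) \<le> K" "\<kappa> \<le> norm (b - \<epsilon> *\<^sub>R barrier_grad \<beta> m x)"
      and ang: "\<bar>(x - m) \<bullet> (b - \<epsilon> *\<^sub>R barrier_grad \<beta> m x)\<bar> \<le> norm (x - m) * norm (b - \<epsilon> *\<^sub>R barrier_grad \<beta> m x) / 2"
      and op: "sms_op \<alpha> A b z \<le> K * (\<epsilon> * barrier \<beta> r m x)"
    note A = A0(1) A0(2)[rule_format]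
    define c where "c = b - \<epsilon> *\<^sub>R barrier_grad \<beta> m x"
    define v where "v = x - m"
    define E where "E = exp (- \<beta> * (v \<bullet> v))"
    have E: "E > 0" by (simp add: E_def)
    have A': "linear (\<lambda>h. A h - \<epsilon> *\<^sub>R barrier_hess \<beta> m x h)"
      using A(1) linear_barrier_hess by (intro linear_compose_sub linear_compose_scale_right)
    have lt: "ltrace (\<lambda>h. A h - \<epsilon> *\<^sub>R barrier_hess \<beta> m x h) = ltrace A - \<epsilon> * (E * (4 * \<beta>\<^sup>2 * (v \<bullet> v) - 6 * \<beta>))"
      using ltrace_barrier_hess[of \<beta> m x]
      by (simp add: ltrace_def inner_diff_left sum_subtractf sum_distrib_left[symmetric] E_def v_def)
    have hc: "barrier_hess \<beta> m x c \<bullet> c = E * (4 * \<beta>\<^sup>2 * (v \<bullet> c)\<^sup>2 - 2 * \<beta> * (c \<bullet> c))"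
      unfolding barrier_hess_def v_def[symmetric] E_def[symmetric]
      by (simp add: inner_diff_left power2_eq_square algebra_simps)
    have split: "sms_op \<alpha> (\<lambda>h. A h - \<epsilon> *\<^sub>R barrier_hess \<beta> m x h) c z = sms_op \<alpha> A c z
        - \<epsilon> * E * (4 * \<beta>\<^sup>2 * ((c \<bullet> c) * (v \<bullet> v) - (v \<bullet> c)\<^sup>2) - 4 * \<beta> * (c \<bullet> c))"
      unfolding sms_op_def lt inner_diff_left inner_scaleR_left hc by (simp add: algebra_simps)
    have ncb: "norm (c - b) \<le> \<epsilon> * (2 * \<beta> * E * (2 * r))"
    proof -
      have "norm (c - b) = \<epsilon> * (2 * \<beta> * E * norm v)"
        using \<epsilon> \<beta>(1) E by (simp add: c_def barrier_grad_def v_def E_def abs_mult)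
      then show ?thesis using d(2) \<epsilon> \<beta>(1) E by (simp add: v_def mult_left_mono)
    qed
    have "sms_op \<alpha> A c z \<le> sms_op \<alpha> A b z + C * norm (c - b)"
      unfolding C_def by (rule sms_op_perturb[OF A b b'(1)[folded c_def] z K])
    also have "\<dots> \<le> K * (\<epsilon> * E) + C * (\<epsilon> * (2 * \<beta> * E * (2 * r)))"
    proof (rule add_mono)
      have "barrier \<beta> r m x \<le> E" by (simp add: barrier_def E_def v_def)
      then have "K * (\<epsilon> * barrier \<beta> r m x) \<le> K * (\<epsilon> * E)" using K \<epsilon> by simp
      then show "sms_op \<alpha> A b z \<le> K * (\<epsilon> * E)" using op by linarith
      show "C * norm (c - b) \<le> C * (\<epsilon> * (2 * \<beta> * E * (2 * r)))" using ncb C by simp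
    qed
    finally have u1: "sms_op \<alpha> A c z \<le> \<epsilon> * E * (K + 4 * C * \<beta> * r)" by (simp add: algebra_simps)
    \<comment> \<open>The gradient makes an angle of at least sixty degrees with the line along
      \<open>v\<close>, so three quarters of \<open>(c \<bullet> c) * (v \<bullet> v)\<close>
      survive in the leading term.\<close>
    have vc: "(v \<bullet> c)\<^sup>2 \<le> (c \<bullet> c) * (v \<bullet> v) / 4"
    proof -
      have "\<bar>v \<bullet> c\<bar> \<le> norm v * norm c / 2" using ang by (simp add: v_def c_def)
      then have "\<bar>v \<bullet> c\<bar>\<^sup>2 \<le> (norm v * norm c / 2)\<^sup>2" by (intro power_mono) auto
      then show ?thesis by (simp add: power_mult_distrib power_divide dot_square_norm mult.commute)
    qed
    have vv: "v \<bullet> v \<ge> r\<^sup>2 / 4"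
    proof -
      have "(r / 2)\<^sup>2 \<le> (norm v)\<^sup>2" using d(1) r by (intro power_mono) (auto simp: v_def)
      then show ?thesis by (simp add: dot_square_norm power_divide)
    qed
    have cc: "c \<bullet> c \<ge> \<kappa>\<^sup>2"
      using b'(2) \<kappa> by (simp add: dot_square_norm power_mono c_def)
    have "4 * \<beta>\<^sup>2 * ((c \<bullet> c) * (v \<bullet> v) - (v \<bullet> c)\<^sup>2) \<ge> 4 * \<beta>\<^sup>2 * (3 / 4 * ((c \<bullet> c) * (v \<bullet> v)))"
      using vc by (intro mult_left_mono) auto
    moreover have "4 * \<beta>\<^sup>2 * (3 / 4 * ((c \<bullet> c) * (v \<bullet> v))) \<ge> 4 * \<beta>\<^sup>2 * (3 / 4 * ((c \<bullet> c) * (r\<^sup>2 / 4)))"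
      using vv by (intro mult_left_mono) auto
    ultimately have "4 * \<beta>\<^sup>2 * ((c \<bullet> c) * (v \<bullet> v) - (v \<bullet> c)\<^sup>2) - 4 * \<beta> * (c \<bullet> c)
        \<ge> 3 * \<beta>\<^sup>2 * ((c \<bullet> c) * (r\<^sup>2 / 4)) - 4 * \<beta> * (c \<bullet> c)" by linarith
    also have "3 * \<beta>\<^sup>2 * ((c \<bullet> c) * (r\<^sup>2 / 4)) - 4 * \<beta> * (c \<bullet> c) = \<beta> * (c \<bullet> c) * (3 / 4 * (\<beta> * r\<^sup>2) - 4)"
      by (simp add: power2_eq_square algebra_simps)
    finally have l1: "4 * \<beta>\<^sup>2 * ((c \<bullet> c) * (v \<bullet> v) - (v \<bullet> c)\<^sup>2) - 4 * \<beta> * (c \<bullet> c)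
        \<ge> \<beta> * (c \<bullet> c) * (3 / 4 * (\<beta> * r\<^sup>2) - 4)" .
    have "\<beta> * (c \<bullet> c) * (3 / 4 * (\<beta> * r\<^sup>2) - 4) \<ge> \<beta> * \<kappa>\<^sup>2 * (\<beta> * r\<^sup>2 / 2)"
      using \<beta>1 \<beta>(1) cc by (intro mult_mono) auto
    moreover have "\<beta> * \<kappa>\<^sup>2 * (\<beta> * r\<^sup>2 / 2) = \<beta> * (\<beta> * (\<kappa>\<^sup>2 * r\<^sup>2) / 2)" by simp
    moreover have "\<beta> * (\<beta> * (\<kappa>\<^sup>2 * r\<^sup>2) / 2) > \<beta> * (K + 4 * C * r)"
      using \<beta>2 \<beta>(1) by (intro mult_strict_left_mono) auto
    moreover have "\<beta> * (K + 4 * C * r) \<ge> K + 4 * C * \<beta> * r"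
      using mult_right_mono[OF \<beta>(1), of K] K by (simp add: algebra_simps)
    ultimately have "4 * \<beta>\<^sup>2 * ((c \<bullet> c) * (v \<bullet> v) - (v \<bullet> c)\<^sup>2) - 4 * \<beta> * (c \<bullet> c) > K + 4 * C * \<beta> * r"
      using l1 by linarith
    then have "\<epsilon> * E * (4 * \<beta>\<^sup>2 * ((c \<bullet> c) * (v \<bullet> v) - (v \<bullet> c)\<^sup>2) - 4 * \<beta> * (c \<bullet> c)) > \<epsilon> * E * (K + 4 * C * \<beta> * r)"
      using \<epsilon> E by (intro mult_strict_left_mono) auto
    then show "sms_op \<alpha> (\<lambda>h. A h - \<epsilon> *\<^sub>R barrier_hess \<beta> m x h) (b - \<epsilon> *\<^sub>R barrier_grad \<beta> m x) z < 0"
      using split u1 unfolding c_def by linarith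
  qed
qed

section \<open>Comparison with the barrier\<close>

text \<open>Substitute for a solution of a linear elliptic equation. Local defining functions of the
  surface have this property, and it is stable under reflection in vertical planes and under change
  of sign.\<close>

definition comparison_function ::
    "real \<Rightarrow> real^3 \<Rightarrow> real \<Rightarrow> real \<Rightarrow> (real^3 \<Rightarrow> real) \<Rightarrow> (real^3 \<Rightarrow> real^3) \<Rightarrow> (real^3 \<Rightarrow> real^3 \<Rightarrow> real^3) \<Rightarrow> bool" where
  "comparison_function \<alpha> p \<delta> K w G A \<longleftrightarrow> \<delta> > 0 \<and> K > 0 \<and>
     (\<forall>x\<in>ball p \<delta>. (w has_derivative (\<lambda>h. G x \<bullet> h)) (at x) \<and> (G has_derivative A x) (at x) \<and>
        (\<forall>h. norm (A x h) \<le> K * norm h) \<and> norm (G x) \<le> K \<and>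
        \<bar>sms_op \<alpha> (A x) (G x) (x $ 3)\<bar> \<le> K * \<bar>w x\<bar>)"

lemma comparison_functionD:
  assumes "comparison_function \<alpha> p \<delta> K w G A"
  shows "\<delta> > 0" "K > 0"
    "\<And>x. x \<in> ball p \<delta> \<Longrightarrow> (w has_derivative (\<lambda>h. G x \<bullet> h)) (at x)"
    "\<And>x. x \<in> ball p \<delta> \<Longrightarrow> (G has_derivative A x) (at x)"
    "\<And>x h. x \<in> ball p \<delta> \<Longrightarrow> norm (A x h) \<le> K * norm h"
    "\<And>x. x \<in> ball p \<delta> \<Longrightarrow> norm (G x) \<le> K"
    "\<And>x. x \<in> ball p \<delta> \<Longrightarrow> \<bar>sms_op \<alpha> (A x) (G x) (x $ 3)\<bar> \<le> K * \<bar>w x\<bar>"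
  using assms unfolding comparison_function_def by auto

lemma norm_barrier_grad_le:
  assumes "\<beta> > 0" "norm (x - m) \<le> 2 * r"
  shows "norm (barrier_grad \<beta> m x) \<le> 4 * \<beta> * r"
proof -
  have "exp (- \<beta> * ((x - m) \<bullet> (x - m))) \<le> 1" using assms by simp
  then have "norm (barrier_grad \<beta> m x) \<le> 2 * \<beta> * 1 * (2 * r)"
    unfolding barrier_grad_def norm_scaleR abs_mult using assms
    by (intro mult_mono) (auto simp: abs_mult)
  then show ?thesis by simp
qed

locale compact_sms = sms +
  assumes compact_M: "compact M" and closed_boundary: "closed (surface_boundary M)"
begin

text \<open>The sphere of radius \<open>r\<close> about \<open>m\<close> passes through \<open>q\<close>, and \<open>w\<close> is positive on the part of \<open>M \<inter> H\<close>
  that it encloses near \<open>q\<close>. Inside the sphere, \<open>H\<close> has no boundary points relative to \<open>M\<close>.\<close>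

definition barrier_admissible ::
    "(real^3) set \<Rightarrow> (real^3 \<Rightarrow> real) \<Rightarrow> real^3 \<Rightarrow> (real^3) set \<Rightarrow> real^3 \<Rightarrow> real^3 \<Rightarrow> real \<Rightarrow> bool" where
  "barrier_admissible D w b H q m r \<longleftrightarrow> r > 0 \<and> cball q (r / 2) \<subseteq> D \<and> dist q m = r \<and>
     (\<forall>x\<in>M \<inter> cball q (r / 2). \<bar>(x - m) \<bullet> b\<bar> \<le> 1 / 4 * (norm (x - m) * norm b)) \<and>
     closed H \<and> (\<forall>x\<in>M \<inter> H \<inter> cball q (r / 2). 0 \<le> w x) \<and>
     (\<forall>x\<in>M \<inter> H \<inter> cball q (r / 2). dist x m \<le> r \<and> x \<noteq> q \<longrightarrow> 0 < w x) \<and>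
     (\<forall>x\<in>M \<inter> H \<inter> cball q (r / 2). dist x m < r \<longrightarrow> (\<exists>e>0. M \<inter> ball x e \<subseteq> H))"

text \<open>If \<open>w\<close> minus a small multiple of the barrier were negative somewhere on the
  piece, its minimum would lie inside the sphere and off the edge of the piece, where the second
  derivative test contradicts \<open>strict_barrier\<close>. The set \<open>H\<close> is all of
  space in the strong maximum principle and a half-space in the Hopf argument.\<close>

lemma barrier_comparison:
  assumes p: "p \<in> M" and w: "comparison_function \<alpha> p \<delta> K w G A"
    and bd: "ball p \<delta> \<inter> surface_boundary M = {}" and Gp: "G p \<noteq> 0"
  obtains \<delta>' where "\<delta>' > 0" "\<delta>' \<le> \<delta>" "\<forall>x\<in>ball p \<delta>'. norm (G x - G p) \<le> norm (G p) / 16"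
    "\<forall>q m r H. barrier_admissible (ball p \<delta>') w (G p) H q m r
      \<longrightarrow> (\<exists>\<epsilon>>0. \<exists>\<beta>>0. \<forall>x\<in>M \<inter> H \<inter> cball q (r / 2). \<epsilon> * barrier \<beta> r m x \<le> w x)"
proof -
  note wD = comparison_functionD[OF w]
  have p3: "p $ 3 > 0" using height_pos[OF p] .
  have pd: "p \<in> ball p \<delta>" using wD(1) by simp
  have "isCont G p" using wD(4)[OF pd] has_derivative_continuous by blast
  then have ev1: "\<forall>\<^sub>F x in at p. dist (G x) (G p) < norm (G p) / 16"
    using Gp tendstoD[of G "G p" "at p" "norm (G p) / 16"] by (simp add: continuous_at)
  have "((\<lambda>x. x $ 3) \<longlongrightarrow> p $ 3) (at p)" by (intro tendsto_intros)
  then have ev2: "\<forall>\<^sub>F x in at p. dist (x $ 3) (p $ 3) < p $ 3 / 2"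
    using p3 tendstoD[of "\<lambda>x. x $ 3" "p $ 3" "at p" "p $ 3 / 2"] by simp
  obtain d where d: "d > 0" "\<And>x. x \<noteq> p \<Longrightarrow> dist x p < d \<Longrightarrow> dist (G x) (G p) < norm (G p) / 16 \<and> dist (x $ 3) (p $ 3) < p $ 3 / 2"
    using eventually_conj[OF ev1 ev2] unfolding eventually_at by auto
  define \<delta>' where "\<delta>' = min d \<delta>"
  have \<delta>': "\<delta>' > 0" "\<delta>' \<le> \<delta>" using d wD(1) by (auto simp: \<delta>'_def)
  have near: "norm (G x - G p) \<le> norm (G p) / 16" "p $ 3 / 2 < x $ 3" if "x \<in> ball p \<delta>'" for x
  proof -
    have "norm (G x - G p) \<le> norm (G p) / 16 \<and> p $ 3 / 2 < x $ 3"
    proof (cases "x = p")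
      case True then show ?thesis using p3 by simp
    next
      case False
      have "dist x p < d" using that by (simp add: \<delta>'_def dist_commute)
      from d(2)[OF False this] show ?thesis by (auto simp: dist_norm abs_if split: if_splits)
    qed
    then show "norm (G x - G p) \<le> norm (G p) / 16" "p $ 3 / 2 < x $ 3" by auto
  qed
  define g where "g = norm (G p)"
  have g: "g > 0" using Gp by (simp add: g_def)
  \<comment> \<open>\<open>g\<close> leaves room for the perturbed gradient, and
    \<open>2 * \<bar>\<alpha>\<bar> / (p $ 3)\<close> bounds \<open>\<bar>\<alpha>\<bar> / z\<close>
    at all heights \<open>z\<close> above half the height of \<open>p\<close>.\<close>
  define K' where "K' = K + g + 2 * \<bar>\<alpha>\<bar> / (p $ 3)"
  have K'0: "2 * \<bar>\<alpha>\<bar> / (p $ 3) \<ge> 0" using p3 by simp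
  have K': "K' > 0" "K \<le> K'" "g \<le> K' - K" using wD(2) g K'0 unfolding K'_def by linarith+
  show ?thesis
  proof (rule that[OF \<delta>'])
    show "\<forall>x\<in>ball p \<delta>'. norm (G x - G p) \<le> norm (G p) / 16" using near(1) by blast
    show "\<forall>q m r H. barrier_admissible (ball p \<delta>') w (G p) H q m r
      \<longrightarrow> (\<exists>\<epsilon>>0. \<exists>\<beta>>0. \<forall>x\<in>M \<inter> H \<inter> cball q (r / 2). \<epsilon> * barrier \<beta> r m x \<le> w x)"
      unfolding barrier_admissible_def
    proof (intro allI impI; elim conjE)
    fix q m :: "real^3" and r :: real and H :: "(real^3) set"
    assume r: "r > 0" and cb: "cball q (r / 2) \<subseteq> ball p \<delta>'" and qm: "dist q m = r"
      and flat: "\<forall>x\<in>M \<inter> cball q (r / 2). \<bar>(x - m) \<bullet> G p\<bar> \<le> 1 / 4 * (norm (x - m) * norm (G p))"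
      and H: "closed H"
      and w0: "\<forall>x\<in>M \<inter> H \<inter> cball q (r / 2). 0 \<le> w x"
      and w1: "\<forall>x\<in>M \<inter> H \<inter> cball q (r / 2). dist x m \<le> r \<and> x \<noteq> q \<longrightarrow> 0 < w x"
      and Hn: "\<forall>x\<in>M \<inter> H \<inter> cball q (r / 2). dist x m < r \<longrightarrow> (\<exists>e>0. M \<inter> ball x e \<subseteq> H)"
    have gr: "g / 2 > 0" using g by simp
    obtain \<beta> where \<beta>: "\<beta> > 0" and strict: "strict_barrier \<alpha> K' (g / 2) r \<beta>"
      using barrier_strict[OF K'(1) gr r] by blast
    have wcont: "continuous_on (cball q (r / 2)) w"
    proof (rule continuous_at_imp_continuous_on, rule ballI)
      fix x assume "x \<in> cball q (r / 2)"
      then have "x \<in> ball p \<delta>" using cb \<delta>' by auto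
      then show "isCont w x" using wD(3) has_derivative_continuous by blast
    qed
    \<comment> \<open>The part of the outer edge where the barrier can be positive. It does not
      contain \<open>q\<close>, so \<open>w\<close> is bounded below there by some
      \<open>\<eta> > 0\<close>. If it is empty, any value does for \<open>\<eta>\<close>.\<close>
    define S where "S = M \<inter> H \<inter> (sphere q (r / 2) \<inter> cball m r)"
    have "compact S" unfolding S_def
      by (intro compact_Int_closed compact_M H closed_Int closed_cball closed_sphere)
    have Spos: "0 < w x" if "x \<in> S" for x
      using that r by (intro w1[rule_format]) (auto simp: S_def dist_commute)
    obtain \<eta> where \<eta>: "\<eta> > 0" "\<And>x. x \<in> S \<Longrightarrow> \<eta> \<le> w x"
    proof (cases "S = {}")
      case True then show ?thesis using that[of 1] by simp
    next
      case False
      have "continuous_on S w" by (rule continuous_on_subset[OF wcont]) (auto simp: S_def)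
      then obtain x where "x \<in> S" "\<forall>y\<in>S. w x \<le> w y"
        using continuous_attains_inf[OF \<open>compact S\<close> False] by blast
      then show ?thesis using that[of "w x"] Spos by blast
    qed
    \<comment> \<open>The barrier is at most \<open>1\<close>, so
      \<open>\<epsilon> \<le> \<eta>\<close> settles the edge \<open>S\<close>. The second entry
      keeps the change of the gradient below \<open>g / 16\<close>.\<close>
    define \<epsilon> where "\<epsilon> = min \<eta> (g / (64 * \<beta> * r))"
    have \<epsilon>: "\<epsilon> > 0" "\<epsilon> \<le> \<eta>" "\<epsilon> * (4 * \<beta> * r) \<le> g / 16"
    proof -
      show "\<epsilon> > 0" "\<epsilon> \<le> \<eta>" using \<eta> g \<beta> r by (auto simp: \<epsilon>_def)
      have "\<epsilon> * (4 * \<beta> * r) \<le> g / (64 * \<beta> * r) * (4 * \<beta> * r)"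
        using \<beta> r by (intro mult_right_mono) (auto simp: \<epsilon>_def)
      then show "\<epsilon> * (4 * \<beta> * r) \<le> g / 16" using \<beta> r by simp
    qed
    define F where "F = (\<lambda>x. w x - \<epsilon> * barrier \<beta> r m x)"
    define T where "T = M \<inter> H \<inter> cball q (r / 2)"
    have cT: "compact T" unfolding T_def by (intro compact_Int_closed compact_M H closed_cball)
    have Fcont: "continuous_on T F" unfolding F_def
      by (intro continuous_intros continuous_on_subset[OF wcont] continuous_at_imp_continuous_on ballI
            has_derivative_continuous[OF barrier_has_derivative]) (auto simp: T_def)
    have "\<forall>x\<in>T. 0 \<le> F x"
    proof (rule ccontr)
      assume "\<not> (\<forall>x\<in>T. 0 \<le> F x)"
      then obtain x0 where x0: "x0 \<in> T" "F x0 < 0" by fastforce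
      obtain x where x: "x \<in> T" "\<And>y. y \<in> T \<Longrightarrow> F x \<le> F y"
        using continuous_attains_inf[OF cT _ Fcont] x0 by blast
      have Fx: "F x < 0" using x(2)[OF x0(1)] x0(2) by linarith
      have wx: "0 \<le> w x" using w0 x(1) by (simp add: T_def)
      have bx: "barrier \<beta> r m x > 0"
        using Fx wx \<epsilon>(1) unfolding F_def by (metis diff_gt_0_iff_gt less_iff_diff_less_0 order_le_less_trans zero_less_mult_pos)
      have xm: "dist x m < r"
      proof -
        have "\<beta> * ((x - m) \<bullet> (x - m)) < \<beta> * r\<^sup>2" using bx by (simp add: barrier_def)
        then have "(norm (x - m))\<^sup>2 < r\<^sup>2" using \<beta> by (simp add: dot_square_norm)
        then show ?thesis using r by (simp add: dist_norm power_less_imp_less_base)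
      qed
      have b1: "barrier \<beta> r m x \<le> 1"
      proof -
        have "exp (- \<beta> * ((x - m) \<bullet> (x - m))) \<le> 1" using \<beta> by simp
        then show ?thesis unfolding barrier_def by (smt (verit) exp_ge_zero)
      qed
      have xq: "dist q x < r / 2"
      proof (rule ccontr)
        assume "\<not> dist q x < r / 2"
        then have "x \<in> S" using x(1) xm by (auto simp: S_def T_def dist_commute)
        then have "\<eta> \<le> w x" using \<eta> by blast
        moreover have "\<epsilon> * barrier \<beta> r m x \<le> \<eta> * 1" using \<epsilon> b1 bx \<eta>(1) by (intro mult_mono) auto
        ultimately show False using Fx by (simp add: F_def)
      qed
      obtain e where e: "e > 0" "M \<inter> ball x e \<subseteq> H" using Hn x(1) xm unfolding T_def by blast
      define e' where "e' = min e (r / 2 - dist q x)"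
      have e': "e' > 0" using e xq by (simp add: e'_def)
      have sub: "ball x e' \<subseteq> cball q (r / 2)"
      proof
        fix y assume "y \<in> ball x e'"
        then show "y \<in> cball q (r / 2)" using dist_triangle[of q y x] by (simp add: e'_def)
      qed
      have xM: "x \<in> M" "x \<in> cball q (r / 2)" using x(1) by (auto simp: T_def)
      have xp: "x \<in> ball p \<delta>'" "x \<in> ball p \<delta>" using xM cb \<delta>' by auto
      have xb: "x \<notin> surface_boundary M" using xp bd by blast
      define c where "c = G x - \<epsilon> *\<^sub>R barrier_grad \<beta> m x"
      have F1: "(F has_derivative (\<lambda>h. (G y - \<epsilon> *\<^sub>R barrier_grad \<beta> m y) \<bullet> h)) (at y)" if "y \<in> ball x e'" for y
      proof -
        have "y \<in> ball p \<delta>'" using that sub cb by blast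
        then have "y \<in> ball p \<delta>" using \<delta>' by simp
        from has_derivative_diff[OF wD(3)[OF this] has_derivative_mult_right[OF barrier_has_derivative[of \<beta> r m y], of \<epsilon>]]
        show ?thesis unfolding F_def by (simp add: inner_diff_left)
      qed
      have F2: "((\<lambda>y. G y - \<epsilon> *\<^sub>R barrier_grad \<beta> m y) has_derivative (\<lambda>h. A x h - \<epsilon> *\<^sub>R barrier_hess \<beta> m x h)) (at x)"
        by (intro has_derivative_diff wD(4)[OF xp(2)] has_derivative_scaleR_right barrier_grad_has_derivative)
      have min: "F x \<le> F y" if "y \<in> M \<inter> ball x e'" for y
      proof (rule x(2))
        have "y \<in> M" "y \<in> ball x e" "y \<in> cball q (r / 2)" using that sub by (auto simp: e'_def)
        then show "y \<in> T" using e(2) by (auto simp: T_def)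
      qed
      have ge: "sms_op \<alpha> (\<lambda>h. A x h - \<epsilon> *\<^sub>R barrier_hess \<beta> m x h) (G x - \<epsilon> *\<^sub>R barrier_grad \<beta> m x) (x $ 3) \<ge> 0"
        using sms_op_nonneg_at_local_min(1)[OF xM(1) xb e' F1 F2 min] .
      have nd: "r / 2 \<le> norm (x - m)" "norm (x - m) \<le> 2 * r"
        using dist_triangle[of q m x] xq xm r qm by (auto simp: dist_norm norm_minus_commute)
      have small: "norm (\<epsilon> *\<^sub>R barrier_grad \<beta> m x) \<le> g / 16"
      proof -
        have "norm (\<epsilon> *\<^sub>R barrier_grad \<beta> m x) \<le> \<epsilon> * (4 * \<beta> * r)"
          using norm_barrier_grad_le[OF \<beta> nd(2)] \<epsilon>(1) by simp
        then show ?thesis using \<epsilon>(3) by linarith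
      qed
      have cG: "norm (c - G p) \<le> g / 8"
        using norm_triangle_ineq4[of "G x - G p" "\<epsilon> *\<^sub>R barrier_grad \<beta> m x"] near(1)[OF xp(1)] small
        by (simp add: c_def g_def algebra_simps)
      have cge: "7 / 8 * g \<le> norm c"
        using norm_triangle_ineq2[of "G p" c] cG by (simp add: g_def norm_minus_commute)
      have cle: "norm c \<le> K'"
      proof -
        have "norm c \<le> norm (G x) + norm (\<epsilon> *\<^sub>R barrier_grad \<beta> m x)" unfolding c_def by (rule norm_triangle_ineq4)
        then show ?thesis using wD(6)[OF xp(2)] small K' g by linarith
      qed
      \<comment> \<open>A quarter from the hypothesis and an eighth from the change of the gradient
        give \<open>3 / 8 * g\<close>, below half of the lower bound \<open>7 / 8 * g\<close> for
        \<open>norm c\<close>.\<close>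
      have ang: "\<bar>(x - m) \<bullet> c\<bar> \<le> norm (x - m) * norm c / 2"
      proof -
        have comb: "\<bar>s\<bar> \<le> n * (3 / 8 * g)" if "s = a + b" "\<bar>a\<bar> \<le> 1 / 4 * (n * g)" "\<bar>b\<bar> \<le> n * (g / 8)"
          for s a b n :: real
          using abs_triangle_ineq[of a b] that by (simp add: algebra_simps)
        have "\<bar>(x - m) \<bullet> (c - G p)\<bar> \<le> norm (x - m) * norm (c - G p)" by (rule Cauchy_Schwarz_ineq2)
        also have "\<dots> \<le> norm (x - m) * (g / 8)" using cG by (rule mult_left_mono) simp
        finally have 2: "\<bar>(x - m) \<bullet> (c - G p)\<bar> \<le> norm (x - m) * (g / 8)" .
        have 1: "\<bar>(x - m) \<bullet> G p\<bar> \<le> 1 / 4 * (norm (x - m) * g)"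
          unfolding g_def using flat xM by blast
        have "\<bar>(x - m) \<bullet> c\<bar> \<le> norm (x - m) * (3 / 8 * g)"
          by (rule comb[OF _ 1 2]) (simp add: inner_diff_right)
        also have "\<dots> \<le> norm (x - m) * (norm c / 2)" using cge g by (intro mult_left_mono) auto
        finally show ?thesis by simp
      qed
      have a: "\<bar>\<alpha>\<bar> / (x $ 3) \<le> K'"
      proof -
        have "\<bar>\<alpha>\<bar> / (x $ 3) \<le> \<bar>\<alpha>\<bar> / (p $ 3 / 2)"
          using near(2)[OF xp(1)] p3 by (intro divide_left_mono) (auto intro!: mult_pos_pos)
        also have "\<dots> = 2 * \<bar>\<alpha>\<bar> / (p $ 3)" by simp
        finally show ?thesis using wD(2) g unfolding K'_def by linarith
      qed
      have op: "sms_op \<alpha> (A x) (G x) (x $ 3) \<le> K' * (\<epsilon> * barrier \<beta> r m x)"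
      proof -
        have "sms_op \<alpha> (A x) (G x) (x $ 3) \<le> K * \<bar>w x\<bar>" using wD(7)[OF xp(2)] by linarith
        also have "\<dots> \<le> K' * (\<epsilon> * barrier \<beta> r m x)"
          using wx Fx K' wD(2) by (intro mult_mono) (auto simp: F_def)
        finally show ?thesis .
      qed
      have "sms_op \<alpha> (\<lambda>h. A x h - \<epsilon> *\<^sub>R barrier_hess \<beta> m x h) (G x - \<epsilon> *\<^sub>R barrier_grad \<beta> m x) (x $ 3) < 0"
      proof (rule strict[unfolded strict_barrier_def, rule_format], intro conjI allI)
        show "linear (A x)" using wD(4)[OF xp(2)] has_derivative_linear by blast
        show "norm (A x h) \<le> K' * norm h" for h
          using wD(5)[OF xp(2), of h] mult_right_mono[OF K'(2), of "norm h"] by simp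
        show "norm (G x) \<le> K'" using wD(6)[OF xp(2)] K' by linarith
        show "\<bar>\<alpha>\<bar> / (x $ 3) \<le> K'" "x $ 3 > 0" using a height_pos[OF xM(1)] by auto
        show "g / 2 \<le> norm (G x - \<epsilon> *\<^sub>R barrier_grad \<beta> m x)" using cge g by (simp add: c_def)
      qed (use \<epsilon>(1) nd cle ang op in \<open>auto simp: c_def\<close>)
      then show False using ge by linarith
    qed
    then show "\<exists>\<epsilon>>0. \<exists>\<beta>>0. \<forall>x\<in>M \<inter> H \<inter> cball q (r / 2). \<epsilon> * barrier \<beta> r m x \<le> w x"
      using \<epsilon>(1) \<beta> by (intro exI[of _ \<epsilon>] conjI exI[of _ \<beta>]) (auto simp: F_def T_def)
    qed
  qed
qed

text \<open>Hopf's argument on the surface. Take a ball that meets the zero set of \<open>w\<close>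
  at the single point \<open>q\<close> of its sphere. At \<open>q\<close> both \<open>w\<close> and
  \<open>w\<close> minus the barrier have a minimum on \<open>M\<close>, so both gradients are
  normal to \<open>M\<close>, and with them the radius at \<open>q\<close>. But this radius is half
  of a short chord of \<open>M\<close>, hence almost tangent.\<close>

lemma strong_maximum_principle:
  assumes p: "p \<in> M" and w: "comparison_function \<alpha> p \<delta> K w G A"
    and bd: "ball p \<delta> \<inter> surface_boundary M = {}" and Gp: "G p \<noteq> 0"
    and wp: "w p = 0" and w0: "\<And>x. x \<in> M \<inter> ball p \<delta> \<Longrightarrow> 0 \<le> w x"
  shows "\<exists>e>0. \<forall>x\<in>M \<inter> ball p e. w x = 0"
proof -
  note wD = comparison_functionD[OF w]
  obtain \<delta>' where \<delta>': "\<delta>' > 0" "\<delta>' \<le> \<delta>" and nearG: "\<forall>x\<in>ball p \<delta>'. norm (G x - G p) \<le> norm (G p) / 16"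
    and cmp: "\<forall>q m r H. barrier_admissible (ball p \<delta>') w (G p) H q m r
      \<longrightarrow> (\<exists>\<epsilon>>0. \<exists>\<beta>>0. \<forall>x\<in>M \<inter> H \<inter> cball q (r / 2). \<epsilon> * barrier \<beta> r m x \<le> w x)"
    by (rule barrier_comparison[OF p w bd Gp])
  have pb: "p \<notin> surface_boundary M" using bd wD(1) centre_in_ball by blast
  have par: "G x = (N x \<bullet> G x) *\<^sub>R N x" if x: "x \<in> M \<inter> ball p \<delta>" "w x = 0" for x
  proof -
    obtain e where e: "e > 0" "ball x e \<subseteq> ball p \<delta>" using x(1) open_contains_ball open_ball by (metis IntD2)
    show ?thesis
    proof (rule sms_op_nonneg_at_local_min(2))
      show "x \<in> M" "x \<notin> surface_boundary M" "e > 0" using x bd e by auto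
      show "(w has_derivative (\<lambda>h. G y \<bullet> h)) (at y)" if "y \<in> ball x e" for y using wD(3) that e by blast
      show "(G has_derivative A x) (at x)" using wD(4) x by blast
      show "w x \<le> w y" if "y \<in> M \<inter> ball x e" for y using w0 that e x by auto
    qed
  qed
  \<comment> \<open>With \<open>1 / 12\<close>, the chords \<open>x - q\<close> and
    \<open>m - q\<close> contribute \<open>r / 24\<close> and \<open>r / 12\<close> to the angle
    estimate; the sum \<open>r / 8\<close> is a quarter of \<open>r / 2\<close>, the least distance
    to the centre.\<close>
  obtain \<delta>c where \<delta>c: "\<delta>c > 0" "\<And>x y. \<lbrakk>x \<in> M; y \<in> M; dist x p < \<delta>c; dist y p < \<delta>c\<rbrakk> \<Longrightarrow>
      \<bar>(x - y) \<bullet> N p\<bar> \<le> 1 / 12 * norm (x - y)"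
    using chord_almost_tangent[OF p, of "1 / 12"] by auto
  have chord: "\<bar>(x - y) \<bullet> G p\<bar> \<le> 1 / 12 * norm (x - y) * norm (G p)"
    if "x \<in> M" "y \<in> M" "dist x p < \<delta>c" "dist y p < \<delta>c" for x y
  proof -
    define k where "k = N p \<bullet> G p"
    have k: "G p = k *\<^sub>R N p" using par[of p] p wp wD(1) by (simp add: k_def)
    then have nk: "norm (G p) = \<bar>k\<bar>" using N_norm[OF p] by simp
    have "\<bar>(x - y) \<bullet> G p\<bar> = \<bar>k\<bar> * \<bar>(x - y) \<bullet> N p\<bar>" by (subst k) (simp add: abs_mult)
    also have "\<dots> \<le> \<bar>k\<bar> * (1 / 12 * norm (x - y))" using \<delta>c(2)[OF that] by (intro mult_left_mono) auto
    finally show ?thesis by (simp add: nk mult_ac)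
  qed
  define \<rho> where "\<rho> = min \<delta>' \<delta>c"
  have \<rho>: "\<rho> > 0" "\<rho> \<le> \<delta>'" "\<rho> \<le> \<delta>c" using \<delta>' \<delta>c by (auto simp: \<rho>_def)
  have "w m = 0" if m: "m \<in> M \<inter> ball p (\<rho> / 8)" for m
  proof (rule ccontr)
    assume wm: "w m \<noteq> 0"
    define Z where "Z = {x \<in> M \<inter> cball p (\<rho> / 2). w x = 0}"
    have cont: "continuous_on (M \<inter> cball p (\<rho> / 2)) w"
    proof (rule continuous_at_imp_continuous_on, rule ballI)
      fix x assume "x \<in> M \<inter> cball p (\<rho> / 2)"
      then have "x \<in> ball p \<delta>" using \<rho> \<delta>' by auto
      then show "isCont w x" using wD(3) has_derivative_continuous by blast
    qed
    have "compact (M \<inter> cball p (\<rho> / 2))" by (intro compact_Int_closed compact_M closed_cball)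
    moreover have "closedin (top_of_set (M \<inter> cball p (\<rho> / 2))) Z"
      unfolding Z_def by (rule continuous_closedin_preimage_constant[OF cont])
    ultimately have "compact Z" using closedin_compact by blast
    have "p \<in> Z" using p wp \<rho> by (simp add: Z_def)
    then obtain q where q: "q \<in> Z" "\<And>y. y \<in> Z \<Longrightarrow> dist m q \<le> dist m y"
      using distance_attains_inf[of Z m] compact_imp_closed[OF \<open>compact Z\<close>] by blast
    have qM: "q \<in> M" "w q = 0" using q(1) by (auto simp: Z_def)
    define r where "r = dist m q / 2"
    have "m \<noteq> q" using wm qM by auto
    then have r: "r > 0" by (simp add: r_def)
    have r8: "2 * r < \<rho> / 8" using q(2)[OF \<open>p \<in> Z\<close>] m by (simp add: r_def dist_commute)
    \<comment> \<open>\<open>q\<close> is a zero nearest to \<open>m\<close>. The ball about the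
      midpoint lies in the ball about \<open>m\<close> through \<open>q\<close> and meets its sphere
      only at \<open>q\<close>, so it contains no second zero.\<close>
    define c where "c = midpoint m q"
    define v where "v = m - c"
    have v: "m = c + v" "q = c - v" by (simp_all add: v_def c_def midpoint_def algebra_simps scaleR_2[symmetric])
    have nv: "norm v = r"
    proof -
      have "m - q = 2 *\<^sub>R v" by (simp add: v scaleR_2)
      then show ?thesis by (simp add: r_def dist_norm)
    qed
    have pq: "dist p q < \<rho> / 4" using dist_triangle[of p q m] m r8 r_def by simp
    have inb: "dist x p < \<rho> / 2" if "x \<in> cball q (r / 2)" for x
      using dist_triangle[of p x q] that pq r8 r by (simp add: dist_commute)
    have "\<exists>\<epsilon>>0. \<exists>\<beta>>0. \<forall>x\<in>M \<inter> UNIV \<inter> cball q (r / 2). \<epsilon> * barrier \<beta> r c x \<le> w x"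
    proof (rule cmp[rule_format], unfold barrier_admissible_def, intro conjI ballI impI)
      show "r > 0" by (rule r)
      show "cball q (r / 2) \<subseteq> ball p \<delta>'" using inb \<rho> by (force simp: dist_commute)
      show "dist q c = r" using nv by (simp add: v dist_norm)
      show "\<bar>(x - c) \<bullet> G p\<bar> \<le> 1 / 4 * (norm (x - c) * norm (G p))" if x: "x \<in> M \<inter> cball q (r / 2)" for x
      proof -
        have xc: "x - c = (x - q) - (1 / 2) *\<^sub>R (m - q)" by (simp add: v scaleR_2[symmetric])
        have dx: "dist x p < \<delta>c" "dist q p < \<delta>c" "dist m p < \<delta>c"
          using inb[of x] x pq m \<rho> by (auto simp: dist_commute)
        have "\<bar>(x - c) \<bullet> G p\<bar> \<le> \<bar>(x - q) \<bullet> G p\<bar> + 1 / 2 * \<bar>(m - q) \<bullet> G p\<bar>"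
        proof -
          have "(x - c) \<bullet> G p = (x - q) \<bullet> G p - 1 / 2 * ((m - q) \<bullet> G p)"
            unfolding xc by (simp only: inner_diff_left[of "x - q"] inner_scaleR_left)
          then show ?thesis by linarith
        qed
        also have "\<dots> \<le> 1 / 12 * norm (x - q) * norm (G p) + 1 / 2 * (1 / 12 * norm (m - q) * norm (G p))"
          using chord[of x q] chord[of m q] x qM m dx by (intro add_mono) auto
        also have "\<dots> \<le> 1 / 12 * (r / 2) * norm (G p) + 1 / 2 * (1 / 12 * (2 * r) * norm (G p))"
          using x by (intro add_mono mult_left_mono mult_right_mono) (auto simp: r_def dist_norm norm_minus_commute)
        also have "\<dots> = 1 / 4 * ((r / 2) * norm (G p))" by simp
        also have "\<dots> \<le> 1 / 4 * (norm (x - c) * norm (G p))"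
        proof -
          have "r \<le> norm (x - c) + r / 2"
            using norm_triangle_ineq[of "x - c" "q - x"] x nv by (simp add: v dist_norm)
          then show ?thesis by (intro mult_left_mono mult_right_mono) auto
        qed
        finally show ?thesis .
      qed
      show "closed (UNIV :: (real^3) set)" by simp
      show "0 \<le> w x" if "x \<in> M \<inter> UNIV \<inter> cball q (r / 2)" for x
        using w0[of x] that inb[of x] \<rho> \<delta>' by (auto simp: dist_commute)
      show "0 < w x" if x: "x \<in> M \<inter> UNIV \<inter> cball q (r / 2)" "dist x c \<le> r \<and> x \<noteq> q" for x
      proof -
        have xp: "dist x p < \<rho> / 2" using inb x(1) by blast
        have "dist m x < 2 * r"
        proof (rule ccontr)
          assume "\<not> dist m x < 2 * r"
          define a where "a = x - c"
          have "2 * r \<le> norm (a - v)"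
            using \<open>\<not> dist m x < 2 * r\<close> by (simp add: a_def v dist_norm norm_minus_commute algebra_simps)
          then have "(2 * r)\<^sup>2 \<le> (norm (a - v))\<^sup>2"
            using r by (intro power_mono) auto
          moreover have "(norm (a - v))\<^sup>2 = (norm a)\<^sup>2 + r\<^sup>2 - 2 * (a \<bullet> v)"
            using dot_norm_neg[of a v] unfolding nv by simp
          moreover have "(norm (a + v))\<^sup>2 = (norm a)\<^sup>2 + r\<^sup>2 + 2 * (a \<bullet> v)"
            using dot_norm[of a v] unfolding nv by simp
          moreover have "(norm a)\<^sup>2 \<le> r\<^sup>2" using x(2) by (intro power_mono) (auto simp: a_def dist_norm)
          ultimately have "(norm (a + v))\<^sup>2 \<le> 0" by (simp add: power_mult_distrib)
          then have "a + v = 0" by simp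
          then have "x = c - v" by (simp add: a_def algebra_simps eq_diff_eq)
          then show False using x(2) v by simp
        qed
        then have "x \<notin> Z" using q(2)[of x] by (auto simp: r_def)
        then have "w x \<noteq> 0" using x(1) xp by (auto simp: Z_def dist_commute)
        then show ?thesis using w0[of x] x(1) xp \<rho> \<delta>' by (auto simp: dist_commute)
      qed
      show "\<exists>e>0. M \<inter> ball x e \<subseteq> UNIV" for x by (intro exI[of _ 1]) auto
    qed
    then obtain \<epsilon> \<beta> where \<epsilon>: "\<epsilon> > 0" "\<beta> > 0" "\<And>x. x \<in> M \<inter> cball q (r / 2) \<Longrightarrow> \<epsilon> * barrier \<beta> r c x \<le> w x"
      by auto
    have qd: "q \<in> ball p \<delta>" "q \<in> ball p \<delta>'" using pq \<rho> \<delta>' by auto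
    have Gq: "G q = (N q \<bullet> G q) *\<^sub>R N q" using par[of q] qM qd by simp
    have bq: "barrier \<beta> r c q = 0" using nv by (simp add: barrier_def v dot_square_norm)
    define c1 where "c1 = G q - \<epsilon> *\<^sub>R barrier_grad \<beta> c q"
    have "c1 = (N q \<bullet> c1) *\<^sub>R N q" unfolding c1_def
    proof (rule sms_op_nonneg_at_local_min(2)[where F="\<lambda>x. w x - \<epsilon> * barrier \<beta> r c x" and d="r / 2"
          and G="\<lambda>x. G x - \<epsilon> *\<^sub>R barrier_grad \<beta> c x" and A="\<lambda>h. A q h - \<epsilon> *\<^sub>R barrier_hess \<beta> c q h"])
      show "q \<in> M" "0 < r / 2" using qM r by auto
      show "q \<notin> surface_boundary M" using bd qd by blast
      show "((\<lambda>x. w x - \<epsilon> * barrier \<beta> r c x) has_derivative (\<lambda>h. (G x - \<epsilon> *\<^sub>R barrier_grad \<beta> c x) \<bullet> h)) (at x)"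
        if "x \<in> ball q (r / 2)" for x
      proof -
        have "x \<in> ball p \<delta>" using inb[of x] that \<rho> \<delta>' by (auto simp: dist_commute)
        from has_derivative_diff[OF wD(3)[OF this] has_derivative_mult_right[OF barrier_has_derivative[of \<beta> r c x], of \<epsilon>]]
        show ?thesis by (simp add: inner_diff_left)
      qed
      show "((\<lambda>x. G x - \<epsilon> *\<^sub>R barrier_grad \<beta> c x) has_derivative (\<lambda>h. A q h - \<epsilon> *\<^sub>R barrier_hess \<beta> c q h)) (at q)"
        by (intro has_derivative_diff wD(4)[OF qd(1)] has_derivative_scaleR_right barrier_grad_has_derivative)
      show "w q - \<epsilon> * barrier \<beta> r c q \<le> w x - \<epsilon> * barrier \<beta> r c x" if "x \<in> M \<inter> ball q (r / 2)" for x
        using \<epsilon>(3)[of x] that qM(2) bq by auto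
    qed
    define b where "b = 2 * \<beta> * exp (- \<beta> * ((q - c) \<bullet> (q - c)))"
    have b: "b > 0" using \<epsilon> by (simp add: b_def)
    have bg: "barrier_grad \<beta> c q = b *\<^sub>R v" by (simp add: barrier_grad_def b_def v)
    have "(\<epsilon> * b) *\<^sub>R v = G q - c1" by (simp add: c1_def bg)
    also have "\<dots> = (N q \<bullet> G q - N q \<bullet> c1) *\<^sub>R N q"
      using Gq \<open>c1 = (N q \<bullet> c1) *\<^sub>R N q\<close> by (metis scaleR_left_diff_distrib)
    finally have ev: "(\<epsilon> * b) *\<^sub>R v = (N q \<bullet> G q - N q \<bullet> c1) *\<^sub>R N q" .
    define l where "l = (N q \<bullet> G q - N q \<bullet> c1) / (\<epsilon> * b)"
    have vl: "v = l *\<^sub>R N q"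
    proof -
      have "v = (1 / (\<epsilon> * b)) *\<^sub>R ((\<epsilon> * b) *\<^sub>R v)" using \<epsilon> b by simp
      then show ?thesis unfolding ev by (simp add: l_def)
    qed
    have nq: "norm (N q) = 1" "N q \<bullet> N q = 1" using N_norm[OF qM(1)] by (auto simp: norm_eq_1)
    have big: "\<bar>v \<bullet> G q\<bar> = r * norm (G q)"
    proof -
      have "norm v = \<bar>l\<bar>" using vl nq by simp
      moreover have "v \<bullet> G q = l * (N q \<bullet> G q)" using vl by simp
      moreover have "norm (G q) = \<bar>N q \<bullet> G q\<bar>" using arg_cong[OF Gq, of norm] nq by simp
      ultimately show ?thesis using nv by (simp add: abs_mult)
    qed
    have small: "\<bar>v \<bullet> G p\<bar> \<le> 1 / 12 * r * norm (G p)"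
    proof -
      have "m - q = 2 *\<^sub>R v" by (simp add: v scaleR_2)
      then show ?thesis using chord[of m q] m qM pq \<rho> nv by (auto simp: dist_commute)
    qed
    have "\<bar>v \<bullet> (G q - G p)\<bar> \<le> r * norm (G q - G p)"
      using Cauchy_Schwarz_ineq2[of v "G q - G p"] nv by simp
    also have "\<dots> \<le> r * (norm (G p) / 16)"
      using bspec[OF nearG qd(2)] r by (intro mult_left_mono) auto
    finally have "\<bar>v \<bullet> (G q - G p)\<bar> \<le> r * (norm (G p) / 16)" .
    then have "r * norm (G q) \<le> 1 / 12 * r * norm (G p) + r * (norm (G p) / 16)"
      using big small inner_diff_right[of v "G q" "G p"] by linarith
    then have "norm (G q) \<le> norm (G p) / 12 + norm (G p) / 16" using r by (simp add: algebra_simps)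
    then have "norm (G q) \<le> norm (G p) / 2" using norm_ge_zero[of "G p"] by linarith
    moreover have "norm (G p) \<le> norm (G q) + norm (G q - G p)"
      by (metis norm_minus_commute norm_triangle_sub)
    moreover have "norm (G p) > 0" using Gp by simp
    ultimately show False using bspec[OF nearG qd(2)] by linarith
  qed
  then show ?thesis using \<rho>(1) by (intro exI[of _ "\<rho> / 8"]) auto
qed

end

section \<open>Barriers at the boundary circle\<close>

definition hor :: "real^3 \<Rightarrow> real^3" where
  "hor v = v - (v $ 3) *\<^sub>R axis 3 1"

lemma hor_nth [simp]: "hor v $ 1 = v $ 1" "hor v $ 2 = v $ 2" "hor v $ 3 = 0"
  by (simp_all add: hor_def axis_def)

lemma linear_hor: "linear hor"
  unfolding hor_def by (rule linearI) (auto simp: algebra_simps)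

lemma hor_inner: "hor v \<bullet> w = v $ 1 * w $ 1 + v $ 2 * w $ 2"
  by (simp add: inner_vec_def sum_3)

lemma real3_inner: "v \<bullet> w = v $ 1 * w $ 1 + v $ 2 * w $ 2 + v $ 3 * w $ 3" for v w :: "real^3"
  by (simp add: inner_vec_def sum_3)

lemma bounded_linear_hor: "bounded_linear hor"
  using linear_hor by (simp only: linear_conv_bounded_linear)

lemma ltrace_scaleR_hor: "ltrace (\<lambda>h. k *\<^sub>R hor h) = 2 * k"
proof -
  have "linear (\<lambda>h. k *\<^sub>R hor h)" by (rule linear_compose_scale_right[OF linear_hor])
  from ltrace_onb[OF this, of "axis 1 1" "axis 2 1" "axis 3 1"]
  show ?thesis by (simp add: real3_inner axis_def norm_eq_1)
qed

definition axis_dist2 :: "real^3 \<Rightarrow> real^3 \<Rightarrow> real" where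
  "axis_dist2 c x = hor (x - c) \<bullet> (x - c)"

lemma axis_dist2_has_derivative:
  "(axis_dist2 c has_derivative (\<lambda>h. (2 *\<^sub>R hor (x - c)) \<bullet> h)) (at x)"
proof -
  have "((\<lambda>x. x - c) has_derivative (\<lambda>h. h)) (at x)" by (auto intro!: derivative_eq_intros)
  from has_derivative_compose[OF this bounded_linear_imp_has_derivative[OF bounded_linear_hor]]
  have "((\<lambda>x. hor (x - c)) has_derivative (\<lambda>h. hor h)) (at x)" .
  moreover have "((\<lambda>x. x - c) has_derivative (\<lambda>h. h)) (at x)" by (auto intro!: derivative_eq_intros)
  ultimately have "(axis_dist2 c has_derivative (\<lambda>h. hor (x - c) \<bullet> h + hor h \<bullet> (x - c))) (at x)"
    unfolding axis_dist2_def by (rule has_derivative_inner)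
  moreover have "hor (x - c) \<bullet> h + hor h \<bullet> (x - c) = (2 *\<^sub>R hor (x - c)) \<bullet> h" for h
    by (simp add: hor_inner algebra_simps)
  ultimately show ?thesis by simp
qed

lemma hor_diff_has_derivative:
  "((\<lambda>x. k *\<^sub>R hor (x - c)) has_derivative (\<lambda>h. k *\<^sub>R hor h)) (at x)"
proof -
  have "((\<lambda>x. x - c) has_derivative (\<lambda>h. h)) (at x)" by (auto intro!: derivative_eq_intros)
  from has_derivative_compose[OF this bounded_linear_imp_has_derivative[OF bounded_linear_hor]]
  have "((\<lambda>x. hor (x - c)) has_derivative (\<lambda>h. hor h)) (at x)" .
  then show ?thesis by (rule has_derivative_scaleR_right)
qed

lemma has_real_derivative_scaleI:
  fixes D :: real
  assumes "(f has_derivative (\<lambda>s. s * D)) (at x)"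
  shows "(f has_real_derivative D) (at x)"
proof -
  have "(\<lambda>s. s * D) = (*) D" by (simp add: fun_eq_iff)
  then show ?thesis using assms by (simp add: has_field_derivative_def)
qed

lemma right_derivative_nonneg:
  fixes f :: "real \<Rightarrow> real"
  assumes "(f has_real_derivative D) (at 0)" "f 0 = 0" "d > 0" "\<And>t. 0 \<le> t \<Longrightarrow> t < d \<Longrightarrow> 0 \<le> f t"
  shows "0 \<le> D"
proof (rule ccontr)
  assume "\<not> 0 \<le> D"
  then obtain d' where d': "d' > 0" "\<And>h. \<lbrakk>h > 0; h < d'\<rbrakk> \<Longrightarrow> f (0 + h) < f 0"
    using DERIV_neg_dec_right[OF assms(1)] by force
  define h where "h = min d d' / 2"
  have h: "0 < h" "h < d" "h < d'" using assms(3) d'(1) by (auto simp: h_def)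
  then have "f h < 0" using d'(2)[of h] assms(2) by simp
  then show False using assms(4)[of h] h by simp
qed

section \<open>Position of the surface relative to its boundary circle\<close>

locale circle_sms = compact_sms +
  fixes c :: "real^3" and R :: real
  assumes alpha_nz: "\<alpha> \<noteq> 0" and R_pos: "R > 0"
    and boundary_iff: "p \<in> surface_boundary M \<longleftrightarrow> p $ 3 = c $ 3 \<and> axis_dist2 c p = R\<^sup>2"
begin

lemma chart_image:
  assumes "surface_chart M V X" "u \<in> V \<inter> half_plane" shows "X u \<in> M"
proof -
  have "openin (top_of_set M) (X ` (V \<inter> half_plane))" using assms(1) unfolding surface_chart_def by simp
  from openin_imp_subset[OF this] show ?thesis using assms(2) by (rule image_subset_iff[THEN iffD1, THEN bspec])
qed

lemma boundary_in_M: "p \<in> surface_boundary M \<Longrightarrow> p \<in> M"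
proof -
  assume "p \<in> surface_boundary M"
  then obtain V X u where ch: "surface_chart M V X" "u \<in> V" "u $ 2 = 0" "X u = p"
    unfolding surface_boundary_def by blast
  then have "u \<in> V \<inter> half_plane" by (simp add: half_plane_def)
  then show "p \<in> M" using chart_image[OF ch(1)] ch(4) by blast
qed

text \<open>Strict positivity of the operator excludes interior maxima, so the maximum over the
  compact surface is taken on the circle. The Hessian \<open>A\<close> is constant because only
  quadratic functions are tested.\<close>

lemma max_on_boundary:
  assumes F: "\<And>x. (F has_derivative (\<lambda>h. G x \<bullet> h)) (at x)"
    and G: "\<And>x. (G has_derivative A) (at x)"
    and pos: "\<And>p n. p \<in> M \<Longrightarrow> norm n = 1 \<Longrightarrow> ltrace A - A n \<bullet> n + \<alpha> * (G p $ 3) / (p $ 3) > 0"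
    and bd: "\<And>p. p \<in> surface_boundary M \<Longrightarrow> F p \<le> B"
  shows "p \<in> M \<Longrightarrow> F p \<le> B"
proof -
  have no: "\<not> (\<forall>x\<in>M. F x \<le> F p)" if p: "p \<in> M" "p \<notin> surface_boundary M" for p
  proof
    assume "\<forall>x\<in>M. F x \<le> F p"
    then have "ltrace A - A (N p) \<bullet> N p + \<alpha> * (G p $ 3) / (p $ 3) \<le> 0"
      by (intro local_max_on_surface(2)[OF p zero_less_one F G]) simp
    then show False using pos[OF p(1) N_norm[OF p(1)]] by linarith
  qed
  have "continuous_on M F"
    using has_derivative_continuous[OF F] by (intro continuous_at_imp_continuous_on) auto
  then have le: "F p \<le> B" if "p \<in> M" for p
  proof -
    obtain x where x: "x \<in> M" "\<forall>y\<in>M. F y \<le> F x"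
      using continuous_attains_sup[OF compact_M _ \<open>continuous_on M F\<close>] \<open>p \<in> M\<close> by blast
    then have "F x \<le> B" using no[of x] bd[of x] by blast
    moreover have "F p \<le> F x" using x(2) \<open>p \<in> M\<close> by blast
    ultimately show ?thesis by linarith
  qed
  then show "p \<in> M \<Longrightarrow> F p \<le> B" .
qed

text \<open>For the squared distance from the axis the trace is \<open>4\<close> and the normal
  direction removes at most \<open>2\<close>; the gradient is horizontal, so the curvature term
  drops out.\<close>

lemma in_cylinder: "p \<in> M \<Longrightarrow> axis_dist2 c p \<le> R\<^sup>2"
proof -
  have pos: "ltrace (\<lambda>h. 2 *\<^sub>R hor h) - (2 *\<^sub>R hor n) \<bullet> n + \<alpha> * ((2 *\<^sub>R hor (p - c)) $ 3) / (p $ 3) > 0"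
    if "norm n = 1" for n p
  proof -
    have "n \<bullet> n = 1" using that norm_eq_1 by blast
    moreover have "0 \<le> n $ 3 * n $ 3" by simp
    ultimately have "hor n \<bullet> n \<le> 1" unfolding hor_inner by (simp only: real3_inner)
    then show ?thesis by (simp add: ltrace_scaleR_hor)
  qed
  note m = max_on_boundary[OF axis_dist2_has_derivative hor_diff_has_derivative pos]
  show "p \<in> M \<Longrightarrow> axis_dist2 c p \<le> R\<^sup>2" by (rule m) (auto simp: boundary_iff)
qed

lemma max_height: obtains z where "z > 0" "\<forall>p\<in>M. p $ 3 \<le> z"
proof -
  obtain B where B: "\<And>p. p \<in> M \<Longrightarrow> norm p \<le> B"
    using compact_imp_bounded[OF compact_M] unfolding bounded_iff by blast
  have "p $ 3 \<le> \<bar>B\<bar> + 1" if "p \<in> M" for p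
    using B[OF that] component_le_norm_cart[of p 3] by linarith
  moreover have "\<bar>B\<bar> + 1 > 0" by simp
  ultimately show ?thesis using that by blast
qed

text \<open>Applied to \<open>sgn \<alpha> z - \<epsilon> \<rho>\<^sup>2\<close> with \<open>\<rho>\<close> the distance to the axis, the maximum principle bounds the angle
  between the surface and its boundary plane from below.\<close>

lemma collar:
  obtains \<epsilon> where "\<epsilon> > 0" "\<forall>p\<in>M. \<epsilon> * (R\<^sup>2 - axis_dist2 c p) \<le> sgn \<alpha> * (c $ 3 - p $ 3)"
proof -
  obtain z where z: "z > 0" "\<forall>p\<in>M. p $ 3 \<le> z" by (rule max_height)
  \<comment> \<open>On all of \<open>M\<close> the height term is at least
    \<open>\<bar>\<alpha>\<bar> / z = 8 * \<epsilon>\<close>, twice the amount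
    \<open>4 * \<epsilon>\<close> that the trace of the quadratic part takes away.\<close>
  define \<epsilon> where "\<epsilon> = \<bar>\<alpha>\<bar> / (8 * z)"
  have \<epsilon>: "\<epsilon> > 0" using alpha_nz z by (simp add: \<epsilon>_def)
  let ?F = "\<lambda>x. sgn \<alpha> * (x $ 3) - \<epsilon> * axis_dist2 c x"
  let ?G = "\<lambda>x. sgn \<alpha> *\<^sub>R axis 3 1 - (2 * \<epsilon>) *\<^sub>R hor (x - c)"
  have F: "(?F has_derivative (\<lambda>h. ?G x \<bullet> h)) (at x)" for x
  proof -
    have "((\<lambda>x::real^3. sgn \<alpha> * (x $ 3)) has_derivative (\<lambda>h. sgn \<alpha> * (h $ 3))) (at x)"
      by (intro has_derivative_mult_right bounded_linear_imp_has_derivative bounded_linear_vec_nth)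
    from has_derivative_diff[OF this has_derivative_mult_right[OF axis_dist2_has_derivative[of c x], of \<epsilon>]]
    show ?thesis by (simp add: inner_diff_left inner_axis' mult_ac)
  qed
  have G: "(?G has_derivative (\<lambda>h. (- 2 * \<epsilon>) *\<^sub>R hor h)) (at x)" for x
    using has_derivative_diff[OF has_derivative_const hor_diff_has_derivative[of "2 * \<epsilon>" c x], of "sgn \<alpha> *\<^sub>R axis 3 1"]
    by simp
  have pos: "ltrace (\<lambda>h. (- 2 * \<epsilon>) *\<^sub>R hor h) - ((- 2 * \<epsilon>) *\<^sub>R hor n) \<bullet> n + \<alpha> * (?G p $ 3) / (p $ 3) > 0"
    if "p \<in> M" for n p
  proof -
    have "\<alpha> * (?G p $ 3) / (p $ 3) = \<bar>\<alpha>\<bar> / (p $ 3)" by (simp add: abs_sgn axis_def)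
    also have "\<dots> \<ge> \<bar>\<alpha>\<bar> / z"
      using z that height_pos by (intro divide_left_mono) auto
    finally have "\<alpha> * (?G p $ 3) / (p $ 3) \<ge> 8 * \<epsilon>" using z(1) by (simp add: \<epsilon>_def)
    moreover have "ltrace (\<lambda>h. (- 2 * \<epsilon>) *\<^sub>R hor h) = 2 * (- 2 * \<epsilon>)" by (rule ltrace_scaleR_hor)
    moreover have "hor n \<bullet> n \<ge> 0" by (simp add: hor_inner)
    then have "((- 2 * \<epsilon>) *\<^sub>R hor n) \<bullet> n \<le> 0" using \<epsilon> by simp
    ultimately show ?thesis using \<epsilon> by linarith
  qed
  have "?F p \<le> sgn \<alpha> * (c $ 3) - \<epsilon> * R\<^sup>2" if "p \<in> M" for p
    by (rule max_on_boundary[OF F G pos _ that]) (auto simp: boundary_iff)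
  then have "\<epsilon> * (R\<^sup>2 - axis_dist2 c p) \<le> sgn \<alpha> * (c $ 3 - p $ 3)" if "p \<in> M" for p
    using that by (force simp: algebra_simps)
  then show ?thesis using that \<epsilon> by blast
qed

text \<open>At the height of the circle the collar estimate pushes a point out to radius
  \<open>R\<close>, and the cylinder lets it go no further.\<close>

lemma boundary_height:
  assumes "p \<in> M" "p $ 3 = c $ 3" shows "p \<in> surface_boundary M"
proof -
  obtain \<epsilon> where \<epsilon>: "\<epsilon> > 0" "\<forall>p\<in>M. \<epsilon> * (R\<^sup>2 - axis_dist2 c p) \<le> sgn \<alpha> * (c $ 3 - p $ 3)"
    by (rule collar)
  have "\<epsilon> * (R\<^sup>2 - axis_dist2 c p) \<le> 0" using bspec[OF \<epsilon>(2) assms(1)] assms(2) by simp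
  then have "R\<^sup>2 \<le> axis_dist2 c p" using \<epsilon>(1) by (simp add: mult_le_0_iff)
  then show ?thesis using in_cylinder[OF assms(1)] assms boundary_iff by auto
qed

text \<open>A horizontal tangent vector not along the circle would make the tangent plane at
  \<open>p\<close> horizontal. A curve entering the surface would then have no vertical velocity,
  the collar and the cylinder would leave it no radial velocity either, and the differential of the
  chart would not be injective.\<close>

lemma boundary_normal_horizontal:
  assumes p: "p \<in> surface_boundary M" and e: "e $ 3 = 0" "N p \<bullet> e = 0"
  shows "(p - c) \<bullet> e = 0"
proof (rule ccontr)
  assume ne: "(p - c) \<bullet> e \<noteq> 0"
  obtain V X u where ch: "surface_chart M V X" "u \<in> V" "u $ 2 = 0" "X u = p"
    using p unfolding surface_boundary_def by blast
  have V: "open V" "smooth_on X V" using ch unfolding surface_chart_def by auto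
  have uH: "u \<in> V \<inter> half_plane" using ch by (simp add: half_plane_def)
  define D where "D = frechet_derivative X (at u)"
  have Xd: "(X has_derivative D) (at u)" using smooth_on_has_derivative[OF V(2,1) ch(2)] by (simp add: D_def)
  have inj: "inj D" using ch(1) uH unfolding surface_chart_def D_def by blast
  interpret D: linear D using Xd has_derivative_linear by blast
  have pM: "p \<in> M" using boundary_in_M[OF p] .
  have ND: "N p \<bullet> D w = 0" for w
  proof -
    have "D w \<in> {w. N (X u) \<bullet> w = 0}" using chart_tangent_range[OF ch(1) uH] unfolding D_def by (metis rangeI)
    then show ?thesis using ch(4) by simp
  qed
  obtain d where d: "d > 0" "ball u d \<subseteq> V" using V(1) ch(2) open_contains_ball by blast
  have inV: "u + t *\<^sub>R a \<in> V" if "\<bar>t\<bar> < d" "norm a = 1" for t a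
    using d(2) that by (auto simp: dist_norm)
  have line: "((\<lambda>t. u + t *\<^sub>R a) has_derivative (\<lambda>s. s *\<^sub>R a)) (at 0)" for a
    by (auto intro!: derivative_eq_intros)
  have Xline: "((\<lambda>t. X (u + t *\<^sub>R a)) has_derivative (\<lambda>s. s *\<^sub>R D a)) (at 0)" for a
  proof -
    have "(X has_derivative D) (at (u + 0 *\<^sub>R a))" using Xd by simp
    from has_derivative_compose[OF line this] show ?thesis by (simp add: D.scaleR)
  qed
  have z': "((\<lambda>t. X (u + t *\<^sub>R a) $ 3) has_real_derivative (D a $ 3)) (at 0)" for a
    using has_derivative_compose[OF Xline bounded_linear_imp_has_derivative[OF bounded_linear_vec_nth], of a 3]
    by (intro has_real_derivative_scaleI) simp
  have r': "((\<lambda>t. axis_dist2 c (X (u + t *\<^sub>R a))) has_real_derivative (2 * (hor (p - c) \<bullet> D a))) (at 0)" for a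
  proof -
    have "(axis_dist2 c has_derivative (\<lambda>h. (2 *\<^sub>R hor (p - c)) \<bullet> h)) (at (X (u + 0 *\<^sub>R a)))"
      using axis_dist2_has_derivative[of c p] ch(4) by simp
    from has_derivative_compose[OF Xline this]
    show ?thesis by (intro has_real_derivative_scaleI) (simp add: mult_ac)
  qed
  let ?a1 = "axis 1 1 :: real^2" and ?a2 = "axis 2 1 :: real^2"
  have bdl: "X (u + t *\<^sub>R ?a1) \<in> surface_boundary M" if "\<bar>t\<bar> < d" for t
  proof -
    have "u + t *\<^sub>R ?a1 \<in> V" using inV[OF that, of ?a1] by simp
    moreover have "(u + t *\<^sub>R ?a1) $ 2 = 0" using ch(3) by (simp add: axis_def)
    ultimately show ?thesis unfolding surface_boundary_def using ch(1) by blast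
  qed
  have inM: "X (u + t *\<^sub>R ?a2) \<in> M" if "0 \<le> t" "t < d" for t
  proof -
    have "u + t *\<^sub>R ?a2 \<in> V" using inV[of t ?a2] that by simp
    moreover have "(u + t *\<^sub>R ?a2) $ 2 \<ge> 0" using ch(3) that by (simp add: axis_def)
    ultimately have "u + t *\<^sub>R ?a2 \<in> V \<inter> half_plane" by (simp add: half_plane_def)
    then show ?thesis by (rule chart_image[OF ch(1)])
  qed
  define v1 v2 where "v1 = D ?a1" and "v2 = D ?a2"
  have v13: "v1 $ 3 = 0"
  proof -
    have "((\<lambda>t. X (u + t *\<^sub>R ?a1) $ 3) has_real_derivative 0) (at 0)"
      by (rule has_field_derivative_transform_within[OF DERIV_const d(1)]) (use bdl boundary_iff in auto)
    then show ?thesis using z'[of ?a1] DERIV_unique unfolding v1_def by blast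
  qed
  have v1r: "hor (p - c) \<bullet> v1 = 0"
  proof -
    have "((\<lambda>t. axis_dist2 c (X (u + t *\<^sub>R ?a1))) has_real_derivative 0) (at 0)"
      by (rule has_field_derivative_transform_within[OF DERIV_const d(1)]) (use bdl boundary_iff in auto)
    then show ?thesis using r'[of ?a1] DERIV_unique unfolding v1_def by force
  qed
  have p0: "p $ 3 = c $ 3" "axis_dist2 c p = R\<^sup>2" using p boundary_iff by auto
  obtain \<epsilon> where \<epsilon>: "\<epsilon> > 0" "\<forall>p\<in>M. \<epsilon> * (R\<^sup>2 - axis_dist2 c p) \<le> sgn \<alpha> * (c $ 3 - p $ 3)"
    by (rule collar)
  \<comment> \<open>One-sided derivatives in the inward direction \<open>?a2\<close>: the parameter
    may only move into the half-plane.\<close>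
  have s1: "0 \<le> 0 - 2 * (hor (p - c) \<bullet> v2)"
    unfolding v2_def
  proof (rule right_derivative_nonneg[OF DERIV_diff[OF DERIV_const[of "R\<^sup>2"] r'] _ d(1)])
    show "R\<^sup>2 - axis_dist2 c (X (u + 0 *\<^sub>R ?a2)) = 0" using p0 ch(4) by simp
    show "0 \<le> R\<^sup>2 - axis_dist2 c (X (u + t *\<^sub>R ?a2))" if "0 \<le> t" "t < d" for t
      using in_cylinder[OF inM[OF that]] by simp
  qed
  have s2: "0 \<le> sgn \<alpha> * (0 - v2 $ 3) - \<epsilon> * (0 - 2 * (hor (p - c) \<bullet> v2))"
    unfolding v2_def
  proof (rule right_derivative_nonneg[OF DERIV_diff[OF DERIV_cmult[OF DERIV_diff[OF DERIV_const[of "c $ 3"] z']]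
            DERIV_cmult[OF DERIV_diff[OF DERIV_const[of "R\<^sup>2"] r']]] _ d(1)])
    show "sgn \<alpha> * (c $ 3 - X (u + 0 *\<^sub>R ?a2) $ 3) - \<epsilon> * (R\<^sup>2 - axis_dist2 c (X (u + 0 *\<^sub>R ?a2))) = 0"
      using p0 ch(4) by simp
    show "0 \<le> sgn \<alpha> * (c $ 3 - X (u + t *\<^sub>R ?a2) $ 3) - \<epsilon> * (R\<^sup>2 - axis_dist2 c (X (u + t *\<^sub>R ?a2)))"
      if "0 \<le> t" "t < d" for t using bspec[OF \<epsilon>(2) inM[OF that]] by simp
  qed
  define a b where "a = v1 $ 1" and "b = v1 $ 2"
  define x y where "x = p $ 1 - c $ 1" and "y = p $ 2 - c $ 2"
  have ker: "w = 0" if "D w = 0" for w using injD[OF inj, of w 0] that D.zero by simp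
  have a1: "?a1 \<noteq> 0" "?a2 - k *\<^sub>R ?a1 \<noteq> 0" for k
    by (simp_all add: vec_eq_iff axis_def forall_2)
  have ab: "a \<noteq> 0 \<or> b \<noteq> 0"
  proof (rule ccontr)
    assume "\<not> (a \<noteq> 0 \<or> b \<noteq> 0)"
    then have "v1 = 0" using v13 by (simp add: vec_eq_iff forall_3 a_def b_def)
    then show False using ker a1(1) unfolding v1_def by blast
  qed
  then have ab2: "a * a + b * b > 0" by (metis add_nonneg_pos add_pos_nonneg not_real_square_gt_zero zero_le_square)
  have o1: "x * a + y * b = 0" using v1r by (simp add: hor_inner a_def b_def x_def y_def)
  \<comment> \<open>\<open>(x, y)\<close> is orthogonal to \<open>(a, b)\<close>, so it is
    \<open>k\<close> times the quarter turn \<open>(- b, a)\<close>.\<close>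
  define k where "k = (y * a - x * b) / (a * a + b * b)"
  have xy: "x = - k * b" "y = k * a"
  proof -
    have "x * (a * a + b * b) = - (y * a - x * b) * b" using o1 by algebra
    then have "x = (- (y * a - x * b) * b) / (a * a + b * b)"
      using ab2 by (subst nonzero_eq_divide_eq) auto
    also have "\<dots> = - k * b" by (simp only: k_def minus_divide_left times_divide_eq_left)
    finally show "x = - k * b" .
    have "y * (a * a + b * b) = (y * a - x * b) * a" using o1 by algebra
    then have "y = ((y * a - x * b) * a) / (a * a + b * b)"
      using ab2 by (subst nonzero_eq_divide_eq) auto
    then show "y = k * a" by (simp add: k_def)
  qed
  have det: "k * (a * e $ 2 - b * e $ 1) \<noteq> 0"
    using ne e(1) by (simp add: real3_inner xy algebra_simps flip: x_def y_def)
  have n12: "N p $ 1 = 0" "N p $ 2 = 0"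
  proof -
    have 1: "N p $ 1 * a + N p $ 2 * b = 0"
      using ND[of ?a1] v13 by (simp add: real3_inner a_def b_def v1_def)
    have 2: "N p $ 1 * e $ 1 + N p $ 2 * e $ 2 = 0" using e by (simp add: real3_inner)
    have "N p $ 1 * (a * e $ 2 - b * e $ 1) = 0" using 1 2 by algebra
    then show "N p $ 1 = 0" using det by simp
    have "N p $ 2 * (a * e $ 2 - b * e $ 1) = 0" using 1 2 by algebra
    then show "N p $ 2 = 0" using det by simp
  qed
  have "N p \<bullet> N p = 1" using N_norm[OF pM] norm_eq_1 by blast
  then have "N p $ 3 \<noteq> 0" using n12 by (auto simp: real3_inner)
  then have v23: "v2 $ 3 = 0" using ND[of ?a2] n12 by (simp add: real3_inner v2_def)
  then have "hor (p - c) \<bullet> v2 = 0" using s1 s2 \<epsilon>(1) by (simp add: zero_le_mult_iff)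
  then have "k * (a * v2 $ 2 - b * v2 $ 1) = 0" by (simp add: hor_inner xy algebra_simps flip: x_def y_def)
  then have o2: "a * v2 $ 2 = b * v2 $ 1" using det by auto
  define l where "l = (a * v2 $ 1 + b * v2 $ 2) / (a * a + b * b)"
  have "v2 = l *\<^sub>R v1"
  proof -
    have "v2 $ 1 * (a * a + b * b) = (a * v2 $ 1 + b * v2 $ 2) * a" using o2 by algebra
    moreover have "v2 $ 2 * (a * a + b * b) = (a * v2 $ 1 + b * v2 $ 2) * b" using o2 by algebra
    moreover have "x = s / (a * a + b * b) * y" if "x * (a * a + b * b) = s * y" for x y s
    proof -
      have "x = (s * y) / (a * a + b * b)" using ab2 that by (subst nonzero_eq_divide_eq) auto
      then show ?thesis by simp
    qed
    ultimately have "v2 $ 1 = l * a" "v2 $ 2 = l * b" unfolding l_def by blast+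
    then show ?thesis using v23 v13 by (simp add: vec_eq_iff forall_3 a_def b_def)
  qed
  then have "D (?a2 - l *\<^sub>R ?a1) = 0" by (simp add: D.diff D.scaleR v1_def v2_def)
  then show False using ker a1(2) by blast
qed

text \<open>The tangency points, included as degenerate pairs, are what makes this set closed.\<close>

definition chords :: "real^3 \<Rightarrow> ((real^3) \<times> (real^3)) set" where
  "chords e = {(p, q). p \<in> M \<and> q \<in> M \<and> (\<exists>l\<ge>0. p = q + l *\<^sub>R e \<and> (l = 0 \<longrightarrow> N p \<bullet> e = 0))}"

text \<open>The critical limit is one of chords whose length tends to zero. Short chords near
  \<open>p\<close> are almost tangent and all have direction \<open>e\<close>, so \<open>e\<close>
  is tangent at the limit; degenerate pairs pass to the limit by continuity of
  \<open>N\<close>.\<close>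

lemma compact_chords:
  assumes e: "norm e = 1"
  shows "compact (chords e)"
proof -
  have ee: "e \<bullet> e = 1" using e norm_eq_1 by blast
  have "closed (chords e)"
    unfolding closed_sequential_limits
  proof (intro allI impI, elim conjE)
    fix x l assume x: "\<forall>n. x n \<in> chords e" and lim: "x \<longlonglongrightarrow> l"
    obtain p q where l: "l = (p, q)" by (cases l)
    define pn qn where "pn = (\<lambda>n. fst (x n))" and "qn = (\<lambda>n. snd (x n))"
    have pn: "pn \<longlonglongrightarrow> p" and qn: "qn \<longlonglongrightarrow> q"
      using tendsto_fst[OF lim] tendsto_snd[OF lim] l by (auto simp: pn_def qn_def)
    have M: "pn n \<in> M" "qn n \<in> M" for n using x by (auto simp: chords_def pn_def qn_def split_beta)
    have "\<exists>l\<ge>0. pn n = qn n + l *\<^sub>R e \<and> (l = 0 \<longrightarrow> N (pn n) \<bullet> e = 0)" for n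
      using x by (auto simp: chords_def pn_def qn_def split_beta)
    then obtain t where t: "\<And>n. t n \<ge> 0" "\<And>n. pn n = qn n + t n *\<^sub>R e" "\<And>n. t n = 0 \<Longrightarrow> N (pn n) \<bullet> e = 0"
      by metis
    have pq: "p \<in> M" "q \<in> M"
      using M pn qn compact_imp_closed[OF compact_M] closed_sequentially by blast+
    have tn: "t n = (pn n - qn n) \<bullet> e" for n using t(2)[of n] ee by simp
    define t0 where "t0 = (p - q) \<bullet> e"
    have tlim: "t \<longlonglongrightarrow> t0"
      unfolding tn t0_def by (intro tendsto_intros pn qn)
    then have t0: "t0 \<ge> 0" using t(1) by (intro LIMSEQ_le_const) auto
    have "(\<lambda>n. qn n + t n *\<^sub>R e) \<longlonglongrightarrow> q + t0 *\<^sub>R e" by (intro tendsto_intros qn tlim)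
    then have pe: "p = q + t0 *\<^sub>R e" using pn LIMSEQ_unique unfolding t(2)[symmetric] by blast
    have "N p \<bullet> e = 0" if "t0 = 0"
    proof (rule ccontr)
      assume ne: "N p \<bullet> e \<noteq> 0"
      define \<eta> where "\<eta> = \<bar>N p \<bullet> e\<bar>"
      have \<eta>: "\<eta> > 0" using ne by (simp add: \<eta>_def)
      obtain \<delta> where \<delta>: "\<delta> > 0" "\<And>x y. \<lbrakk>x \<in> M; y \<in> M; dist x p < \<delta>; dist y p < \<delta>\<rbrakk> \<Longrightarrow>
          \<bar>(x - y) \<bullet> N p\<bar> \<le> \<eta> / 2 * norm (x - y)"
        using chord_almost_tangent[OF pq(1), of "\<eta> / 2"] \<eta> by auto
      have "q = p" using pe that by simp
      then have ev: "\<forall>\<^sub>F n in sequentially. dist (pn n) p < \<delta> \<and> dist (qn n) p < \<delta>"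
        using tendstoD[OF pn \<delta>(1)] tendstoD[OF qn \<delta>(1)] eventually_conj by blast
      have "(\<lambda>n. N (pn n)) \<longlonglongrightarrow> N p"
        using N_continuous pq(1) M(1) pn unfolding continuous_on_sequentially o_def by blast
      then have "(\<lambda>n. N (pn n) \<bullet> e) \<longlonglongrightarrow> N p \<bullet> e" by (intro tendsto_intros)
      then have ev2: "\<forall>\<^sub>F n in sequentially. dist (N (pn n) \<bullet> e) (N p \<bullet> e) < \<eta>" using tendstoD \<eta> by blast
      have "\<exists>n. (dist (pn n) p < \<delta> \<and> dist (qn n) p < \<delta>) \<and> dist (N (pn n) \<bullet> e) (N p \<bullet> e) < \<eta>"
        by (rule eventually_happens'[OF trivial_limit_sequentially eventually_conj[OF ev ev2]])
      then obtain n where n: "dist (pn n) p < \<delta>" "dist (qn n) p < \<delta>" "dist (N (pn n) \<bullet> e) (N p \<bullet> e) < \<eta>"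
        by blast
      show False
      proof (cases "t n = 0")
        case True
        then show ?thesis using t(3)[OF True] n(3) by (simp add: \<eta>_def dist_real_def)
      next
        case False
        then have tp: "t n > 0" using t(1)[of n] by simp
        have pq': "pn n - qn n = t n *\<^sub>R e" using t(2)[of n] by simp
        have "\<bar>(pn n - qn n) \<bullet> N p\<bar> \<le> \<eta> / 2 * norm (pn n - qn n)" using \<delta>(2) M n by blast
        then have "t n * \<eta> \<le> \<eta> / 2 * t n"
          unfolding pq' using e tp by (simp add: abs_mult \<eta>_def inner_commute)
        then show ?thesis using tp \<eta> by simp
      qed
    qed
    then show "l \<in> chords e" unfolding chords_def using l pq t0 pe by auto
  qed
  moreover have "chords e \<subseteq> M \<times> M" by (auto simp: chords_def)
  ultimately show ?thesis using compact_Times[OF compact_M compact_M] compact_Int_closed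
    by (metis inf.absorb_iff2)
qed

end

section \<open>The Alexandrov reflection argument\<close>

definition rfl :: "real^3 \<Rightarrow> real^3 \<Rightarrow> real^3" where
  "rfl e h = h - (2 * (h \<bullet> e)) *\<^sub>R e"

lemma linear_rfl: "linear (rfl e)"
  unfolding rfl_def by (rule linearI) (auto simp: inner_add_left algebra_simps)

lemma rfl_inner_commute: "rfl e v \<bullet> w = v \<bullet> rfl e w"
  by (simp add: rfl_def inner_diff_left inner_diff_right inner_commute)

lemma rfl_rfl: "norm e = 1 \<Longrightarrow> rfl e (rfl e v) = v"
  by (simp add: rfl_def inner_diff_left norm_eq_1 algebra_simps)

lemma rfl_inner_rfl: "norm e = 1 \<Longrightarrow> rfl e v \<bullet> rfl e w = v \<bullet> w"
  by (simp add: rfl_inner_commute rfl_rfl)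

lemma norm_rfl: "norm e = 1 \<Longrightarrow> norm (rfl e v) = norm v"
  by (simp add: norm_eq_sqrt_inner rfl_inner_rfl)

lemma rfl_nth3: "e $ 3 = 0 \<Longrightarrow> rfl e v $ 3 = v $ 3"
  by (simp add: rfl_def)

text \<open>The operator is built from the Euclidean metric and the height, and a reflection with
  horizontal normal preserves both.\<close>

lemma sms_op_rfl:
  assumes e: "norm e = 1" "e $ 3 = 0" and A: "linear A"
  shows "sms_op \<alpha> (\<lambda>h. rfl e (A (rfl e h))) (rfl e b) z = sms_op \<alpha> A b z"
proof -
  have lin: "linear (\<lambda>h. rfl e (A (rfl e h)))"
    using linear_compose[OF linear_compose[OF linear_rfl[of e] A] linear_rfl[of e]] by (simp add: o_def)
  let ?a = "axis 1 1 :: real^3" and ?b = "axis 2 1 :: real^3" and ?c = "axis 3 1 :: real^3"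
  have onb: "norm ?a = 1" "norm ?b = 1" "norm ?c = 1" "?a \<bullet> ?b = 0" "?a \<bullet> ?c = 0" "?b \<bullet> ?c = 0"
    by (simp_all add: inner_axis_axis)
  have "ltrace (\<lambda>h. rfl e (A (rfl e h))) = ltrace A"
    using ltrace_onb[OF lin onb] ltrace_onb[OF A, of "rfl e ?a" "rfl e ?b" "rfl e ?c"] onb e
    by (simp add: norm_rfl rfl_inner_rfl rfl_inner_commute rfl_rfl)
  then show ?thesis
    using e by (simp add: sms_op_def rfl_inner_rfl rfl_rfl rfl_nth3)
qed

lemma comparison_function_mono:
  assumes "comparison_function \<alpha> p \<delta> K w G A" "0 < \<delta>'" "\<delta>' \<le> \<delta>"
  shows "comparison_function \<alpha> p \<delta>' K w G A"
  using assms unfolding comparison_function_def by auto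

lemma comparison_function_scale:
  assumes w: "comparison_function \<alpha> p \<delta> K w G A" and k: "k = 1 \<or> k = -1"
  shows "comparison_function \<alpha> p \<delta> K (\<lambda>x. k * w x) (\<lambda>x. k *\<^sub>R G x) (\<lambda>x h. k *\<^sub>R A x h)"
  using k
proof
  assume "k = 1" then show ?thesis using w by simp
next
  assume k: "k = -1"
  note wD = comparison_functionD[OF w]
  show ?thesis
    unfolding comparison_function_def k
  proof (intro conjI ballI allI)
    show "0 < \<delta>" "0 < K" using wD by auto
    fix x assume x: "x \<in> ball p \<delta>"
    show "((\<lambda>x. - 1 * w x) has_derivative (\<lambda>h. (- 1 *\<^sub>R G x) \<bullet> h)) (at x)"
      using has_derivative_minus[OF wD(3)[OF x]] by simp
    show "((\<lambda>x. - 1 *\<^sub>R G x) has_derivative (\<lambda>h. - 1 *\<^sub>R A x h)) (at x)"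
      using has_derivative_minus[OF wD(4)[OF x]] by simp
    show "norm (- 1 *\<^sub>R A x h) \<le> K * norm h" for h using wD(5)[OF x] by simp
    show "norm (- 1 *\<^sub>R G x) \<le> K" using wD(6)[OF x] by simp
    show "\<bar>sms_op \<alpha> (\<lambda>h. - 1 *\<^sub>R A x h) (- 1 *\<^sub>R G x) (x $ 3)\<bar> \<le> K * \<bar>- 1 * w x\<bar>"
      using wD(7)[OF x] sms_op_minus[OF has_derivative_linear[OF wD(4)[OF x]]] by simp
  qed
qed

context circle_sms
begin

definition pos :: "real^3 \<Rightarrow> real^3 \<Rightarrow> real" where
  "pos e x = (x - c) \<bullet> e"

text \<open>The mirror image in the plane where \<open>pos e\<close> equals \<open>T\<close>;
  \<open>rfl e\<close> is its linear part.\<close>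

definition refl :: "real^3 \<Rightarrow> real \<Rightarrow> real^3 \<Rightarrow> real^3" where
  "refl e T x = x + (2 * (T - pos e x)) *\<^sub>R e"

lemma pos_add: "norm e = 1 \<Longrightarrow> pos e (x + t *\<^sub>R e) = pos e x + t"
  by (simp add: pos_def inner_diff_left inner_add_left norm_eq_1)

lemma pos_refl: "norm e = 1 \<Longrightarrow> pos e (refl e T x) = 2 * T - pos e x"
  by (simp add: refl_def pos_add)

lemma refl_refl: "norm e = 1 \<Longrightarrow> refl e T (refl e T x) = x"
  by (simp add: refl_def[of e T "refl e T x"] pos_refl) (simp add: refl_def algebra_simps)

lemma refl_diff: "refl e T x - refl e T y = rfl e (x - y)"
  by (simp add: refl_def rfl_def pos_def inner_diff_left algebra_simps)

lemma dist_refl: "norm e = 1 \<Longrightarrow> dist (refl e T x) (refl e T y) = dist x y"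
  by (simp add: dist_norm refl_diff norm_rfl)

lemma refl_nth3: "e $ 3 = 0 \<Longrightarrow> refl e T x $ 3 = x $ 3"
  by (simp add: refl_def)

lemma pos_has_derivative: "(pos e has_derivative (\<lambda>h. e \<bullet> h)) (at x)"
  unfolding pos_def by (auto intro!: derivative_eq_intros simp: inner_commute)

lemma refl_has_derivative: "(refl e T has_derivative rfl e) (at x)"
proof -
  have "(refl e T has_derivative (\<lambda>h. h + (2 * (0 - e \<bullet> h)) *\<^sub>R e)) (at x)"
    unfolding refl_def by (auto intro!: derivative_eq_intros pos_has_derivative)
  moreover have "(\<lambda>h. h + (2 * (0 - e \<bullet> h)) *\<^sub>R e) = rfl e"
    by (simp add: fun_eq_iff rfl_def inner_commute)
  ultimately show ?thesis by simp
qed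

lemma abs_pos_diff_le: "norm e = 1 \<Longrightarrow> \<bar>pos e x - pos e y\<bar> \<le> dist x y"
  using Cauchy_Schwarz_ineq2[of "x - y" e] by (simp add: pos_def dist_norm inner_diff_left)

lemma comparison_function_refl:
  assumes w: "comparison_function \<alpha> p \<delta> K w G A" and e: "norm e = 1" "e $ 3 = 0"
  shows "comparison_function \<alpha> (refl e T p) \<delta> K (\<lambda>x. w (refl e T x)) (\<lambda>x. rfl e (G (refl e T x)))
    (\<lambda>x h. rfl e (A (refl e T x) (rfl e h)))"
  unfolding comparison_function_def
proof (intro conjI ballI allI)
  note wD = comparison_functionD[OF w]
  show "0 < \<delta>" "0 < K" using wD by auto
  fix x assume "x \<in> ball (refl e T p) \<delta>"
  then have x: "refl e T x \<in> ball p \<delta>" using dist_refl[OF e(1), of T "refl e T p" x] refl_refl[OF e(1)] by simp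
  show "((\<lambda>x. w (refl e T x)) has_derivative (\<lambda>h. rfl e (G (refl e T x)) \<bullet> h)) (at x)"
    using has_derivative_compose[OF refl_has_derivative wD(3)[OF x]] by (simp add: rfl_inner_commute)
  have bl: "bounded_linear (rfl e)" using linear_rfl by (simp only: linear_conv_bounded_linear)
  show "((\<lambda>x. rfl e (G (refl e T x))) has_derivative (\<lambda>h. rfl e (A (refl e T x) (rfl e h)))) (at x)"
    using has_derivative_compose[OF has_derivative_compose[OF refl_has_derivative wD(4)[OF x]]
        bounded_linear_imp_has_derivative[OF bl]] .
  show "norm (rfl e (A (refl e T x) (rfl e h))) \<le> K * norm h" for h
    using wD(5)[OF x, of "rfl e h"] e by (simp add: norm_rfl)
  show "norm (rfl e (G (refl e T x))) \<le> K" using wD(6)[OF x] e by (simp add: norm_rfl)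
  show "\<bar>sms_op \<alpha> (\<lambda>h. rfl e (A (refl e T x) (rfl e h))) (rfl e (G (refl e T x))) (x $ 3)\<bar> \<le> K * \<bar>w (refl e T x)\<bar>"
    using wD(7)[OF x] sms_op_rfl[OF e has_derivative_linear[OF wD(4)[OF x]]] e by (simp add: refl_nth3)
qed

lemma defining_comparison_function:
  assumes p: "p \<in> M" "p \<notin> surface_boundary M" and nu: "\<nu> \<bullet> N p \<noteq> 0" "norm \<nu> = 1"
  obtains \<phi> G A \<delta> K where "comparison_function \<alpha> p \<delta> K \<phi> G A"
    "\<forall>x\<in>ball p \<delta>. x \<in> M \<longleftrightarrow> \<phi> x = 0"
    "\<forall>x\<in>ball p \<delta>. \<forall>t. x + t *\<^sub>R \<nu> \<in> ball p \<delta> \<longrightarrow> \<phi> (x + t *\<^sub>R \<nu>) = \<phi> x + t \<and> G (x + t *\<^sub>R \<nu>) = G x"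
    "\<forall>x\<in>ball p \<delta>. G x \<bullet> \<nu> = 1"
    "\<forall>x\<in>ball p \<delta> \<inter> M. G x = (N x \<bullet> G x) *\<^sub>R N x"
    "ball p \<delta> \<inter> surface_boundary M = {}"
proof -
  obtain \<phi> G A \<delta> K where a: "\<delta> > 0" "K > 0"
    "\<forall>x\<in>ball p \<delta>. (\<phi> has_derivative (\<lambda>h. G x \<bullet> h)) (at x)"
    "\<forall>x\<in>ball p \<delta>. (G has_derivative A x) (at x)"
    "\<forall>x\<in>ball p \<delta>. x \<in> M \<longleftrightarrow> \<phi> x = 0"
    "\<forall>x\<in>ball p \<delta>. \<forall>t. x + t *\<^sub>R \<nu> \<in> ball p \<delta> \<longrightarrow> \<phi> (x + t *\<^sub>R \<nu>) = \<phi> x + t \<and> G (x + t *\<^sub>R \<nu>) = G x"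
    "\<forall>x\<in>ball p \<delta>. \<forall>h. norm (A x h) \<le> K * norm h"
    "\<forall>x\<in>ball p \<delta>. \<bar>sms_op \<alpha> (A x) (G x) (x $ 3)\<bar> \<le> K * \<bar>\<phi> x\<bar>"
    "\<forall>x\<in>ball p \<delta>. G x \<bullet> \<nu> = 1"
    "\<forall>x\<in>ball p \<delta> \<inter> M. G x = (N x \<bullet> G x) *\<^sub>R N x"
    "\<forall>x\<in>ball p \<delta>. norm (G x) \<le> K"
    "ball p \<delta> \<inter> surface_boundary M = {}"
    by (rule local_defining_function[OF p(1) closed_boundary p(2) nu])
  have "comparison_function \<alpha> p \<delta> K \<phi> G A"
    unfolding comparison_function_def using a by blast
  then show ?thesis using that a by blast
qed

lemma curve_in_surface:
  assumes p: "p \<in> M" "p \<notin> surface_boundary M" and v: "N p \<bullet> v = 0"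
  obtains \<gamma> d where "d > 0" "\<gamma> 0 = p" "(\<gamma> has_derivative (\<lambda>s. s *\<^sub>R v)) (at 0)"
    "\<forall>t::real. \<bar>t\<bar> < d \<longrightarrow> \<gamma> t \<in> M"
proof -
  obtain V :: "(real^2) set" and X u Y where V: "open V" "smooth_on X V" and u: "u \<in> V" and Xu: "X u = p"
    and inj0: "\<forall>v\<in>V. inj (frechet_derivative X (at v))"
    and op: "openin (top_of_set M) (X ` V)" and hom: "homeomorphism V (X ` V) X Y"
    and rng0: "\<forall>v\<in>V. range (frechet_derivative X (at v)) = {w. N (X v) \<bullet> w = 0}"
    by (rule interior_chart[OF p])
  have img: "X ` V \<subseteq> M" using openin_imp_subset[OF op] .
  have "v \<in> range (frechet_derivative X (at u))" using bspec[OF rng0 u] v Xu by simp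
  then obtain a where a: "frechet_derivative X (at u) a = v" by blast
  have Xd: "(X has_derivative frechet_derivative X (at u)) (at (u + 0 *\<^sub>R a))"
    using smooth_on_has_derivative[OF V(2,1) u] by simp
  have line: "((\<lambda>t. u + t *\<^sub>R a) has_derivative (\<lambda>s. s *\<^sub>R a)) (at 0)"
    by (auto intro!: derivative_eq_intros)
  obtain d where d: "d > 0" "ball u d \<subseteq> V" using V(1) u open_contains_ball by blast
  show ?thesis
  proof (rule that[of "d / (1 + norm a)" "\<lambda>t. X (u + t *\<^sub>R a)"])
    show "d / (1 + norm a) > 0" using d by (simp add: add_pos_nonneg)
    show "X (u + 0 *\<^sub>R a) = p" using Xu by simp
    have "((\<lambda>t. X (u + t *\<^sub>R a)) has_derivative (\<lambda>s. frechet_derivative X (at u) (s *\<^sub>R a))) (at 0)"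
      using has_derivative_compose[OF line Xd] .
    then show "((\<lambda>t. X (u + t *\<^sub>R a)) has_derivative (\<lambda>s. s *\<^sub>R v)) (at 0)"
      using linear_scale[OF has_derivative_linear[OF Xd]] a by simp
    show "\<forall>t. \<bar>t\<bar> < d / (1 + norm a) \<longrightarrow> X (u + t *\<^sub>R a) \<in> M"
    proof (intro allI impI)
      fix t assume t: "\<bar>t\<bar> < d / (1 + norm a)"
      have "\<bar>t\<bar> * norm a \<le> \<bar>t\<bar> * (1 + norm a)" by (intro mult_left_mono) auto
      also have "\<dots> < d" using t by (simp add: pos_less_divide_eq add_pos_nonneg)
      finally have "u + t *\<^sub>R a \<in> ball u d" by (simp add: dist_norm)
      then show "X (u + t *\<^sub>R a) \<in> M" using d img by blast
    qed
  qed
qed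

text \<open>A horizontal chord with one end on the circle lies at the height of the circle, so its
  other end is on the circle too. But a chord of the circle in direction \<open>e\<close> has its
  midpoint on the diameter orthogonal to \<open>e\<close>, where the two positions cancel.\<close>

lemma chord_off_boundary:
  assumes e: "norm e = 1" "e $ 3 = 0" and pq: "p \<in> M" "q \<in> M" "p = q + l *\<^sub>R e" "l > 0"
    and ne: "pos e p + pos e q \<noteq> 0"
  shows "p \<notin> surface_boundary M" "q \<notin> surface_boundary M"
proof -
  have h: "p $ 3 = q $ 3" using pq e by simp
  have iff: "p \<in> surface_boundary M \<longleftrightarrow> q \<in> surface_boundary M"
    using boundary_height pq h boundary_iff by metis
  have "\<not> (p \<in> surface_boundary M \<and> q \<in> surface_boundary M)"
  proof
    assume b: "p \<in> surface_boundary M \<and> q \<in> surface_boundary M"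
    have ee: "e $ 1 * e $ 1 + e $ 2 * e $ 2 = 1" using e by (simp add: norm_eq_1 real3_inner)
    have "axis_dist2 c p = axis_dist2 c q" using b boundary_iff by simp
    then have "(q $ 1 + l * e $ 1 - c $ 1)\<^sup>2 + (q $ 2 + l * e $ 2 - c $ 2)\<^sup>2 = (q $ 1 - c $ 1)\<^sup>2 + (q $ 2 - c $ 2)\<^sup>2"
      by (simp add: axis_dist2_def hor_inner pq(3) power2_eq_square)
    then have "l * (2 * ((q $ 1 - c $ 1) * e $ 1 + (q $ 2 - c $ 2) * e $ 2) + l) = 0"
      using ee by algebra
    then have "2 * ((q $ 1 - c $ 1) * e $ 1 + (q $ 2 - c $ 2) * e $ 2) + l = 0" using pq(4) by simp
    moreover have "pos e q = (q $ 1 - c $ 1) * e $ 1 + (q $ 2 - c $ 2) * e $ 2"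
      using e by (simp add: pos_def real3_inner)
    moreover have "pos e p = pos e q + l" using pos_add[OF e(1)] pq(3) by simp
    ultimately show False using ne by simp
  qed
  then show "p \<notin> surface_boundary M" "q \<notin> surface_boundary M" using iff by auto
qed

text \<open>First contact at two distinct points: by the strong maximum principle the points of the
  surface whose mirror image lies on the surface form a set that is open in \<open>M\<close> away from the
  mirror plane, so a slightly tilted height function has an interior minimum on it.\<close>

lemma no_contact_of_distinct_points:
  assumes e: "norm e = 1" "e $ 3 = 0" and T: "T > 0"
    and pairs: "\<forall>p\<in>M. \<forall>q\<in>M. \<forall>l>0. p = q + l *\<^sub>R e \<longrightarrow> pos e p + pos e q \<le> 2 * T"
    and tangents: "\<forall>p\<in>M. N p \<bullet> e = 0 \<longrightarrow> pos e p \<le> T"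
    and pq: "p \<in> M" "q \<in> M" "p = q + l *\<^sub>R e" "l > 0" "pos e p + pos e q = 2 * T"
  shows False
proof -
  have P1: "pos e p + pos e q \<le> 2 * T" if "p \<in> M" "q \<in> M" "p = q + l *\<^sub>R e" "l > 0" for p q l
    using pairs that by blast
  have P2: "pos e p \<le> T" if "p \<in> M" "N p \<bullet> e = 0" for p using tangents that by blast
  define E where "E = {q \<in> M. pos e q \<le> T \<and> refl e T q \<in> M}"
  have contpos: "continuous_on S (pos e)" for S
    using has_derivative_continuous[OF pos_has_derivative] by (intro continuous_at_imp_continuous_on) auto
  have contrefl: "continuous_on S (refl e T)" for S
    using has_derivative_continuous[OF refl_has_derivative] by (intro continuous_at_imp_continuous_on) auto
  have clM: "closed M" using compact_imp_closed[OF compact_M] .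
  have "closed ({q. pos e q \<le> T} \<inter> refl e T -` M)"
    by (intro closed_Int closed_Collect_le contpos continuous_on_const continuous_closed_vimage clM)
       (use contrefl[of UNIV] in \<open>auto simp: continuous_on_eq_continuous_at\<close>)
  moreover have "E = M \<inter> ({q. pos e q \<le> T} \<inter> refl e T -` M)" by (auto simp: E_def)
  ultimately have cE: "compact E" using compact_Int_closed[OF compact_M] by metis
  have sq: "pos e q < T" using pq pos_add[OF e(1), of q l] by simp
  have "refl e T q = p"
  proof -
    have "l = 2 * (T - pos e q)" using pq pos_add[OF e(1), of q l] by simp
    then show ?thesis by (simp add: refl_def pq(3))
  qed
  then have qE: "q \<in> E" using pq sq by (simp add: E_def)
  obtain z where z: "z > 0" "\<forall>p\<in>M. p $ 3 \<le> z" by (rule max_height)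
  \<comment> \<open>Heights on \<open>M\<close> differ by at most \<open>z\<close>, so the tilt
    changes the position of the maximizer by less than the margin \<open>T - pos e q\<close>: it
    stays strictly on the near side of the mirror plane, where \<open>E\<close> has no edge.\<close>
  define \<epsilon> where "\<epsilon> = (T - pos e q) / (2 * z)"
  have \<epsilon>: "\<epsilon> > 0" "\<epsilon> * z < T - pos e q" using sq z by (auto simp: \<epsilon>_def)
  define F where "F = (\<lambda>x. \<epsilon> * sgn \<alpha> * (x $ 3) - pos e x)"
  have "continuous_on E F" unfolding F_def by (intro continuous_intros contpos)
  then obtain q0 where q0: "q0 \<in> E" "\<And>y. y \<in> E \<Longrightarrow> F y \<le> F q0"
    using continuous_attains_sup[OF cE] qE by blast
  have q0M: "q0 \<in> M" "refl e T q0 \<in> M" using q0 by (auto simp: E_def)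
  have sq0: "pos e q0 < T"
  proof -
    have "q0 $ 3 \<le> z" "q $ 3 \<le> z" "0 < q0 $ 3" "0 < q $ 3" using z q0M(1) pq(2) height_pos by auto
    then have "\<bar>q0 $ 3 - q $ 3\<bar> \<le> z" by linarith
    then have "\<bar>sgn \<alpha> * (q0 $ 3 - q $ 3)\<bar> \<le> z" using alpha_nz by (simp add: abs_mult abs_sgn_eq)
    then have "\<epsilon> * (sgn \<alpha> * (q0 $ 3 - q $ 3)) \<le> \<epsilon> * z" using \<epsilon>(1) by (intro mult_left_mono) auto
    moreover have "pos e q0 \<le> pos e q + \<epsilon> * (sgn \<alpha> * (q0 $ 3 - q $ 3))"
      using q0(2)[OF qE] by (simp add: F_def algebra_simps)
    ultimately show ?thesis using \<epsilon>(2) by linarith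
  qed
  define p0 where "p0 = refl e T q0"
  have p0: "p0 \<in> M" "p0 = q0 + (2 * (T - pos e q0)) *\<^sub>R e" "2 * (T - pos e q0) > 0"
    using q0M sq0 by (auto simp: p0_def refl_def)
  have sp0: "pos e p0 = 2 * T - pos e q0" using pos_refl[OF e(1)] by (simp add: p0_def)
  have off: "p0 \<notin> surface_boundary M" "q0 \<notin> surface_boundary M"
    using chord_off_boundary[OF e p0(1) q0M(1) p0(2,3)] sp0 T by auto
  \<comment> \<open>Beyond the mirror plane \<open>e\<close> is never tangent, so \<open>M\<close>
    is a graph in the direction \<open>e\<close> near \<open>p0\<close>.\<close>
  have "N p0 \<bullet> e \<noteq> 0" using P2[OF p0(1)] sp0 sq0 by force
  then have tr: "e \<bullet> N p0 \<noteq> 0" by (simp add: inner_commute)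
  obtain \<phi> G A \<delta> K where cf: "comparison_function \<alpha> p0 \<delta> K \<phi> G A"
    and zero: "\<forall>x\<in>ball p0 \<delta>. x \<in> M \<longleftrightarrow> \<phi> x = 0"
    and shift: "\<forall>x\<in>ball p0 \<delta>. \<forall>t. x + t *\<^sub>R e \<in> ball p0 \<delta> \<longrightarrow> \<phi> (x + t *\<^sub>R e) = \<phi> x + t \<and> G (x + t *\<^sub>R e) = G x"
    and Ge: "\<forall>x\<in>ball p0 \<delta>. G x \<bullet> e = 1"
    and par: "\<forall>x\<in>ball p0 \<delta> \<inter> M. G x = (N x \<bullet> G x) *\<^sub>R N x"
    and dis: "ball p0 \<delta> \<inter> surface_boundary M = {}"
    by (rule defining_comparison_function[OF p0(1) off(1) tr e(1)])
  note cD = comparison_functionD[OF cf]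
  have p0b: "p0 \<in> ball p0 \<delta>" using cD(1) by simp
  have \<phi>0: "\<phi> p0 = 0" using zero p0b p0(1) by blast
  have "isCont \<phi> p0" using cD(3)[OF p0b] has_derivative_continuous by blast
  then have "\<forall>\<^sub>F x in at p0. dist (\<phi> x) (\<phi> p0) < \<delta> / 2"
    using cD(1) tendstoD[of \<phi> "\<phi> p0" "at p0" "\<delta> / 2"] by (simp add: continuous_at)
  then obtain d1 where d1: "d1 > 0" "\<And>x. x \<noteq> p0 \<Longrightarrow> dist x p0 < d1 \<Longrightarrow> \<bar>\<phi> x\<bar> < \<delta> / 2"
    unfolding eventually_at using \<phi>0 by (auto simp: dist_real_def)
  have d1': "\<bar>\<phi> x\<bar> < \<delta> / 2" if "dist x p0 < d1" for x
    using d1(2)[of x] that \<phi>0 cD(1) by (cases "x = p0") auto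
  have "open (- surface_boundary M)" using closed_boundary by (simp add: open_Compl)
  then obtain d2 where d2: "d2 > 0" "ball q0 d2 \<subseteq> - surface_boundary M"
    using off(2) open_contains_ball by (metis ComplI)
  define \<delta>2 where "\<delta>2 = Min {\<delta> / 2, d1, d2, T - pos e q0}"
  have \<delta>2: "\<delta>2 > 0" "\<delta>2 \<le> \<delta> / 2" "\<delta>2 \<le> d1" "\<delta>2 \<le> d2" "\<delta>2 \<le> T - pos e q0"
  proof -
    show "\<delta>2 > 0" using cD(1) d1(1) d2(1) sq0 by (simp add: \<delta>2_def)
    show "\<delta>2 \<le> \<delta> / 2" "\<delta>2 \<le> d1" "\<delta>2 \<le> d2" "\<delta>2 \<le> T - pos e q0"
      unfolding \<delta>2_def by (rule Min_le; simp)+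
  qed
  have rp0: "refl e T p0 = q0" using refl_refl[OF e(1)] by (simp add: p0_def)
  have cf2: "comparison_function \<alpha> q0 \<delta>2 K (\<lambda>x. \<phi> (refl e T x)) (\<lambda>x. rfl e (G (refl e T x)))
      (\<lambda>x h. rfl e (A (refl e T x) (rfl e h)))"
    by (rule comparison_function_mono[OF comparison_function_refl[OF cf e, of T, unfolded rp0]]) (use \<delta>2 cD(1) in auto)
  have side: "pos e x < T" if "x \<in> ball q0 \<delta>2" for x
  proof -
    have "pos e x - pos e q0 \<le> dist x q0" using abs_pos_diff_le[OF e(1), of x q0] by linarith
    then show ?thesis using that \<delta>2 by (simp add: dist_commute)
  qed
  have near: "dist (refl e T x) p0 < \<delta>2" if "x \<in> ball q0 \<delta>2" for x
    using dist_refl[OF e(1), of T x q0] that by (simp add: p0_def dist_commute)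
  \<comment> \<open>A negative value would put a point of \<open>M\<close> farther out than the
    mirror image of \<open>x\<close> on the same line, and this pair would have its midpoint beyond
    \<open>T\<close>.\<close>
  have nonneg: "0 \<le> \<phi> (refl e T x)" if x: "x \<in> M \<inter> ball q0 \<delta>2" for x
  proof (rule ccontr)
    assume neg: "\<not> 0 \<le> \<phi> (refl e T x)"
    define y where "y = refl e T x"
    have y: "dist y p0 < \<delta>2" using near x by (simp add: y_def)
    define t where "t = - \<phi> y"
    have t: "0 < t" "\<bar>t\<bar> < \<delta> / 2" using neg d1'[of y] y \<delta>2 by (auto simp: t_def y_def)
    have yb: "y \<in> ball p0 \<delta>" using y \<delta>2 cD(1) by (simp add: dist_commute)
    have "dist p0 (y + t *\<^sub>R e) \<le> dist p0 y + \<bar>t\<bar>"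
      using dist_triangle[of p0 "y + t *\<^sub>R e" y] e by (simp add: dist_norm)
    then have yt: "y + t *\<^sub>R e \<in> ball p0 \<delta>" using y t \<delta>2 by (simp add: dist_commute)
    have "\<phi> (y + t *\<^sub>R e) = 0" using shift[rule_format, OF yb yt] by (simp add: t_def)
    then have M: "y + t *\<^sub>R e \<in> M" using zero yt by blast
    have eq: "y + t *\<^sub>R e = x + (2 * (T - pos e x) + t) *\<^sub>R e" by (simp add: y_def refl_def algebra_simps)
    have "pos e (y + t *\<^sub>R e) + pos e x \<le> 2 * T"
      using P1[OF M _ eq] x side[of x] t by auto
    moreover have "pos e (y + t *\<^sub>R e) = 2 * T - pos e x + t" by (simp add: pos_add[OF e(1)] y_def pos_refl[OF e(1)])
    ultimately show False using t by simp
  qed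
  have "\<exists>r>0. \<forall>x\<in>M \<inter> ball q0 r. \<phi> (refl e T x) = 0"
  proof (rule strong_maximum_principle[OF q0M(1) cf2])
    have "ball q0 \<delta>2 \<subseteq> ball q0 d2" using \<delta>2(4) by (rule subset_ball)
    then show "ball q0 \<delta>2 \<inter> surface_boundary M = {}" using d2(2) by blast
    have "G p0 \<bullet> e = 1" using Ge p0b by blast
    then have "G p0 \<noteq> 0" by auto
    then have "norm (rfl e (G p0)) \<noteq> 0" using e by (simp add: norm_rfl)
    then show "rfl e (G (refl e T q0)) \<noteq> 0" by (auto simp: p0_def)
    show "\<phi> (refl e T q0) = 0" using \<phi>0 by (simp add: p0_def)
    show "0 \<le> \<phi> (refl e T x)" if "x \<in> M \<inter> ball q0 \<delta>2" for x using nonneg that .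
  qed
  then obtain r where r: "r > 0" "\<forall>x\<in>M \<inter> ball q0 r. \<phi> (refl e T x) = 0" by blast
  define d where "d = min r \<delta>2"
  have d: "d > 0" using r \<delta>2 by (simp add: d_def)
  \<comment> \<open>The sheets coincide near \<open>q0\<close>, so a neighbourhood of
    \<open>q0\<close> in \<open>M\<close> belongs to \<open>E\<close> and the maximum over
    \<open>E\<close> is a local one on \<open>M\<close>. There the operator of \<open>F\<close>
    equals \<open>\<epsilon> * \<bar>\<alpha>\<bar> / (q0 $ 3)\<close>, which is positive.\<close>
  have max: "F x \<le> F q0" if "x \<in> M \<inter> ball q0 d" for x
  proof (rule q0(2))
    have x: "x \<in> M" "x \<in> ball q0 r" "x \<in> ball q0 \<delta>2" using that by (auto simp: d_def)
    have "refl e T x \<in> ball p0 \<delta>" using near[OF x(3)] \<delta>2 cD(1) by (simp add: dist_commute)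
    moreover have "\<phi> (refl e T x) = 0" using r x by blast
    ultimately have "refl e T x \<in> M" using zero by blast
    then show "x \<in> E" using x side[OF x(3)] by (simp add: E_def)
  qed
  have Fd: "(F has_derivative (\<lambda>h. ((\<epsilon> * sgn \<alpha>) *\<^sub>R axis 3 1 - e) \<bullet> h)) (at x)" for x
  proof -
    have "((\<lambda>x::real^3. \<epsilon> * sgn \<alpha> * (x $ 3)) has_derivative (\<lambda>h. \<epsilon> * sgn \<alpha> * (h $ 3))) (at x)"
      by (intro has_derivative_mult_right bounded_linear_imp_has_derivative bounded_linear_vec_nth)
    from has_derivative_diff[OF this pos_has_derivative]
    show ?thesis unfolding F_def by (simp add: inner_diff_left inner_axis')
  qed
  have Gd: "((\<lambda>x::real^3. (\<epsilon> * sgn \<alpha>) *\<^sub>R axis 3 1 - e) has_derivative (\<lambda>h. 0)) (at q0)"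
    by (rule has_derivative_const)
  have "ltrace (\<lambda>h. 0) - 0 \<bullet> N q0 + \<alpha> * (((\<epsilon> * sgn \<alpha>) *\<^sub>R axis 3 1 - e) $ 3) / (q0 $ 3) \<le> 0"
    by (rule local_max_on_surface(2)[OF q0M(1) off(2) d Fd Gd max])
  then have "\<alpha> * (\<epsilon> * sgn \<alpha>) / (q0 $ 3) \<le> 0" using e by (simp add: ltrace_def axis_def)
  moreover have "\<alpha> * (\<epsilon> * sgn \<alpha>) = \<epsilon> * \<bar>\<alpha>\<bar>" by (simp add: abs_sgn)
  moreover have "\<epsilon> * \<bar>\<alpha>\<bar> / (q0 $ 3) > 0" using \<epsilon>(1) alpha_nz height_pos[OF q0M(1)] by simp
  ultimately show False by simp
qed

text \<open>First contact at a point where \<open>e\<close> is tangent: the Hopf boundary point argument.\<close>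

lemma no_tangential_contact:
  assumes e: "norm e = 1" "e $ 3 = 0" and T: "T > 0"
    and pairs: "\<forall>p\<in>M. \<forall>q\<in>M. \<forall>l>0. p = q + l *\<^sub>R e \<longrightarrow> pos e p + pos e q \<le> 2 * T"
    and tangents: "\<forall>p\<in>M. N p \<bullet> e = 0 \<longrightarrow> pos e p \<le> T"
    and p: "p \<in> M" "N p \<bullet> e = 0" "pos e p = T"
  shows False
proof -
  have P2: "pos e p \<le> T" if "p \<in> M" "N p \<bullet> e = 0" for p using tangents that by blast
  have P1': "pos e x + pos e y < 2 * T" if "x \<in> M" "y \<in> M" "x = y + l *\<^sub>R e" "l > 0" for x y l
  proof -
    have "pos e x + pos e y \<le> 2 * T" using pairs that by blast
    moreover have "pos e x + pos e y \<noteq> 2 * T"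
      using no_contact_of_distinct_points[OF e T pairs tangents that] by blast
    ultimately show ?thesis by linarith
  qed
  have pb: "p \<notin> surface_boundary M"
    using boundary_normal_horizontal[of p e] e p T by (auto simp: pos_def)
  have ee: "e \<bullet> e = 1" using e norm_eq_1 by blast
  \<comment> \<open>The graph direction is now orthogonal to \<open>e\<close>: shifts along
    \<open>\<nu>\<close> preserve \<open>pos e\<close> and never cross the mirror plane.\<close>
  define \<nu> where "\<nu> = N p"
  have \<nu>: "norm \<nu> = 1" "\<nu> \<bullet> N p \<noteq> 0" "\<nu> \<bullet> e = 0" "\<nu> \<bullet> \<nu> = 1"
    using N_norm[OF p(1)] p(2) by (auto simp: \<nu>_def norm_eq_1)
  have pos\<nu>: "pos e (x + t *\<^sub>R \<nu>) = pos e x" for x t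
    using \<nu>(3) by (simp add: pos_def inner_diff_left inner_add_left)
  obtain \<phi>0 G0 A0 \<delta> K where cf: "comparison_function \<alpha> p \<delta> K \<phi>0 G0 A0"
    and zero: "\<forall>x\<in>ball p \<delta>. x \<in> M \<longleftrightarrow> \<phi>0 x = 0"
    and shift: "\<forall>x\<in>ball p \<delta>. \<forall>t. x + t *\<^sub>R \<nu> \<in> ball p \<delta> \<longrightarrow> \<phi>0 (x + t *\<^sub>R \<nu>) = \<phi>0 x + t \<and> G0 (x + t *\<^sub>R \<nu>) = G0 x"
    and G\<nu>: "\<forall>x\<in>ball p \<delta>. G0 x \<bullet> \<nu> = 1"
    and par: "\<forall>x\<in>ball p \<delta> \<inter> M. G0 x = (N x \<bullet> G0 x) *\<^sub>R N x"
    and dis: "ball p \<delta> \<inter> surface_boundary M = {}"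
    by (rule defining_comparison_function[OF p(1) pb \<nu>(2,1)])
  note cD = comparison_functionD[OF cf]
  have pball: "p \<in> ball p \<delta>" using cD(1) by simp
  have \<phi>p: "\<phi>0 p = 0" using zero pball p(1) by blast
  have Gp: "G0 p = \<nu>"
  proof -
    have "G0 p = (N p \<bullet> G0 p) *\<^sub>R N p" using par pball p(1) by blast
    moreover have "N p \<bullet> G0 p = 1" using G\<nu> pball by (simp add: \<nu>_def inner_commute)
    ultimately show ?thesis by (simp add: \<nu>_def)
  qed
  have "isCont \<phi>0 p" using cD(3)[OF pball] has_derivative_continuous by blast
  then have "\<forall>\<^sub>F x in at p. dist (\<phi>0 x) (\<phi>0 p) < \<delta> / 2"
    using cD(1) tendstoD[of \<phi>0 "\<phi>0 p" "at p" "\<delta> / 2"] by (simp add: continuous_at)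
  then obtain d1 where d1: "d1 > 0" "\<And>x. x \<noteq> p \<Longrightarrow> dist x p < d1 \<Longrightarrow> \<bar>\<phi>0 x\<bar> < \<delta> / 2"
    unfolding eventually_at using \<phi>p by (auto simp: dist_real_def)
  have d1': "\<bar>\<phi>0 x\<bar> < \<delta> / 2" if "dist x p < d1" for x
    using d1(2)[of x] that \<phi>p cD(1) by (cases "x = p") auto
  define \<delta>1 where "\<delta>1 = min (\<delta> / 2) d1"
  have \<delta>1: "\<delta>1 > 0" "\<delta>1 \<le> \<delta> / 2" "\<delta>1 \<le> d1" using cD(1) d1(1) by (auto simp: \<delta>1_def)
  have sub1: "x \<in> ball p \<delta>" if "x \<in> ball p \<delta>1" for x using that \<delta>1 cD(1) by auto
  define U where "U = ball p \<delta>1 \<inter> {x. pos e x > T}"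
  \<comment> \<open>Shift \<open>x\<close> along \<open>\<nu>\<close> onto \<open>M\<close>. The
    result is still beyond the mirror plane, where \<open>e\<close> is transversal to
    \<open>M\<close>.\<close>
  have Une: "G0 x \<bullet> e \<noteq> 0" if x: "x \<in> U" for x
  proof
    assume Ge: "G0 x \<bullet> e = 0"
    define y where "y = x + (- \<phi>0 x) *\<^sub>R \<nu>"
    have xb: "x \<in> ball p \<delta>" "dist x p < \<delta>1" using x sub1[of x] by (auto simp: U_def dist_commute)
    have "dist p y \<le> dist p x + \<bar>\<phi>0 x\<bar>"
      using dist_triangle[of p y x] \<nu>(1) by (simp add: y_def dist_norm)
    then have yb: "y \<in> ball p \<delta>" using xb d1'[of x] \<delta>1 by (simp add: dist_commute)
    have sy: "\<phi>0 y = 0" "G0 y = G0 x" using shift[rule_format, OF xb(1) yb[unfolded y_def]] by (simp_all add: y_def)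
    then have yM: "y \<in> M" using zero yb by blast
    have "N y \<bullet> e \<noteq> 0" using P2[OF yM] x pos\<nu>[of x "- \<phi>0 x"] by (force simp: U_def y_def)
    moreover have Gy: "G0 y = (N y \<bullet> G0 y) *\<^sub>R N y" using par yb yM by blast
    moreover have "N y \<bullet> G0 y \<noteq> 0"
    proof
      assume "N y \<bullet> G0 y = 0"
      then have "G0 y = 0" using Gy by simp
      moreover have "G0 y \<bullet> \<nu> = 1" using G\<nu> yb by blast
      ultimately show False by simp
    qed
    ultimately have "G0 y \<bullet> e \<noteq> 0" by (metis inner_scaleR_left mult_eq_0_iff)
    then show False using Ge sy by simp
  qed
  have convU: "convex U"
  proof -
    have "{x. pos e x > T} = {x. e \<bullet> x > T + c \<bullet> e}" by (auto simp: pos_def inner_diff_left inner_commute[of e])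
    then show ?thesis unfolding U_def using convex_halfspace_gt by (metis convex_Int convex_ball)
  qed
  have contG: "continuous_on U (\<lambda>x. G0 x \<bullet> e)"
  proof (intro continuous_intros continuous_at_imp_continuous_on ballI)
    fix x assume "x \<in> U"
    then have "x \<in> ball p \<delta>" using sub1[of x] by (simp add: U_def)
    then show "isCont G0 x" using cD(4) has_derivative_continuous by blast
  qed
  have "(\<forall>x\<in>U. G0 x \<bullet> e > 0) \<or> (\<forall>x\<in>U. G0 x \<bullet> e < 0)"
  proof (rule ccontr)
    assume "\<not> ?thesis"
    then obtain x y where xy: "x \<in> U" "y \<in> U" "G0 x \<bullet> e < 0" "G0 y \<bullet> e > 0"
      using Une by (metis linorder_neqE_linordered_idom)
    have "connected ((\<lambda>x. G0 x \<bullet> e) ` U)" using connected_continuous_image[OF contG convex_connected[OF convU]] .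
    then have "0 \<in> (\<lambda>x. G0 x \<bullet> e) ` U"
      using xy connectedD_interval[of "(\<lambda>x. G0 x \<bullet> e) ` U" "G0 x \<bullet> e" "G0 y \<bullet> e" 0] by auto
    then show False using Une by auto
  qed
  \<comment> \<open>\<open>U\<close> is convex, so the nonvanishing slope of \<open>\<phi>0\<close>
    in direction \<open>e\<close> has a constant sign \<open>k\<close> on it.\<close>
  then obtain k :: real where k: "k = 1 \<or> k = -1" and kpos: "\<forall>x\<in>U. k * (G0 x \<bullet> e) > 0"
    by (metis mult_1 mult_minus1 neg_0_less_iff_less)
  define w where "w = (\<lambda>x. - k * \<phi>0 (refl e T x))"
  have rp: "refl e T p = p" using p(3) by (simp add: refl_def)
  have cfw: "comparison_function \<alpha> p \<delta> K w (\<lambda>x. - k *\<^sub>R rfl e (G0 (refl e T x)))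
      (\<lambda>x h. - k *\<^sub>R rfl e (A0 (refl e T x) (rfl e h)))"
    unfolding w_def
    by (rule comparison_function_scale[OF comparison_function_refl[OF cf e, of T, unfolded rp]]) (use k in auto)
  have Gwp: "- k *\<^sub>R rfl e (G0 (refl e T p)) = - k *\<^sub>R \<nu>"
    using \<nu>(3) by (simp add: rp Gp rfl_def)
  \<comment> \<open>On the segment from \<open>x\<close> to its mirror image,
    \<open>k * \<phi>0\<close> starts at \<open>0\<close> and decreases as far as the mirror plane.
    Were it nonnegative at the end, it would have a zero on the far half: a point of
    \<open>M\<close> whose midpoint with \<open>x\<close> is at or beyond \<open>T\<close>, against
    \<open>P1'\<close>.\<close>
  have wpos: "0 < w x" if x: "x \<in> M" "x \<in> ball p \<delta>1" "pos e x > T" for x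
  proof (rule ccontr)
    assume "\<not> 0 < w x"
    then have wx: "k * \<phi>0 (refl e T x) \<ge> 0" by (simp add: w_def)
    define s where "s = pos e x - T"
    have s: "s > 0" using x by (simp add: s_def)
    define h where "h = (\<lambda>t. k * \<phi>0 (x - t *\<^sub>R e))"
    have rx: "refl e T x = x - (2 * s) *\<^sub>R e" by (simp add: refl_def s_def algebra_simps)
    have rxb: "refl e T x \<in> ball p \<delta>1" using dist_refl[OF e(1), of T p x] x(2) rp by simp
    have seg: "x - t *\<^sub>R e \<in> ball p \<delta>1" if t: "0 \<le> t" "t \<le> 2 * s" for t
    proof -
      have "x - t *\<^sub>R e = (1 - t / (2 * s)) *\<^sub>R x + (t / (2 * s)) *\<^sub>R refl e T x"
        unfolding rx using s by (simp add: algebra_simps)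
      moreover have "t / (2 * s) \<le> 1" "0 \<le> t / (2 * s)" using t s by auto
      ultimately show ?thesis
        using convexD[OF convex_ball x(2) rxb, of "1 - t / (2 * s)" "t / (2 * s)"] by simp
    qed
    have hd: "(h has_real_derivative - (k * (G0 (x - t *\<^sub>R e) \<bullet> e))) (at t)" if t: "0 \<le> t" "t \<le> 2 * s" for t
    proof -
      have "((\<lambda>t. x - t *\<^sub>R e) has_derivative (\<lambda>s. - (s *\<^sub>R e))) (at t)"
        by (auto intro!: derivative_eq_intros)
      from has_derivative_mult_right[OF has_derivative_compose[OF this cD(3)[OF sub1[OF seg[OF t]]]], of k]
      show ?thesis unfolding h_def by (intro has_real_derivative_scaleI) (simp add: mult_ac)
    qed
    have cont: "continuous_on {a..b} h" if "0 \<le> a" "b \<le> 2 * s" for a b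
      using that by (intro continuous_at_imp_continuous_on ballI DERIV_isCont[OF hd]) auto
    have h0: "h 0 = 0" using zero sub1[OF x(2)] x(1) by (simp add: h_def)
    have "h s < h 0"
    proof (rule DERIV_neg_imp_decreasing_open[OF s])
      fix t assume t: "0 < t" "t < s"
      have "pos e (x - t *\<^sub>R e) > T" using pos_add[OF e(1), of x "- t"] t by (simp add: s_def)
      then have "x - t *\<^sub>R e \<in> U" using seg[of t] t s by (simp add: U_def)
      then have "k * (G0 (x - t *\<^sub>R e) \<bullet> e) > 0" using kpos by blast
      then show "\<exists>y. (h has_real_derivative y) (at t) \<and> y < 0"
        using hd[of t] t s by (intro exI[of _ "- (k * (G0 (x - t *\<^sub>R e) \<bullet> e))"]) auto
    next
      show "continuous_on {0..s} h" by (rule cont) (use s in auto)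
    qed
    then have hs: "h s < 0" using h0 by simp
    have h2: "h (2 * s) \<ge> 0" using wx by (simp add: h_def rx)
    have "\<exists>t\<ge>s. t \<le> 2 * s \<and> h t = 0"
      by (rule IVT') (use hs h2 s cont[of s "2 * s"] in auto)
    then obtain t where t: "s \<le> t" "t \<le> 2 * s" "h t = 0" by blast
    have "x - t *\<^sub>R e \<in> ball p \<delta>" using sub1[OF seg] t s by simp
    moreover have "\<phi>0 (x - t *\<^sub>R e) = 0" using t(3) k by (auto simp: h_def)
    ultimately have yM: "x - t *\<^sub>R e \<in> M" using zero by blast
    have "pos e x + pos e (x - t *\<^sub>R e) < 2 * T"
      by (rule P1'[OF x(1) yM, of t]) (use t s in auto)
    then show False using pos_add[OF e(1), of x "- t"] t s by (simp add: s_def)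
  qed
  have wzero: "w x = 0" if "x \<in> M" "x \<in> ball p \<delta>1" "pos e x = T" for x
    using zero sub1[OF that(2)] that by (simp add: w_def refl_def)
  have nz: "- k *\<^sub>R rfl e (G0 (refl e T p)) \<noteq> 0" unfolding Gwp using k \<nu>(1) by auto
  obtain \<delta>' where \<delta>': "\<delta>' > 0" "\<delta>' \<le> \<delta>"
    and nG: "\<forall>x\<in>ball p \<delta>'. norm (- k *\<^sub>R rfl e (G0 (refl e T x)) - - k *\<^sub>R rfl e (G0 (refl e T p))) \<le> norm (- k *\<^sub>R rfl e (G0 (refl e T p))) / 16"
    and cmp: "\<forall>q m r H. barrier_admissible (ball p \<delta>') w (- k *\<^sub>R rfl e (G0 (refl e T p))) H q m r
      \<longrightarrow> (\<exists>\<epsilon>>0. \<exists>\<beta>>0. \<forall>x\<in>M \<inter> H \<inter> cball q (r / 2). \<epsilon> * barrier \<beta> r m x \<le> w x)"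
    by (rule barrier_comparison[OF p(1) cfw dis nz])
  obtain \<delta>c where \<delta>c: "\<delta>c > 0" "\<And>x. \<lbrakk>x \<in> M; dist x p < \<delta>c\<rbrakk> \<Longrightarrow> \<bar>(x - p) \<bullet> \<nu>\<bar> \<le> 1 / 4 * norm (x - p)"
    using chord_almost_tangent[OF p(1), of "1 / 4"] p(1) unfolding \<nu>_def by (metis dist_self zero_less_divide_1_iff zero_less_numeral)
  define r where "r = Min {\<delta>', \<delta>1, \<delta>c}"
  have r: "r > 0" "r \<le> \<delta>'" "r \<le> \<delta>1" "r \<le> \<delta>c" using \<delta>' \<delta>1 \<delta>c by (auto simp: r_def)
  \<comment> \<open>The sphere of radius \<open>r\<close> about \<open>m\<close> is tangent to the
    mirror plane at \<open>p\<close>, and its closed ball touches that plane only there.\<close>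
  define m where "m = p + r *\<^sub>R e"
  define H where "H = {x. pos e x \<ge> T}"
  have dm: "r / 2 \<le> norm (x - m)" if "x \<in> cball p (r / 2)" for x
  proof -
    have "norm (p - m) = r" using e r by (simp add: m_def)
    then show ?thesis using norm_triangle_ineq[of "x - m" "p - x"] that by (simp add: dist_norm)
  qed
  have inside: "pos e x > T" if x: "dist x m \<le> r" "x \<noteq> p" for x
  proof -
    define y where "y = x - p"
    have "(norm (y - r *\<^sub>R e))\<^sup>2 \<le> r\<^sup>2"
      using x(1) r by (intro power_mono) (auto simp: y_def m_def dist_norm algebra_simps)
    moreover have "(norm (y - r *\<^sub>R e))\<^sup>2 = (norm y)\<^sup>2 + r\<^sup>2 - 2 * (r * (y \<bullet> e))"
      using dot_norm_neg[of y "r *\<^sub>R e"] e r by simp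
    moreover have "(norm y)\<^sup>2 > 0" using x(2) by (simp add: y_def)
    ultimately have "r * (y \<bullet> e) > 0" by linarith
    then have "y \<bullet> e > 0" using r(1) by (simp add: zero_less_mult_iff)
    then show ?thesis using p(3) by (simp add: y_def pos_def inner_diff_left)
  qed
  have "\<exists>\<epsilon>>0. \<exists>\<beta>>0. \<forall>x\<in>M \<inter> H \<inter> cball p (r / 2). \<epsilon> * barrier \<beta> r m x \<le> w x"
  proof (rule cmp[rule_format], unfold barrier_admissible_def, intro conjI ballI impI)
    show "r > 0" "cball p (r / 2) \<subseteq> ball p \<delta>'" using r by auto
    show "dist p m = r" using e r by (simp add: m_def dist_norm)
    show "closed H" unfolding H_def
      by (intro closed_Collect_le continuous_on_const continuous_at_imp_continuous_on ballI has_derivative_continuous[OF pos_has_derivative])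
    show "\<bar>(x - m) \<bullet> (- k *\<^sub>R rfl e (G0 (refl e T p)))\<bar> \<le> 1 / 4 * (norm (x - m) * norm (- k *\<^sub>R rfl e (G0 (refl e T p))))"
      if x: "x \<in> M \<inter> cball p (r / 2)" for x
    proof -
      have "x - m = (x - p) - r *\<^sub>R e" by (simp add: m_def)
      then have "(x - m) \<bullet> \<nu> = (x - p) \<bullet> \<nu> - r * (e \<bullet> \<nu>)"
        by (simp only: inner_diff_left[of "x - p"] inner_scaleR_left)
      then have "(x - m) \<bullet> \<nu> = (x - p) \<bullet> \<nu>" using \<nu>(3) inner_commute[of e \<nu>] by simp
      moreover have "\<bar>(x - p) \<bullet> \<nu>\<bar> \<le> 1 / 4 * norm (x - p)" using \<delta>c(2)[of x] x r by (auto simp: dist_commute)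
      moreover have "norm (x - p) \<le> norm (x - m)" using x dm[of x] by (simp add: dist_norm norm_minus_commute)
      ultimately have "\<bar>(x - m) \<bullet> \<nu>\<bar> \<le> 1 / 4 * norm (x - m)" by linarith
      then show ?thesis unfolding Gwp using k \<nu>(1) by auto
    qed
    show "0 \<le> w x" if x: "x \<in> M \<inter> H \<inter> cball p (r / 2)" for x
    proof -
      have xb: "x \<in> M" "x \<in> ball p \<delta>1" "pos e x \<ge> T" using x r by (auto simp: H_def)
      show ?thesis using wpos[OF xb(1,2)] wzero[OF xb(1,2)] xb(3) by (cases "pos e x = T") auto
    qed
    show "0 < w x" if x: "x \<in> M \<inter> H \<inter> cball p (r / 2)" "dist x m \<le> r \<and> x \<noteq> p" for x
      using wpos[of x] inside[of x] x r by auto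
    show "\<exists>e>0. M \<inter> ball x e \<subseteq> H" if x: "x \<in> M \<inter> H \<inter> cball p (r / 2)" "dist x m < r" for x
    proof -
      have "x \<noteq> p" using x(2) e r by (auto simp: m_def dist_norm)
      then have s: "pos e x > T" using inside[of x] x by simp
      have "y \<in> H" if "y \<in> ball x (pos e x - T)" for y
        using abs_pos_diff_le[OF e(1), of x y] that by (simp add: H_def)
      then show ?thesis using s by (intro exI[of _ "pos e x - T"]) auto
    qed
  qed
  then obtain \<epsilon> \<beta> where \<epsilon>: "\<epsilon> > 0" "\<beta> > 0" and lower: "\<forall>x\<in>M \<inter> H \<inter> cball p (r / 2). \<epsilon> * barrier \<beta> r m x \<le> w x"
    by blast
  obtain \<gamma> d where d: "d > 0" and \<gamma>0: "\<gamma> 0 = p" and \<gamma>d: "(\<gamma> has_derivative (\<lambda>s. s *\<^sub>R e)) (at 0)"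
    and \<gamma>M: "\<forall>t::real. \<bar>t\<bar> < d \<longrightarrow> \<gamma> t \<in> M"
    by (rule curve_in_surface[OF p(1) pb p(2)])
  define f where "f = (\<lambda>t. w (\<gamma> t) - \<epsilon> * barrier \<beta> r m (\<gamma> t))"
  define b where "b = 2 * \<beta> * exp (- \<beta> * ((p - m) \<bullet> (p - m)))"
  have b: "b > 0" using \<epsilon> by (simp add: b_def)
  have bg: "barrier_grad \<beta> m p = (b * r) *\<^sub>R e" by (simp add: barrier_grad_def b_def) (simp add: m_def)
  \<comment> \<open>The gradient of \<open>w\<close> at \<open>p\<close> is a multiple of
    \<open>\<nu>\<close>, so \<open>w\<close> has slope zero along \<open>e\<close>, while the
    barrier has positive slope. Hence \<open>w\<close> cannot stay above it as \<open>lower\<close>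
    demands.\<close>
  have fd: "(f has_real_derivative - (\<epsilon> * (b * r))) (at 0)"
  proof -
    have w1: "(w has_derivative (\<lambda>h. (- k *\<^sub>R \<nu>) \<bullet> h)) (at (\<gamma> 0))"
      using comparison_functionD(3)[OF cfw pball] unfolding Gwp \<gamma>0 .
    have b1: "(barrier \<beta> r m has_derivative (\<lambda>h. ((b * r) *\<^sub>R e) \<bullet> h)) (at (\<gamma> 0))"
      using barrier_has_derivative[of \<beta> r m p] unfolding bg \<gamma>0 .
    have "(f has_derivative (\<lambda>s. (- k *\<^sub>R \<nu>) \<bullet> (s *\<^sub>R e) - \<epsilon> * (((b * r) *\<^sub>R e) \<bullet> (s *\<^sub>R e)))) (at 0)"
      unfolding f_def
      by (intro has_derivative_diff has_derivative_mult_right has_derivative_compose[OF \<gamma>d w1] has_derivative_compose[OF \<gamma>d b1])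
    then show ?thesis using \<nu>(3) ee by (intro has_real_derivative_scaleI) (simp add: mult_ac)
  qed
  have pd: "((\<lambda>t. pos e (\<gamma> t)) has_real_derivative 1) (at 0)"
    using has_derivative_compose[OF \<gamma>d pos_has_derivative[of e]] ee by (intro has_real_derivative_scaleI) simp
  obtain d3 where d3: "d3 > 0" "\<And>h. \<lbrakk>h > 0; h < d3\<rbrakk> \<Longrightarrow> pos e (\<gamma> 0) < pos e (\<gamma> (0 + h))"
    using DERIV_pos_inc_right[OF pd] by auto
  have "isCont \<gamma> 0" using \<gamma>d has_derivative_continuous by blast
  then have "\<forall>\<^sub>F t in at 0. dist (\<gamma> t) (\<gamma> 0) < r / 2" using r(1) tendstoD[of \<gamma> "\<gamma> 0" "at 0" "r / 2"] by (simp add: continuous_at)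
  then obtain d4 where d4: "d4 > 0" "\<And>t. t \<noteq> 0 \<Longrightarrow> dist t 0 < d4 \<Longrightarrow> dist (\<gamma> t) p < r / 2"
    unfolding eventually_at using \<gamma>0 by auto
  have bp: "barrier \<beta> r m p = 0" using e by (simp add: barrier_def m_def dot_square_norm)
  have wp: "w p = 0" using wzero[OF p(1) _ p(3)] \<delta>1 by simp
  have "0 \<le> - (\<epsilon> * (b * r))"
  proof (rule right_derivative_nonneg[OF fd])
    show "f 0 = 0" by (simp add: f_def \<gamma>0 bp wp)
    show "Min {d, d3, d4} > 0" using d d3 d4 by simp
    fix t assume t: "0 \<le> t" "t < Min {d, d3, d4}"
    show "0 \<le> f t"
    proof (cases "t = 0")
      case True then show ?thesis by (simp add: f_def \<gamma>0 bp wp)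
    next
      case False
      then have "\<gamma> t \<in> M" "pos e (\<gamma> t) > T" "dist (\<gamma> t) p < r / 2"
        using t \<gamma>M d3(2)[of t] d4(2)[of t] \<gamma>0 p(3) by auto
      then have "\<gamma> t \<in> M \<inter> H \<inter> cball p (r / 2)" by (auto simp: H_def dist_commute)
      then show ?thesis using lower by (force simp: f_def)
    qed
  qed
  then show False using \<epsilon> b r by (simp add: mult_le_0_iff)
qed

text \<open>Let \<open>T\<close> be the largest midpoint position over all chords and tangency
  points in direction \<open>e\<close>, attained by compactness. A tangency point at positive
  position would make \<open>T\<close> positive, and the maximizer would be a contact of one of the
  two excluded kinds. Reversing \<open>e\<close> gives the other inequality.\<close>

lemma tangent_direction_orthogonal:
  assumes e: "norm e = 1" "e $ 3 = 0" and p: "p \<in> M" "N p \<bullet> e = 0"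
  shows "pos e p = 0"
proof -
  have le: "pos e p \<le> 0" if e: "norm e = 1" "e $ 3 = 0" and Ne: "N p \<bullet> e = 0" for e
  proof (rule ccontr)
    assume "\<not> pos e p \<le> 0"
    have pp: "(p, p) \<in> chords e" using p(1) Ne by (auto simp: chords_def intro!: exI[of _ 0])
    have "continuous_on (chords e) (\<lambda>x. pos e (fst x) + pos e (snd x))"
      unfolding pos_def by (intro continuous_intros)
    then obtain x where x: "x \<in> chords e" "\<And>y. y \<in> chords e \<Longrightarrow> pos e (fst y) + pos e (snd y) \<le> pos e (fst x) + pos e (snd x)"
      using continuous_attains_sup[OF compact_chords[OF e(1)]] pp by blast
    define T where "T = (pos e (fst x) + pos e (snd x)) / 2"
    have T: "T > 0" using x(2)[OF pp] \<open>\<not> pos e p \<le> 0\<close> by (simp add: T_def)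
    have P1: "\<forall>p\<in>M. \<forall>q\<in>M. \<forall>l>0. p = q + l *\<^sub>R e \<longrightarrow> pos e p + pos e q \<le> 2 * T"
    proof (intro ballI allI impI)
      fix p q l assume that: "p \<in> M" "q \<in> M" "l > 0" "p = q + l *\<^sub>R e"
      have "(p, q) \<in> chords e" unfolding chords_def using that by (auto intro!: exI[of _ l])
      from x(2)[OF this] show "pos e p + pos e q \<le> 2 * T" by (simp add: T_def)
    qed
    have P2: "\<forall>p\<in>M. N p \<bullet> e = 0 \<longrightarrow> pos e p \<le> T"
    proof (intro ballI impI)
      fix p assume that: "p \<in> M" "N p \<bullet> e = 0"
      have "(p, p) \<in> chords e" unfolding chords_def using that by (auto intro!: exI[of _ 0])
      from x(2)[OF this] show "pos e p \<le> T" by (simp add: T_def)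
    qed
    obtain l where l: "fst x \<in> M" "snd x \<in> M" "l \<ge> 0" "fst x = snd x + l *\<^sub>R e" "l = 0 \<Longrightarrow> N (fst x) \<bullet> e = 0"
    proof -
      have "fst x \<in> M \<and> snd x \<in> M \<and> (\<exists>l\<ge>0. fst x = snd x + l *\<^sub>R e \<and> (l = 0 \<longrightarrow> N (fst x) \<bullet> e = 0))"
        using x(1) by (simp only: chords_def mem_Collect_eq split_beta)
      then show ?thesis using that by blast
    qed
    show False
    proof (cases "l = 0")
      case True
      then have "pos e (fst x) = T" using l by (simp add: T_def)
      then show False using no_tangential_contact[OF e T P1 P2 l(1) l(5)[OF True]] by blast
    next
      case False
      then show False using no_contact_of_distinct_points[OF e T P1 P2 l(1,2,4)] l(3) by (simp add: T_def)
    qed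
  qed
  have "pos (- e) p \<le> 0" by (rule le) (use e p in auto)
  then show ?thesis using le[OF e p(2)] by (simp add: pos_def)
qed

end

section \<open>Rotation invariance\<close>

text \<open>The function \<open>f s * f s * exp (k * s)\<close> is nonnegative, vanishes at
  \<open>a\<close>, and does not increase as \<open>s\<close> moves away from \<open>a\<close>, with
  \<open>k\<close> equal to \<open>- 2 * K\<close> to the right and \<open>2 * K\<close> to the
  left.\<close>

lemma gronwall_zero:
  fixes f f' :: "real \<Rightarrow> real"
  assumes der: "\<And>t. \<bar>t - a\<bar> < d \<Longrightarrow> (f has_real_derivative f' t) (at t)"
    and bound: "\<And>t. \<bar>t - a\<bar> < d \<Longrightarrow> \<bar>f' t\<bar> \<le> K * \<bar>f t\<bar>"
    and zero: "f a = 0" and t: "\<bar>t - a\<bar> < d"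
  shows "f t = 0"
proof -
  have b: "\<bar>f s * f' s\<bar> \<le> K * (f s * f s)" if "\<bar>s - a\<bar> < d" for s
  proof -
    have "\<bar>f s\<bar> * \<bar>f' s\<bar> \<le> \<bar>f s\<bar> * (K * \<bar>f s\<bar>)" using bound[OF that] by (intro mult_left_mono) auto
    also have "\<dots> = K * (\<bar>f s\<bar> * \<bar>f s\<bar>)" by simp
    finally show ?thesis by (simp only: abs_mult_self_eq abs_mult)
  qed
  define g where "g = (\<lambda>k s. f s * f s * exp (k * s))"
  have gd: "(g k has_real_derivative (2 * (f s * f' s) + k * (f s * f s)) * exp (k * s)) (at s)"
    if "\<bar>s - a\<bar> < d" for k s
    unfolding g_def using der[OF that] by (auto intro!: derivative_eq_intros simp: algebra_simps)
  have ga: "g k a = 0" for k using zero by (simp add: g_def)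
  have "g k t \<le> 0" if k: "k = (if a \<le> t then - 2 * K else 2 * K)" for k
  proof (cases "a \<le> t")
    case True
    have "g k t \<le> g k a"
    proof (rule DERIV_nonpos_imp_nonincreasing[where f="g k", OF True])
      fix s assume s: "a \<le> s" "s \<le> t"
      then have sd: "\<bar>s - a\<bar> < d" using t by auto
      have "2 * (f s * f' s) + k * (f s * f s) \<le> 0" using b[OF sd] k True by auto
      then have "(2 * (f s * f' s) + k * (f s * f s)) * exp (k * s) \<le> 0" by (simp add: mult_le_0_iff)
      then show "\<exists>y. (g k has_real_derivative y) (at s) \<and> y \<le> 0" using gd[OF sd] by blast
    qed
    then show ?thesis using ga by simp
  next
    case False
    have "g k t \<le> g k a"
    proof (rule DERIV_nonneg_imp_nondecreasing[where f="g k"])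
      show "t \<le> a" using False by simp
      fix s assume s: "t \<le> s" "s \<le> a"
      then have sd: "\<bar>s - a\<bar> < d" using t by auto
      have "2 * (f s * f' s) + k * (f s * f s) \<ge> 0" using b[OF sd] k False by auto
      then have "(2 * (f s * f' s) + k * (f s * f s)) * exp (k * s) \<ge> 0" by simp
      then show "\<exists>y. (g k has_real_derivative y) (at s) \<and> y \<ge> 0" using gd[OF sd] by blast
    qed
    then show ?thesis using ga by simp
  qed
  then have "f t * f t \<le> 0" unfolding g_def by (metis exp_gt_zero mult_le_0_iff not_le)
  then show ?thesis by (metis mult_eq_0_iff order_antisym zero_le_square)
qed

section \<open>Rotations about a vertical axis and their generator\<close>

definition rot_gen :: "real^3 \<Rightarrow> real^3" where
  "rot_gen v = vector [- v $ 2, v $ 1, 0]"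

definition rot :: "real \<Rightarrow> real^3 \<Rightarrow> real^3" where
  "rot \<theta> v = vector [cos \<theta> * v $ 1 - sin \<theta> * v $ 2, sin \<theta> * v $ 1 + cos \<theta> * v $ 2, v $ 3]"

lemma rot_gen_nth [simp]: "rot_gen v $ 1 = - v $ 2" "rot_gen v $ 2 = v $ 1" "rot_gen v $ 3 = 0"
  by (simp_all add: rot_gen_def vector_def)

lemma rot_nth [simp]: "rot \<theta> v $ 1 = cos \<theta> * v $ 1 - sin \<theta> * v $ 2"
  "rot \<theta> v $ 2 = sin \<theta> * v $ 1 + cos \<theta> * v $ 2" "rot \<theta> v $ 3 = v $ 3"
  by (simp_all add: rot_def vector_def)

lemma rot_0 [simp]: "rot 0 v = v"
  by (simp add: vec_eq_iff forall_3)

lemma rot_inverse: "rot \<theta> (rot (- \<theta>) v) = v"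
proof -
  have s: "sin \<theta> * sin \<theta> = 1 - cos \<theta> * cos \<theta>"
    using sin_cos_squared_add[of \<theta>] by (simp add: power2_eq_square algebra_simps)
  have "cos \<theta> * (cos \<theta> * x + sin \<theta> * y) - sin \<theta> * (- sin \<theta> * x + cos \<theta> * y) = x"
    "sin \<theta> * (cos \<theta> * x + sin \<theta> * y) + cos \<theta> * (- sin \<theta> * x + cos \<theta> * y) = y" for x y
    using s by algebra+
  then show ?thesis by (simp add: vec_eq_iff forall_3)
qed

lemma norm_rot_gen_le: "norm (rot_gen v) \<le> norm v"
proof -
  have "rot_gen v \<bullet> rot_gen v \<le> v \<bullet> v" by (simp add: real3_inner)
  then show ?thesis by (simp add: norm_eq_sqrt_inner)
qed

lemma rot_has_derivative: "((\<lambda>\<theta>. rot \<theta> v) has_derivative (\<lambda>s. s *\<^sub>R rot_gen (rot \<theta> v))) (at \<theta>)"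
proof -
  have r: "rot \<theta> v = cos \<theta> *\<^sub>R hor v + sin \<theta> *\<^sub>R rot_gen v + (v $ 3) *\<^sub>R axis 3 1" for \<theta>
    by (simp add: vec_eq_iff forall_3 axis_def)
  have "((\<lambda>\<theta>. cos \<theta> *\<^sub>R hor v + sin \<theta> *\<^sub>R rot_gen v + (v $ 3) *\<^sub>R axis 3 1) has_derivative
      (\<lambda>s. (s * - sin \<theta>) *\<^sub>R hor v + (s * cos \<theta>) *\<^sub>R rot_gen v)) (at \<theta>)"
    by (auto intro!: derivative_eq_intros simp: fun_eq_iff)
  moreover have "(s * - sin \<theta>) *\<^sub>R hor v + (s * cos \<theta>) *\<^sub>R rot_gen v = s *\<^sub>R rot_gen (rot \<theta> v)" for s
    by (simp add: vec_eq_iff forall_3 algebra_simps)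
  ultimately show ?thesis by (simp add: r[abs_def])
qed

text \<open>Orthogonality and the fixed axis leave a two by two block. The sum of squares in the
  proof is the sum of its squared column norms minus twice its determinant, hence zero, which forces
  the form of a plane rotation.\<close>

lemma rotation_matrix_fixing_vertical:
  fixes A :: "real^3^3"
  assumes A: "rotation_matrix A" "A *v vertical = vertical"
  obtains \<theta> where "\<And>v. A *v v = rot \<theta> v"
proof -
  have c3: "A $ 1 $ 3 = 0" "A $ 2 $ 3 = 0" "A $ 3 $ 3 = 1"
    using A(2) by (simp_all add: vec_eq_iff forall_3 vertical_def matrix_vector_mult_def sum_3 vector_def)
  have orth: "transpose A ** A = mat 1" and det: "det A = 1"
    using A(1) by (simp_all add: rotation_matrix_def orthogonal_matrix)
  have ent: "(transpose A ** A) $ i $ j = A $ 1 $ i * A $ 1 $ j + A $ 2 $ i * A $ 2 $ j + A $ 3 $ i * A $ 3 $ j" for i j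
    by (simp add: matrix_matrix_mult_def transpose_def sum_3)
  have r3: "A $ 3 $ 1 = 0" "A $ 3 $ 2 = 0"
    using ent[of 1 3] ent[of 2 3] orth c3 by (simp_all add: mat_def)
  have n1: "A $ 1 $ 1 * A $ 1 $ 1 + A $ 2 $ 1 * A $ 2 $ 1 = 1"
    using ent[of 1 1] orth r3 by (simp add: mat_def)
  have n2: "A $ 1 $ 2 * A $ 1 $ 2 + A $ 2 $ 2 * A $ 2 $ 2 = 1"
    using ent[of 2 2] orth r3 by (simp add: mat_def)
  have d: "A $ 1 $ 1 * A $ 2 $ 2 - A $ 1 $ 2 * A $ 2 $ 1 = 1"
    using det c3 r3 by (simp add: det_3)
  have "(A $ 1 $ 1 - A $ 2 $ 2)\<^sup>2 + (A $ 1 $ 2 + A $ 2 $ 1)\<^sup>2 = 0"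
    using n1 n2 d by (simp add: power2_eq_square algebra_simps)
  then have eq: "A $ 2 $ 2 = A $ 1 $ 1" "A $ 1 $ 2 = - A $ 2 $ 1"
    by (simp_all add: sum_power2_eq_zero_iff)
  obtain \<theta> where "A $ 1 $ 1 = cos \<theta>" "A $ 2 $ 1 = sin \<theta>"
    using sincos_total_2pi[of "A $ 1 $ 1" "A $ 2 $ 1"] n1 by (metis power2_eq_square)
  then have "A *v v = rot \<theta> v" for v
    using c3 r3 eq by (simp add: vec_eq_iff forall_3 matrix_vector_mult_def sum_3)
  then show ?thesis using that by blast
qed

section \<open>Invariance of the surface under the rotation flow\<close>

context circle_sms
begin

text \<open>The quarter turn of the horizontal part of the normal is a horizontal tangent direction,
  hence orthogonal to \<open>p - c\<close>. As \<open>rot_gen\<close> is skew, the normal is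
  orthogonal to the rotation field. A vertical normal is so anyway.\<close>

lemma rot_gen_tangent:
  assumes p: "p \<in> M" shows "N p \<bullet> rot_gen (p - c) = 0"
proof (cases "N p $ 1 = 0 \<and> N p $ 2 = 0")
  case True then show ?thesis by (simp add: real3_inner)
next
  case False
  define v where "v = rot_gen (N p)"
  have v: "v \<noteq> 0" using False unfolding v_def vec_eq_iff forall_3 by auto
  define e where "e = v /\<^sub>R norm v"
  have "norm e = 1" using v by (simp add: e_def)
  moreover have "e $ 3 = 0" by (simp add: e_def v_def)
  moreover have "N p \<bullet> e = 0" by (simp add: e_def v_def real3_inner)
  ultimately have "pos e p = 0" using tangent_direction_orthogonal p by blast
  then have "(p - c) \<bullet> v = 0" using v by (simp add: pos_def e_def)
  then show ?thesis by (simp add: v_def real3_inner algebra_simps)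
qed

definition orbit :: "real^3 \<Rightarrow> real \<Rightarrow> real^3" where
  "orbit p \<theta> = c + rot \<theta> (p - c)"

lemma orbit_has_derivative: "(orbit p has_derivative (\<lambda>s. s *\<^sub>R rot_gen (orbit p \<theta> - c))) (at \<theta>)"
proof -
  have "(orbit p has_derivative (\<lambda>s. 0 + s *\<^sub>R rot_gen (rot \<theta> (p - c)))) (at \<theta>)"
    unfolding orbit_def by (intro has_derivative_add has_derivative_const rot_has_derivative)
  then show ?thesis by (simp add: orbit_def)
qed

lemma orbit_boundary: "orbit p \<theta> \<in> surface_boundary M \<longleftrightarrow> p \<in> surface_boundary M"
proof -
  have s: "sin \<theta> * sin \<theta> = 1 - cos \<theta> * cos \<theta>"
    using sin_cos_squared_add[of \<theta>] by (simp add: power2_eq_square algebra_simps)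
  have "(cos \<theta> * x - sin \<theta> * y) * (cos \<theta> * x - sin \<theta> * y) + (sin \<theta> * x + cos \<theta> * y) * (sin \<theta> * x + cos \<theta> * y)
      = x * x + y * y" for x y
    using s by algebra
  then have "axis_dist2 c (orbit p \<theta>) = axis_dist2 c p"
    by (simp add: axis_dist2_def hor_inner orbit_def)
  moreover have "orbit p \<theta> $ 3 = p $ 3" by (simp add: orbit_def)
  ultimately show ?thesis by (simp add: boundary_iff)
qed

text \<open>Along the orbit \<open>\<phi>\<close> satisfies a differential inequality with initial
  value zero. The rotation field is tangent to \<open>M\<close>, and shifting along
  \<open>\<nu>\<close> from \<open>M\<close> to the orbit point changes it by
  \<open>\<phi> x *\<^sub>R rot_gen \<nu>\<close>, so the derivative is at most
  \<open>K * \<bar>\<phi> x\<bar>\<close>.\<close>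

lemma orbit_stays_locally:
  assumes q: "orbit p a \<in> M" "orbit p a \<notin> surface_boundary M"
  shows "\<exists>d>0. \<forall>t. \<bar>t - a\<bar> < d \<longrightarrow> orbit p t \<in> M"
proof -
  define q where "q = orbit p a"
  define \<nu> where "\<nu> = N q"
  have qM: "q \<in> M" "q \<notin> surface_boundary M" using assms by (auto simp: q_def)
  have \<nu>: "norm \<nu> = 1" "\<nu> \<bullet> N q \<noteq> 0" using N_norm[OF qM(1)] by (auto simp: \<nu>_def)
  obtain \<phi> G A \<delta> K where cf: "comparison_function \<alpha> q \<delta> K \<phi> G A"
    and zero: "\<forall>x\<in>ball q \<delta>. x \<in> M \<longleftrightarrow> \<phi> x = 0"
    and shift: "\<forall>x\<in>ball q \<delta>. \<forall>t. x + t *\<^sub>R \<nu> \<in> ball q \<delta> \<longrightarrow> \<phi> (x + t *\<^sub>R \<nu>) = \<phi> x + t \<and> G (x + t *\<^sub>R \<nu>) = G x"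
    and G\<nu>: "\<forall>x\<in>ball q \<delta>. G x \<bullet> \<nu> = 1"
    and par: "\<forall>x\<in>ball q \<delta> \<inter> M. G x = (N x \<bullet> G x) *\<^sub>R N x"
    and dis: "ball q \<delta> \<inter> surface_boundary M = {}"
    by (rule defining_comparison_function[OF qM \<nu>(2,1)])
  note cD = comparison_functionD[OF cf]
  have qb: "q \<in> ball q \<delta>" using cD(1) by simp
  have \<phi>q: "\<phi> q = 0" using zero qb qM(1) by blast
  have "isCont (\<lambda>t. orbit p t) a" using orbit_has_derivative has_derivative_continuous by blast
  then have ev1: "\<forall>\<^sub>F t in at a. dist (orbit p t) q < \<delta> / 2"
    using cD(1) tendstoD[of "orbit p" q "at a" "\<delta> / 2"] by (simp add: continuous_at q_def)
  have "isCont (\<lambda>t. \<phi> (orbit p t)) a"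
    using has_derivative_continuous[OF has_derivative_compose[OF orbit_has_derivative cD(3)[OF qb, unfolded q_def]]] .
  then have ev2: "\<forall>\<^sub>F t in at a. dist (\<phi> (orbit p t)) 0 < \<delta> / 2"
    using cD(1) tendstoD[of "\<lambda>t. \<phi> (orbit p t)" 0 "at a" "\<delta> / 2"] \<phi>q by (simp add: continuous_at q_def)
  obtain d where d: "d > 0" "\<And>t. \<lbrakk>t \<noteq> a; dist t a < d\<rbrakk> \<Longrightarrow> dist (orbit p t) q < \<delta> / 2 \<and> dist (\<phi> (orbit p t)) 0 < \<delta> / 2"
    using eventually_conj[OF ev1 ev2] unfolding eventually_at by auto
  have d': "dist (orbit p t) q < \<delta> / 2" "\<bar>\<phi> (orbit p t)\<bar> < \<delta> / 2" if "\<bar>t - a\<bar> < d" for t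
    using d(2)[of t] that \<phi>q cD(1) by (cases "t = a"; auto simp: dist_real_def q_def)+
  have inb: "orbit p t \<in> ball q \<delta>" if "\<bar>t - a\<bar> < d" for t
    using d'(1)[OF that] cD(1) by (simp add: dist_commute)
  have fd: "((\<lambda>t. \<phi> (orbit p t)) has_real_derivative G (orbit p t) \<bullet> rot_gen (orbit p t - c)) (at t)"
    if "\<bar>t - a\<bar> < d" for t
    using has_derivative_compose[OF orbit_has_derivative cD(3)[OF inb[OF that]]]
    by (intro has_real_derivative_scaleI) simp
  have bound: "\<bar>G (orbit p t) \<bullet> rot_gen (orbit p t - c)\<bar> \<le> K * \<bar>\<phi> (orbit p t)\<bar>" if t: "\<bar>t - a\<bar> < d" for t
  proof -
    define x where "x = orbit p t"
    define y where "y = x + (- \<phi> x) *\<^sub>R \<nu>"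
    have xb: "x \<in> ball q \<delta>" using inb[OF t] by (simp add: x_def)
    have "dist q y \<le> dist q x + \<bar>\<phi> x\<bar>"
      using dist_triangle[of q y x] \<nu>(1) by (simp add: y_def dist_norm)
    then have yb: "y \<in> ball q \<delta>" using d'[OF t] by (simp add: x_def dist_commute)
    have "\<phi> y = 0" "G y = G x" using shift[rule_format, OF xb yb[unfolded y_def]] by (simp_all add: y_def)
    then have yM: "y \<in> M" using zero yb by blast
    have "G y = (N y \<bullet> G y) *\<^sub>R N y" using par yb yM by blast
    then have "G y \<bullet> rot_gen (y - c) = 0" using rot_gen_tangent[OF yM] by (metis inner_scaleR_left mult_zero_right)
    moreover have "rot_gen (x - c) = rot_gen (y - c) + \<phi> x *\<^sub>R rot_gen \<nu>"
      by (simp add: y_def vec_eq_iff forall_3)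
    ultimately have "G x \<bullet> rot_gen (x - c) = \<phi> x * (G x \<bullet> rot_gen \<nu>)"
      using \<open>G y = G x\<close> by (simp add: inner_add_right)
    moreover have "\<bar>G x \<bullet> rot_gen \<nu>\<bar> \<le> K"
    proof -
      have "\<bar>G x \<bullet> rot_gen \<nu>\<bar> \<le> norm (G x) * norm (rot_gen \<nu>)" by (rule Cauchy_Schwarz_ineq2)
      also have "\<dots> \<le> K * 1" using cD(2) cD(6)[OF xb] norm_rot_gen_le[of \<nu>] \<nu>(1) by (intro mult_mono) auto
      finally show ?thesis by simp
    qed
    ultimately have "\<bar>G x \<bullet> rot_gen (x - c)\<bar> \<le> K * \<bar>\<phi> x\<bar>"
      using mult_right_mono[of "\<bar>G x \<bullet> rot_gen \<nu>\<bar>" K "\<bar>\<phi> x\<bar>"] by (simp add: abs_mult mult.commute)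
    then show ?thesis by (simp add: x_def)
  qed
  have "\<phi> (orbit p t) = 0" if "\<bar>t - a\<bar> < d" for t
    using gronwall_zero[OF fd bound _ that] \<phi>q by (simp add: q_def)
  then have "orbit p t \<in> M" if "\<bar>t - a\<bar> < d" for t using zero inb that by blast
  then show ?thesis using d(1) by blast
qed

text \<open>The parameters at which the orbit lies in \<open>M\<close> form a closed set by
  compactness, and an open one because the circle is invariant and so is never met by the orbit of
  an interior point.\<close>

lemma orbit_in_surface:
  assumes p: "p \<in> M" shows "orbit p t \<in> M"
proof (cases "p \<in> surface_boundary M")
  case True
  then show ?thesis using orbit_boundary boundary_in_M by blast
next
  case False
  define S where "S = {t. orbit p t \<in> M}"
  have "continuous_on UNIV (orbit p)"
    using has_derivative_continuous[OF orbit_has_derivative] by (intro continuous_at_imp_continuous_on) auto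
  then have "closed (orbit p -` M)"
    using compact_imp_closed[OF compact_M] closed_vimage by blast
  then have "closed S" by (simp add: S_def vimage_def)
  moreover have "open S"
    unfolding open_dist
  proof
    fix a assume "a \<in> S"
    then have "\<exists>d>0. \<forall>t. \<bar>t - a\<bar> < d \<longrightarrow> orbit p t \<in> M"
      using False orbit_boundary by (intro orbit_stays_locally) (auto simp: S_def)
    then show "\<exists>e>0. \<forall>y. dist y a < e \<longrightarrow> y \<in> S" by (simp add: S_def dist_real_def)
  qed
  moreover have "0 \<in> S" using p by (simp add: S_def orbit_def)
  ultimately have "S = UNIV" using clopen[of S] by blast
  then show ?thesis by (auto simp: S_def)
qed

lemma is_surface_of_revolution: "surface_of_revolution M c vertical"
  unfolding surface_of_revolution_def
proof (intro conjI allI impI)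
  show "embedded_surface M" by (rule embedded)
  show "vertical \<noteq> 0" by (simp add: vec_eq_iff forall_3 vertical_def vector_def)
  fix A :: "real^3^3"
  assume "rotation_matrix A \<and> A *v vertical = vertical"
  then obtain \<theta> where A: "\<And>v. A *v v = rot \<theta> v" using rotation_matrix_fixing_vertical by blast
  have "x \<in> (\<lambda>x. c + A *v (x - c)) ` M" if "x \<in> M" for x
  proof -
    have "orbit x (- \<theta>) \<in> M" using orbit_in_surface[OF that] .
    moreover have "x = c + A *v (orbit x (- \<theta>) - c)" unfolding A by (simp add: orbit_def rot_inverse)
    ultimately show ?thesis by blast
  qed
  moreover have "c + A *v (x - c) \<in> M" if "x \<in> M" for x
    using orbit_in_surface[OF that, of \<theta>] by (simp add: A orbit_def)
  ultimately show "(\<lambda>x. c + A *v (x - c)) ` M = M" by blast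
qed

end

text \<open>For a unit vector \<open>v\<close> in the plane of the circle both
  \<open>c + r *\<^sub>R v\<close> and \<open>c - r *\<^sub>R v\<close> have height
  \<open>h\<close>, so \<open>v\<close> is horizontal and \<open>c\<close> has height
  \<open>h\<close>. Two independent such directions make the normal vertical.\<close>

lemma horizontal_circle:
  assumes "is_circle C" "C \<subseteq> {p. p $ 3 = h}"
  obtains c R where "R > 0" "\<And>p. p \<in> C \<longleftrightarrow> p $ 3 = c $ 3 \<and> axis_dist2 c p = R\<^sup>2"
proof -
  obtain c n r where n: "n \<noteq> 0" and r: "r > 0" and C: "C = {p. (p - c) \<bullet> n = 0 \<and> dist p c = r}"
    using assms(1) unfolding is_circle_def by blast
  define m where "m = n /\<^sub>R norm n"
  have m: "norm m = 1" using n by (simp add: m_def)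
  obtain f1 f2 where f: "norm f1 = 1" "norm f2 = 1" "f1 \<bullet> f2 = 0" "f1 \<bullet> m = 0" "f2 \<bullet> m = 0"
    using orthonormal_complement_basis[OF m] by metis
  have hor0: "v $ 3 = 0 \<and> c $ 3 = h" if v: "norm v = 1" "v \<bullet> m = 0" for v
  proof -
    have "v \<bullet> n = 0" using v(2) n by (simp add: m_def)
    then have "c + r *\<^sub>R v \<in> C" "c - r *\<^sub>R v \<in> C" using v(1) r by (auto simp: C dist_norm)
    then have "c $ 3 + r * v $ 3 = h" "c $ 3 - r * v $ 3 = h" using assms(2) by auto
    then have "2 * (r * v $ 3) = 0" "c $ 3 = h" by linarith+
    then show ?thesis using r by simp
  qed
  have "axis 3 1 = (axis 3 1 \<bullet> f1) *\<^sub>R f1 + (axis 3 1 \<bullet> f2) *\<^sub>R f2 + (axis 3 1 \<bullet> m) *\<^sub>R m"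
    by (rule real3_onb_expand) (use f m in auto)
  then have ax: "axis 3 1 = (m $ 3) *\<^sub>R m" using hor0 f by (simp add: inner_axis')
  have m12: "m $ 1 = 0" "m $ 2 = 0" and m3: "m $ 3 \<noteq> 0"
  proof -
    have "(axis 3 1 :: real^3) $ 3 = m $ 3 * m $ 3" by (subst ax) simp
    then show "m $ 3 \<noteq> 0" by auto
    have "(axis 3 1 :: real^3) $ 1 = m $ 3 * m $ 1" "(axis 3 1 :: real^3) $ 2 = m $ 3 * m $ 2"
      by (subst ax, simp)+
    then show "m $ 1 = 0" "m $ 2 = 0" using \<open>m $ 3 \<noteq> 0\<close> by (simp_all add: axis_def)
  qed
  have "p \<in> C \<longleftrightarrow> p $ 3 = c $ 3 \<and> axis_dist2 c p = r\<^sup>2" for p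
  proof -
    have "n = norm n *\<^sub>R m" using n by (simp add: m_def)
    then have "(p - c) \<bullet> n = norm n * ((p - c) \<bullet> m)" by (metis inner_scaleR_right)
    also have "(p - c) \<bullet> m = (p $ 3 - c $ 3) * m $ 3" by (simp add: real3_inner m12)
    finally have "(p - c) \<bullet> n = 0 \<longleftrightarrow> p $ 3 = c $ 3" using n m3 by simp
    moreover have "dist p c = r \<longleftrightarrow> (p - c) \<bullet> (p - c) = r\<^sup>2"
      using r by (simp add: dist_norm norm_eq_square)
    moreover have "(p - c) \<bullet> (p - c) = axis_dist2 c p" if "p $ 3 = c $ 3"
      using that by (simp add: axis_dist2_def hor_inner real3_inner)
    ultimately show ?thesis unfolding C by auto
  qed
  then show ?thesis using that r by blast
qed

theorem corollary5p3:
  fixes M \<Gamma> P :: "(real^3) set"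
  assumes "singular_minimal_surface M"
    and "compact M"
    and "surface_boundary M = \<Gamma>"
    and "is_circle \<Gamma>"
    and "horizontal_plane P"
    and "\<Gamma> \<subseteq> P"
  shows "\<exists>q. surface_of_revolution M q vertical"
proof -
  obtain \<alpha> N where \<alpha>: "\<alpha> \<noteq> 0" and s: "alpha_singular_minimal_surface \<alpha> M N"
    using assms(1) unfolding singular_minimal_surface_def by blast
  obtain h where "\<Gamma> \<subseteq> {p. p $ 3 = h}" using assms(5,6) unfolding horizontal_plane_def by auto
  then obtain c R where R: "R > 0" "\<And>p. p \<in> \<Gamma> \<longleftrightarrow> p $ 3 = c $ 3 \<and> axis_dist2 c p = R\<^sup>2"
    using horizontal_circle[OF assms(4)] by metis
  \<comment> \<open>Closedness lets a whole neighbourhood of an interior point avoid the boundary,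
    as the local arguments require.\<close>
  have "closed \<Gamma>"
  proof -
    have "\<Gamma> = {p. p $ 3 = c $ 3} \<inter> {p. axis_dist2 c p = R\<^sup>2}" using R(2) by auto
    moreover have "continuous_on UNIV (axis_dist2 c)"
      using has_derivative_continuous[OF axis_dist2_has_derivative] by (intro continuous_at_imp_continuous_on) auto
    ultimately show ?thesis
      by (auto intro!: closed_Int closed_Collect_eq continuous_intros)
  qed
  then interpret circle_sms M N \<alpha> c R
    using s \<alpha> R assms(2,3) unfolding alpha_singular_minimal_surface_def by unfold_locales auto
  show ?thesis using is_surface_of_revolution by blast
qed

end
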